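(* Let $(A,\mathfrak{m})$ be a Noetherian local ring with infinite residue field and let $M$ be a finitely generated Cohen-Macaulay $A$-module of dimension $r \geq 2$. Let $I$ be an ideal of definition for $M$ and let $x$ be $M$-superficial with respect to $I$. The following conditions are equivalent: (i) The Ratliff-Rush filtration on $M$ with respect to $I$ behaves well mod $x$. (ii) $H^{1}(L^{I}(M)) = 0$.
   Context: An ideal $I\subseteq\mathfrak m$ is an ideal of definition for $M$ if $M/IM$ has finite length. An element $x\in I$ is $M$-superficial with respect to $I$ if $(I^{n+1}M:_M x)=I^nM$ for all $n\gg 0$. The Ratliff-Rush filtration of a module $E$ with respect to $I$ is $\widetilde{I^nE}=\bigcup_{k\ge 1}(I^{n+k}E:_E I^k)$. With $N=M/xM$ and $\rho: M\to N$ the natural map, one always has $\rho(\widetilde{I^nM})\subseteq \widetilde{I^nN}$; the Ratliff-Rush filtration on $M$ with respect to $I$ "behaves well mod $x$" if $\rho(\widetilde{I^nM})=\widetilde{I^nN}$ for all $n\ge 1$. $\mathcal R(I)=A[It]=\bigoplus_{n\ge0}I^nt^n$ is the Rees algebra and $\mathfrak M=\mathfrak m\oplus \mathcal R(I)_+$. $L^I(M)=\bigoplus_{n\ge 0}M/I^{n+1}M$, with $M/I^{n+1}M$ in degree $n$; it is a (not finitely generated) graded $\mathcal R(I)$-module via the identification $L^I(M)(-1)=\bigoplus_{n\ge0}M/I^nM=M[t]/\bigoplus_{n\ge 0}I^nM\,t^n$. $H^i(-)$ denotes the $i$-th local cohomology $H^i_{\mathfrak M}(-)$. *)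

theory Defs
  imports
    "HOL-Algebra.UnivPoly"
    "HOL-Algebra.Ideal_Product"
    "HOL-Algebra.Ring_Divisibility"
    "HOL-Library.Extended_Nat"
begin

section \<open>Modules over a commutative ring\<close>

text \<open>The multiplicative part of a module record carries no meaning.\<close>

definition quot_module ::
    "('r, 'm, 'z) module_scheme \<Rightarrow> 'm set \<Rightarrow> ('r, 'm set) module" (infixl "QuotM" 65)
  where "M QuotM N =
    \<lparr>carrier = a_rcosets\<^bsub>M\<^esub> N, monoid.mult = undefined, one = undefined,
     zero = N, add = set_add M,
     smult = (\<lambda>a C. \<Union>x\<in>C. N +>\<^bsub>M\<^esub> (a \<odot>\<^bsub>M\<^esub> x))\<rparr>"

definition mod_hom ::
    "('r, 'x) ring_scheme \<Rightarrow> ('r, 'm, 'y) module_scheme \<Rightarrow> ('r, 'n, 'z) module_scheme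
      \<Rightarrow> ('m \<Rightarrow> 'n) set"
  where "mod_hom R M N =
    {h \<in> carrier M \<rightarrow> carrier N.
       (\<forall>x\<in>carrier M. \<forall>y\<in>carrier M. h (x \<oplus>\<^bsub>M\<^esub> y) = h x \<oplus>\<^bsub>N\<^esub> h y) \<and>
       (\<forall>a\<in>carrier R. \<forall>x\<in>carrier M. h (a \<odot>\<^bsub>M\<^esub> x) = a \<odot>\<^bsub>N\<^esub> h x)}"

definition mod_span ::
    "('r, 'x) ring_scheme \<Rightarrow> ('r, 'm, 'y) module_scheme \<Rightarrow> 'm set \<Rightarrow> 'm set"
  where "mod_span R M S = \<Inter>{N. submodule N R M \<and> S \<subseteq> N}"

definition fg_module :: "('r, 'x) ring_scheme \<Rightarrow> ('r, 'm, 'y) module_scheme \<Rightarrow> bool"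
  where "fg_module R M \<longleftrightarrow>
    module R M \<and> (\<exists>S. finite S \<and> S \<subseteq> carrier M \<and> mod_span R M S = carrier M)"

text \<open>Finite length, as the existence of a composition series.\<close>

definition finite_length :: "('r, 'x) ring_scheme \<Rightarrow> ('r, 'm, 'y) module_scheme \<Rightarrow> bool"
  where "finite_length R M \<longleftrightarrow>
    module R M \<and>
    (\<exists>n C. C 0 = {\<zero>\<^bsub>M\<^esub>} \<and> C n = carrier M \<and>
       (\<forall>i\<le>n. submodule (C i) R M) \<and>
       (\<forall>i<n. C i \<subset> C (Suc i) \<and>
          \<not> (\<exists>N. submodule N R M \<and> C i \<subset> N \<and> N \<subset> C (Suc i))))"

definition ideal_mult_module ::
    "('r, 'x) ring_scheme \<Rightarrow> 'r set \<Rightarrow> ('r, 'm, 'y) module_scheme \<Rightarrow> 'm set"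
  where "ideal_mult_module R I M =
    mod_span R M {a \<odot>\<^bsub>M\<^esub> m | a m. a \<in> I \<and> m \<in> carrier M}"

definition elem_mult_module :: "'r \<Rightarrow> ('r, 'm, 'y) module_scheme \<Rightarrow> 'm set"
  where "elem_mult_module x M = (\<lambda>m. x \<odot>\<^bsub>M\<^esub> m) ` carrier M"

primrec ideal_power :: "('r, 'x) ring_scheme \<Rightarrow> 'r set \<Rightarrow> nat \<Rightarrow> 'r set"
  where
    "ideal_power R I 0 = carrier R"
  | "ideal_power R I (Suc n) = ideal_prod R I (ideal_power R I n)"

text \<open>\<open>colon_module M N S\<close> is $(N :_M S)$.\<close>

definition colon_module :: "('r, 'm, 'y) module_scheme \<Rightarrow> 'm set \<Rightarrow> 'r set \<Rightarrow> 'm set"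
  where "colon_module M N S = {m \<in> carrier M. \<forall>a\<in>S. a \<odot>\<^bsub>M\<^esub> m \<in> N}"

definition module_ann :: "('r, 'x) ring_scheme \<Rightarrow> ('r, 'm, 'y) module_scheme \<Rightarrow> 'r set"
  where "module_ann R M = {a \<in> carrier R. \<forall>m\<in>carrier M. a \<odot>\<^bsub>M\<^esub> m = \<zero>\<^bsub>M\<^esub>}"


section \<open>Local rings, dimension, depth, Cohen--Macaulay modules\<close>

definition local_ring :: "('r, 'x) ring_scheme \<Rightarrow> 'r set \<Rightarrow> bool"
  where "local_ring R \<mm> \<longleftrightarrow>
    cring R \<and> maximalideal \<mm> R \<and> (\<forall>J. maximalideal J R \<longrightarrow> J = \<mm>)"

text \<open>Krull dimension of $R/\mathrm{ann}(M)$.\<close>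

definition module_dim :: "('r, 'x) ring_scheme \<Rightarrow> ('r, 'm, 'y) module_scheme \<Rightarrow> enat"
  where "module_dim R M =
    Sup {enat n | n. \<exists>P :: nat \<Rightarrow> 'r set.
       (\<forall>i\<le>n. primeideal (P i) R \<and> module_ann R M \<subseteq> P i) \<and> (\<forall>i<n. P i \<subset> P (Suc i))}"

definition nonzerodivisor_on :: "'r \<Rightarrow> ('r, 'm, 'y) module_scheme \<Rightarrow> bool"
  where "nonzerodivisor_on x M \<longleftrightarrow>
    (\<forall>m\<in>carrier M. x \<odot>\<^bsub>M\<^esub> m = \<zero>\<^bsub>M\<^esub> \<longrightarrow> m = \<zero>\<^bsub>M\<^esub>)"

definition regular_sequence ::
    "('r, 'x) ring_scheme \<Rightarrow> ('r, 'm, 'y) module_scheme \<Rightarrow> 'r list \<Rightarrow> bool"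
  where "regular_sequence R M xs \<longleftrightarrow>
    set xs \<subseteq> carrier R \<and>
    (\<forall>i<length xs.
       nonzerodivisor_on (xs ! i) (M QuotM ideal_mult_module R (Idl\<^bsub>R\<^esub> (set (take i xs))) M)) \<and>
    ideal_mult_module R (Idl\<^bsub>R\<^esub> (set xs)) M \<noteq> carrier M"

definition module_depth ::
    "('r, 'x) ring_scheme \<Rightarrow> 'r set \<Rightarrow> ('r, 'm, 'y) module_scheme \<Rightarrow> enat"
  where "module_depth R \<mm> M =
    Sup {enat (length xs) | xs. set xs \<subseteq> \<mm> \<and> regular_sequence R M xs}"

definition cohen_macaulay_module ::
    "('r, 'x) ring_scheme \<Rightarrow> 'r set \<Rightarrow> ('r, 'm, 'y) module_scheme \<Rightarrow> bool"
  where "cohen_macaulay_module R \<mm> M \<longleftrightarrow>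
    fg_module R M \<and> module_depth R \<mm> M = module_dim R M"


section \<open>Ideals of definition, superficial elements, Ratliff--Rush filtration\<close>

definition ideal_of_definition ::
    "('r, 'x) ring_scheme \<Rightarrow> 'r set \<Rightarrow> 'r set \<Rightarrow> ('r, 'm, 'y) module_scheme \<Rightarrow> bool"
  where "ideal_of_definition R \<mm> I M \<longleftrightarrow>
    ideal I R \<and> I \<subseteq> \<mm> \<and> finite_length R (M QuotM ideal_mult_module R I M)"

definition superficial ::
    "('r, 'x) ring_scheme \<Rightarrow> 'r set \<Rightarrow> ('r, 'm, 'y) module_scheme \<Rightarrow> 'r \<Rightarrow> bool"
  where "superficial R I M x \<longleftrightarrow>
    x \<in> I \<and>
    (\<exists>n0. \<forall>n\<ge>n0.
       colon_module M (ideal_mult_module R (ideal_power R I (n + 1)) M) {x} =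
       ideal_mult_module R (ideal_power R I n) M)"

definition ratliff_rush ::
    "('r, 'x) ring_scheme \<Rightarrow> 'r set \<Rightarrow> ('r, 'm, 'y) module_scheme \<Rightarrow> nat \<Rightarrow> 'm set"
  where "ratliff_rush R I E n =
    (\<Union>k\<in>{1..}. colon_module E (ideal_mult_module R (ideal_power R I (n + k)) E)
                 (ideal_power R I k))"

definition ratliff_rush_behaves_well ::
    "('r, 'x) ring_scheme \<Rightarrow> 'r set \<Rightarrow> ('r, 'm, 'y) module_scheme \<Rightarrow> 'r \<Rightarrow> bool"
  where "ratliff_rush_behaves_well R I M x \<longleftrightarrow>
    (\<forall>n\<ge>1.
       (\<lambda>m. elem_mult_module x M +>\<^bsub>M\<^esub> m) ` ratliff_rush R I M n =
       ratliff_rush R I (M QuotM elem_mult_module x M) n)"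


section \<open>The Rees algebra and the module \<open>L\<^sup>I(M)\<close>\<close>

text \<open>$A[It]$ as a subring of $A[t]$; a polynomial is its coefficient function.\<close>

definition rees_algebra :: "('a, 'x) ring_scheme \<Rightarrow> 'a set \<Rightarrow> ('a, nat \<Rightarrow> 'a) up_ring"
  where "rees_algebra A I =
    (UP A)\<lparr>carrier := {p \<in> up A. \<forall>n. p n \<in> ideal_power A I n}\<rparr>"

definition rees_maximal_ideal ::
    "('a, 'x) ring_scheme \<Rightarrow> 'a set \<Rightarrow> 'a set \<Rightarrow> (nat \<Rightarrow> 'a) set"
  where "rees_maximal_ideal A \<mm> I = {p \<in> carrier (rees_algebra A I). p 0 \<in> \<mm>}"

text \<open>
  The direct sum of the $M/I^{n+1}M$. The action of the Rees algebra is the one induced from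
  the module $M[t]$ over $A[t]$: the $n$-th component of $p \cdot z$ is
  $\sum_{i \le n} p_i z_{n-i}$, where $p_i \in I^i$ maps the class of $m$ in $M/I^{n-i+1}M$ to
  the class of $p_i m$ in $M/I^{n+1}M$.
\<close>

definition L_comp ::
    "('a, 'x) ring_scheme \<Rightarrow> 'a set \<Rightarrow> ('a, 'm, 'y) module_scheme \<Rightarrow> nat \<Rightarrow> ('a, 'm set) module"
  where "L_comp A I M n = M QuotM ideal_mult_module A (ideal_power A I (n + 1)) M"

definition L_module ::
    "('a, 'x) ring_scheme \<Rightarrow> 'a set \<Rightarrow> ('a, 'm, 'y) module_scheme
      \<Rightarrow> (nat \<Rightarrow> 'a, nat \<Rightarrow> 'm set) module"
  where "L_module A I M =
    \<lparr>carrier = {z. (\<forall>n. z n \<in> carrier (L_comp A I M n)) \<and>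
                   finite {n. z n \<noteq> \<zero>\<^bsub>L_comp A I M n\<^esub>}},
     monoid.mult = undefined, one = undefined,
     zero = (\<lambda>n. \<zero>\<^bsub>L_comp A I M n\<^esub>),
     add = (\<lambda>z w n. z n \<oplus>\<^bsub>L_comp A I M n\<^esub> w n),
     smult = (\<lambda>p z n. \<Oplus>\<^bsub>L_comp A I M n\<^esub>i\<in>{..n}.
       (\<Union>m\<in>z (n - i).
          ideal_mult_module A (ideal_power A I (n + 1)) M +>\<^bsub>M\<^esub> (p i \<odot>\<^bsub>M\<^esub> m)))\<rparr>"


section \<open>Local cohomology as the right derived functor of the torsion functor\<close>

text \<open>
  The extension property is tested on modules \<open>V \<subseteq> W\<close> whose elements have the type of the
  ring elements. These include $R$ itself and its ideals, so by Baer's criterion the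
  property then holds for modules of every type.
\<close>

definition injective_module :: "('r, 'x) ring_scheme \<Rightarrow> ('r, 'b) module \<Rightarrow> bool"
  where "injective_module R E \<longleftrightarrow>
    module R E \<and>
    (\<forall>(V :: ('r, 'r) module) (W :: ('r, 'r) module) f g.
       module R V \<and> module R W \<and>
       f \<in> mod_hom R V W \<and> inj_on f (carrier V) \<and> g \<in> mod_hom R V E \<longrightarrow>
       (\<exists>h\<in>mod_hom R W E. \<forall>x\<in>carrier V. h (f x) = g x))"

definition injective_resolution ::
    "('r, 'x) ring_scheme \<Rightarrow> ('r, 'e) module \<Rightarrow> ('e \<Rightarrow> 'b)
      \<Rightarrow> (nat \<Rightarrow> ('r, 'b) module) \<Rightarrow> (nat \<Rightarrow> 'b \<Rightarrow> 'b) \<Rightarrow> bool"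
  where "injective_resolution R E \<epsilon> J d \<longleftrightarrow>
    module R E \<and>
    (\<forall>n. injective_module R (J n)) \<and>
    \<epsilon> \<in> mod_hom R E (J 0) \<and>
    (\<forall>n. d n \<in> mod_hom R (J n) (J (Suc n))) \<and>
    inj_on \<epsilon> (carrier E) \<and>
    \<epsilon> ` carrier E = {y \<in> carrier (J 0). d 0 y = \<zero>\<^bsub>J 1\<^esub>} \<and>
    (\<forall>n. d n ` carrier (J n) =
         {y \<in> carrier (J (Suc n)). d (Suc n) y = \<zero>\<^bsub>J (Suc (Suc n))\<^esub>})"

definition torsion_part ::
    "('r, 'x) ring_scheme \<Rightarrow> 'r set \<Rightarrow> ('r, 'm, 'y) module_scheme \<Rightarrow> 'm set"
  where "torsion_part R \<aa> E =
    {e \<in> carrier E. \<exists>n. \<forall>a\<in>ideal_power R \<aa> n. a \<odot>\<^bsub>E\<^esub> e = \<zero>\<^bsub>E\<^esub>}"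

definition torsion_cohomology ::
    "('r, 'x) ring_scheme \<Rightarrow> 'r set \<Rightarrow> (nat \<Rightarrow> ('r, 'b) module) \<Rightarrow> (nat \<Rightarrow> 'b \<Rightarrow> 'b)
      \<Rightarrow> nat \<Rightarrow> ('r, 'b set) module"
  where "torsion_cohomology R \<aa> J d i =
    (J i)\<lparr>carrier := {y \<in> torsion_part R \<aa> (J i). d i y = \<zero>\<^bsub>J (Suc i)\<^esub>}\<rparr> QuotM
    (case i of 0 \<Rightarrow> {\<zero>\<^bsub>J 0\<^esub>} | Suc j \<Rightarrow> d j ` torsion_part R \<aa> (J j))"

text \<open>
  Local cohomology is computed from a chosen injective resolution all of whose terms live in
  the type \<open>U = 'r list \<Rightarrow> 'e + nat\<close>. Every module \<open>E\<close> over any commutative ring has such a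
  resolution: \<open>E\<close> embeds in the injective module $\mathrm{Hom}_{\mathbb Z}(R, D)$, with $D$ the
  divisible hull of the additive group of \<open>E\<close>, and since \<open>U\<close> is infinite and has the same
  cardinality as \<open>'r \<Rightarrow> U\<close>, the embedding of any module of cardinality at most \<open>|U|\<close> stays
  within that cardinality. As for any derived functor, the result does not depend on the
  choice up to isomorphism.
\<close>

definition local_cohomology ::
    "('r, 'x) ring_scheme \<Rightarrow> 'r set \<Rightarrow> nat \<Rightarrow> ('r, 'e) module
      \<Rightarrow> ('r, ('r list \<Rightarrow> 'e + nat) set) module"
  where "local_cohomology R \<aa> i E =
    (let (J, d) = (SOME (J, d). \<exists>\<epsilon>. injective_resolution R E \<epsilon> J d)
     in torsion_cohomology R \<aa> J d i)"

end

theory Submission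
  imports Defs "HOL-Algebra.IntRing" "HOL-Algebra.Subrings"
begin

text \<open>
  Write $R = A[It]$ for the Rees algebra, $L = L^I(M)$, $N = M/xM$, and let $\varphi$ be
  multiplication by $xt$ on \<open>L\<close>. The cokernel of $\varphi$ is $L^I(N)$, and its kernel is
  $\bigoplus_n (I^{n+2}M :_M x)/I^{n+1}M$. The kernel vanishes in large degrees because \<open>x\<close>
  is superficial, and $M/I^{n+1}M$ is annihilated by a power of the maximal ideal in each of
  the remaining degrees, so $\mathfrak M^s$ annihilates it for some \<open>s\<close> and it does not affect
  cohomology in positive degrees. The degree \<open>n\<close> part of $H^0(L)$ is
  $\widetilde{I^{n+1}M}/I^{n+1}M$, and similarly for \<open>N\<close>. The Ratliff--Rush filtration
  therefore behaves well mod \<open>x\<close> iff $H^0(L) \to H^0(L^I(N))$ is onto. By the long exact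
  sequence this holds iff $\varphi$ acts injectively on $H^1(L)$. Every element of $H^1(L)$
  is killed by a power of $xt \in \mathfrak M$, so this injectivity means $H^1(L) = 0$.

  The proof replaces the long exact sequence by an explicit description of $H^1$. For every
  commutative ring and every ideal $\mathfrak a$ one has
  $H^1_{\mathfrak a}(E) = \varinjlim \mathrm{Ext}^1(R/\mathfrak a^n, E)$, and this module
  vanishes iff every homomorphism $\mathfrak a^n \to E$ becomes multiplication by an element
  of \<open>E\<close> on a smaller power of $\mathfrak a$
  (\<open>first_local_cohomology_zero_iff\<close>). The two implications become:

  \<^item> \<open>lifts_mod_if_scalar\<close>: if $u \in L$ is torsion modulo $\varphi(L)$, then
    $p \mapsto \varphi^{-1}(pu)$ is a homomorphism on some $\mathfrak M^K$. Here the preimage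
    is taken in large degrees, where $\varphi$ is injective. If this homomorphism is
    multiplication by \<open>z\<close>, then $u - \varphi(z)$ is torsion.
  \<^item> \<open>scalar_if_lifts_mod\<close>: for a homomorphism \<open>f\<close> on $\mathfrak M^n$, the map
    $\varphi^n \circ f$ is multiplication by $f((xt)^n)$. The factors $\varphi$ are removed one
    at a time: if $\varphi(f(p)) = pu$, then \<open>u\<close> is torsion modulo $\varphi(L)$, lifting gives
    \<open>z\<close> such that $u - \varphi(z)$ is torsion, and $f - z$ takes values in the kernel of
    $\varphi$ on a power of $\mathfrak M$, so it vanishes on a smaller power.

  Local cohomology is computed from a chosen injective resolution, which has to be shown to
  exist on the prescribed type. This is done by the classical embedding of a module into
  $\mathrm{Hom}_{\mathbb Z}(R, D)$ with \<open>D\<close> the divisible hull of its additive group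
  (\<open>divisible_hull\<close>, \<open>coinduced_module_injective\<close>), together with explicit encodings that keep
  all terms on that type (\<open>ex_injective_resolution\<close>).
\<close>

section \<open>Homomorphisms, quotients and images of modules\<close>

lemma mod_homI:
  assumes "\<And>x. x \<in> carrier M \<Longrightarrow> h x \<in> carrier N"
    and "\<And>x y. x \<in> carrier M \<Longrightarrow> y \<in> carrier M \<Longrightarrow> h (x \<oplus>\<^bsub>M\<^esub> y) = h x \<oplus>\<^bsub>N\<^esub> h y"
    and "\<And>a x. a \<in> carrier R \<Longrightarrow> x \<in> carrier M \<Longrightarrow> h (a \<odot>\<^bsub>M\<^esub> x) = a \<odot>\<^bsub>N\<^esub> h x"
  shows "h \<in> mod_hom R M N"
  using assms by (auto simp: mod_hom_def)

lemma mod_homD: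
  assumes "h \<in> mod_hom R M N"
  shows "x \<in> carrier M \<Longrightarrow> h x \<in> carrier N"
    and "x \<in> carrier M \<Longrightarrow> y \<in> carrier M \<Longrightarrow> h (x \<oplus>\<^bsub>M\<^esub> y) = h x \<oplus>\<^bsub>N\<^esub> h y"
    and "a \<in> carrier R \<Longrightarrow> x \<in> carrier M \<Longrightarrow> h (a \<odot>\<^bsub>M\<^esub> x) = a \<odot>\<^bsub>N\<^esub> h x"
  using assms by (auto simp: mod_hom_def)

lemma mod_hom_comp:
  assumes "g \<in> mod_hom R M N" "h \<in> mod_hom R N K"
  shows "(\<lambda>x. h (g x)) \<in> mod_hom R M K"
  using assms by (auto simp: mod_hom_def Pi_iff)

lemma additive_map_zero:
  assumes "abelian_group M" "abelian_group N"
    and cl: "\<And>x. x \<in> carrier M \<Longrightarrow> h x \<in> carrier N"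
    and add: "\<And>x y. x \<in> carrier M \<Longrightarrow> y \<in> carrier M \<Longrightarrow> h (x \<oplus>\<^bsub>M\<^esub> y) = h x \<oplus>\<^bsub>N\<^esub> h y"
  shows "h \<zero>\<^bsub>M\<^esub> = \<zero>\<^bsub>N\<^esub>"
    and "x \<in> carrier M \<Longrightarrow> h (\<ominus>\<^bsub>M\<^esub> x) = \<ominus>\<^bsub>N\<^esub> h x"
proof -
  interpret M: abelian_group M by fact
  interpret N: abelian_group N by fact
  have "h \<zero>\<^bsub>M\<^esub> \<oplus>\<^bsub>N\<^esub> h \<zero>\<^bsub>M\<^esub> = h \<zero>\<^bsub>M\<^esub>"
    using add[of "\<zero>\<^bsub>M\<^esub>" "\<zero>\<^bsub>M\<^esub>"] by simp
  then show z: "h \<zero>\<^bsub>M\<^esub> = \<zero>\<^bsub>N\<^esub>" using cl[of "\<zero>\<^bsub>M\<^esub>"] by (simp add: N.add.r_cancel_one)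
  assume x: "x \<in> carrier M"
  have "h (\<ominus>\<^bsub>M\<^esub> x) \<oplus>\<^bsub>N\<^esub> h x = \<zero>\<^bsub>N\<^esub>"
    using add[of "\<ominus>\<^bsub>M\<^esub> x" x] x z by (simp add: M.l_neg)
  then show "h (\<ominus>\<^bsub>M\<^esub> x) = \<ominus>\<^bsub>N\<^esub> h x" using cl x by (simp add: N.minus_equality)
qed

lemma mod_hom_zero:
  assumes "module R M" "module R N" "h \<in> mod_hom R M N"
  shows "h \<zero>\<^bsub>M\<^esub> = \<zero>\<^bsub>N\<^esub>"
    and "x \<in> carrier M \<Longrightarrow> h (\<ominus>\<^bsub>M\<^esub> x) = \<ominus>\<^bsub>N\<^esub> h x"
  using additive_map_zero[of M N h] assms mod_homD[OF assms(3)] by (auto simp: module_def)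

lemma mod_hom_diff:
  assumes "module R M" "module R N" "h \<in> mod_hom R M N" "x \<in> carrier M" "y \<in> carrier M"
  shows "h (x \<ominus>\<^bsub>M\<^esub> y) = h x \<ominus>\<^bsub>N\<^esub> h y"
proof -
  interpret M: module R M by fact
  show ?thesis
    using assms mod_homD[OF assms(3)] mod_hom_zero[OF assms(1-3)] by (simp add: a_minus_def)
qed

lemma (in module) diff_eq_zero_iff:
  assumes "x \<in> carrier M" "y \<in> carrier M"
  shows "x \<ominus>\<^bsub>M\<^esub> y = \<zero>\<^bsub>M\<^esub> \<longleftrightarrow> x = y"
  using assms by (metis M.add.inv_closed M.minus_equality M.minus_minus M.r_neg a_minus_def)

text \<open>All module axioms are equations, apart from the existence of negatives, which a surjection
  transports as well.\<close>

lemma module_surj_image: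
  assumes "module R M" and h: "h \<in> mod_hom R M N"
    and surj: "h ` carrier M = carrier N" and zero: "h \<zero>\<^bsub>M\<^esub> = \<zero>\<^bsub>N\<^esub>"
  shows "module R N"
proof -
  interpret M: module R M by fact
  note hD = mod_homD[OF h]
  note hD' = hD(2,3)[symmetric]
  have ex: "\<exists>x\<in>carrier M. y = h x" if "y \<in> carrier N" for y using that surj by blast
  have "abelian_group N"
  proof (rule abelian_groupI)
    show "\<zero>\<^bsub>N\<^esub> \<in> carrier N" using hD(1)[OF M.zero_closed] zero by simp
  next
    fix u v w assume "u \<in> carrier N" "v \<in> carrier N" "w \<in> carrier N"
    then show "u \<oplus>\<^bsub>N\<^esub> v \<oplus>\<^bsub>N\<^esub> w = u \<oplus>\<^bsub>N\<^esub> (v \<oplus>\<^bsub>N\<^esub> w)"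
      by (auto dest!: ex simp: hD' M.a_assoc)
  next
    fix u v assume "u \<in> carrier N" "v \<in> carrier N"
    then show "u \<oplus>\<^bsub>N\<^esub> v \<in> carrier N" "u \<oplus>\<^bsub>N\<^esub> v = v \<oplus>\<^bsub>N\<^esub> u"
      by (auto dest!: ex simp: hD' hD(1) M.a_comm)
  next
    fix u assume "u \<in> carrier N"
    then obtain x where x: "x \<in> carrier M" "u = h x" by (auto dest: ex)
    show "\<zero>\<^bsub>N\<^esub> \<oplus>\<^bsub>N\<^esub> u = u" using x by (simp add: zero[symmetric] hD')
    show "\<exists>y\<in>carrier N. y \<oplus>\<^bsub>N\<^esub> u = \<zero>\<^bsub>N\<^esub>"
      using x by (intro bexI[of _ "h (\<ominus>\<^bsub>M\<^esub> x)"]) (simp_all add: zero[symmetric] hD' hD(1) M.l_neg)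
  qed
  then show ?thesis
  proof (rule moduleI[OF M.is_cring])
    show "a \<odot>\<^bsub>N\<^esub> u \<in> carrier N" if "a \<in> carrier R" "u \<in> carrier N" for a u
      using that hD(1) by (auto dest!: ex simp: hD')
    show "(a \<oplus>\<^bsub>R\<^esub> b) \<odot>\<^bsub>N\<^esub> u = a \<odot>\<^bsub>N\<^esub> u \<oplus>\<^bsub>N\<^esub> b \<odot>\<^bsub>N\<^esub> u"
      if "a \<in> carrier R" "b \<in> carrier R" "u \<in> carrier N" for a b u
      using that by (auto dest!: ex simp: hD' M.smult_l_distr)
    show "a \<odot>\<^bsub>N\<^esub> (u \<oplus>\<^bsub>N\<^esub> v) = a \<odot>\<^bsub>N\<^esub> u \<oplus>\<^bsub>N\<^esub> a \<odot>\<^bsub>N\<^esub> v"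
      if "a \<in> carrier R" "u \<in> carrier N" "v \<in> carrier N" for a u v
      using that by (auto dest!: ex simp: hD' M.smult_r_distr)
    show "a \<otimes>\<^bsub>R\<^esub> b \<odot>\<^bsub>N\<^esub> u = a \<odot>\<^bsub>N\<^esub> (b \<odot>\<^bsub>N\<^esub> u)"
      if "a \<in> carrier R" "b \<in> carrier R" "u \<in> carrier N" for a b u
      using that by (auto dest!: ex simp: hD' M.smult_assoc1)
    show "\<one>\<^bsub>R\<^esub> \<odot>\<^bsub>N\<^esub> u = u" if "u \<in> carrier N" for u
      using that by (auto dest!: ex simp: hD')
  qed
qed

lemma (in module) submodule_abelian_subgroup:
  assumes "submodule N R M"
  shows "abelian_subgroup N M"
proof (rule abelian_subgroupI3)
  show "additive_subgroup N M"
    using assms by (auto intro: additive_subgroup.intro simp: submodule_def)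
  show "abelian_group M" by (rule M.abelian_group_axioms)
qed

lemma (in module) submodule_zero: "submodule N R M \<Longrightarrow> \<zero>\<^bsub>M\<^esub> \<in> N"
  by (metis additive_subgroup.zero_closed abelian_subgroup_def submodule_abelian_subgroup)

lemma (in module) submodule_diff:
  "submodule N R M \<Longrightarrow> x \<in> N \<Longrightarrow> y \<in> N \<Longrightarrow> x \<ominus>\<^bsub>M\<^esub> y \<in> N"
  using submoduleE[of N] by (auto simp: a_minus_def)

lemma (in module) coset_eq_iff:
  assumes N: "submodule N R M" and x: "x \<in> carrier M" and y: "y \<in> carrier M"
  shows "N +>\<^bsub>M\<^esub> x = N +>\<^bsub>M\<^esub> y \<longleftrightarrow> x \<ominus>\<^bsub>M\<^esub> y \<in> N"
proof -
  interpret S: abelian_subgroup N M using submodule_abelian_subgroup[OF N] .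
  have "N +>\<^bsub>M\<^esub> x = N +>\<^bsub>M\<^esub> y \<longleftrightarrow> x \<in> N +>\<^bsub>M\<^esub> y"
    using S.a_repr_independence'[OF _ y, of x] S.a_rcos_self[OF x] by auto
  also have "\<dots> \<longleftrightarrow> x \<ominus>\<^bsub>M\<^esub> y \<in> N"
  proof
    assume "x \<in> N +>\<^bsub>M\<^esub> y"
    then obtain n where n: "n \<in> N" "x = n \<oplus>\<^bsub>M\<^esub> y" by (auto simp: a_r_coset_def')
    then have "x \<ominus>\<^bsub>M\<^esub> y = n" using y S.a_subset by (auto simp: a_minus_def M.a_assoc M.r_neg)
    then show "x \<ominus>\<^bsub>M\<^esub> y \<in> N" using n by simp
  next
    assume n: "x \<ominus>\<^bsub>M\<^esub> y \<in> N"
    have "x = (x \<ominus>\<^bsub>M\<^esub> y) \<oplus>\<^bsub>M\<^esub> y" using x y by (simp add: a_minus_def M.a_assoc M.l_neg)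
    then show "x \<in> N +>\<^bsub>M\<^esub> y" using n by (auto simp: a_r_coset_def')
  qed
  finally show ?thesis .
qed

lemma (in module) quot_map:
  assumes N: "submodule N R M"
  shows "(\<lambda>m. N +>\<^bsub>M\<^esub> m) \<in> mod_hom R M (M QuotM N)"
    and "(\<lambda>m. N +>\<^bsub>M\<^esub> m) ` carrier M = carrier (M QuotM N)"
    and "N +>\<^bsub>M\<^esub> \<zero>\<^bsub>M\<^esub> = \<zero>\<^bsub>M QuotM N\<^esub>"
    and "module R (M QuotM N)"
proof -
  interpret S: abelian_subgroup N M using submodule_abelian_subgroup[OF N] .
  note NE = submoduleE[OF N]
  show surj: "(\<lambda>m. N +>\<^bsub>M\<^esub> m) ` carrier M = carrier (M QuotM N)"
    by (auto simp: quot_module_def A_RCOSETS_def')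
  show zero: "N +>\<^bsub>M\<^esub> \<zero>\<^bsub>M\<^esub> = \<zero>\<^bsub>M QuotM N\<^esub>"
    using NE(1) by (simp add: quot_module_def)
  show hom: "(\<lambda>m. N +>\<^bsub>M\<^esub> m) \<in> mod_hom R M (M QuotM N)"
  proof (rule mod_homI)
    fix a x assume a: "a \<in> carrier R" and x: "x \<in> carrier M"
    have "N +>\<^bsub>M\<^esub> (a \<odot>\<^bsub>M\<^esub> y) = N +>\<^bsub>M\<^esub> (a \<odot>\<^bsub>M\<^esub> x)" if y: "y \<in> N +>\<^bsub>M\<^esub> x" for y
    proof -
      have yc: "y \<in> carrier M" using y x M.a_r_coset_subset_G[OF NE(1)] by blast
      have "N +>\<^bsub>M\<^esub> y = N +>\<^bsub>M\<^esub> x" using S.a_repr_independence'[OF y x] by simp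
      then have "y \<ominus>\<^bsub>M\<^esub> x \<in> N" using coset_eq_iff[OF N yc x] by simp
      then have "a \<odot>\<^bsub>M\<^esub> (y \<ominus>\<^bsub>M\<^esub> x) \<in> N" using a NE by blast
      moreover have "a \<odot>\<^bsub>M\<^esub> (y \<ominus>\<^bsub>M\<^esub> x) = a \<odot>\<^bsub>M\<^esub> y \<ominus>\<^bsub>M\<^esub> a \<odot>\<^bsub>M\<^esub> x"
        using a yc x by (simp add: a_minus_def smult_r_distr smult_r_minus)
      ultimately show ?thesis using coset_eq_iff[OF N] a yc x by simp
    qed
    moreover have "N +>\<^bsub>M\<^esub> x \<noteq> {}" using S.a_rcos_self[OF x] by blast
    ultimately have "(\<Union>y\<in>N +>\<^bsub>M\<^esub> x. N +>\<^bsub>M\<^esub> (a \<odot>\<^bsub>M\<^esub> y)) = N +>\<^bsub>M\<^esub> (a \<odot>\<^bsub>M\<^esub> x)"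
      by (rule SUP_eq_const[rotated])
    then show "N +>\<^bsub>M\<^esub> a \<odot>\<^bsub>M\<^esub> x = a \<odot>\<^bsub>M QuotM N\<^esub> (N +>\<^bsub>M\<^esub> x)"
      by (simp only: quot_module_def module.simps)
  next
    show "N +>\<^bsub>M\<^esub> x \<in> carrier (M QuotM N)" if "x \<in> carrier M" for x using surj that by blast
    show "N +>\<^bsub>M\<^esub> (x \<oplus>\<^bsub>M\<^esub> y) = (N +>\<^bsub>M\<^esub> x) \<oplus>\<^bsub>M QuotM N\<^esub> (N +>\<^bsub>M\<^esub> y)"
      if "x \<in> carrier M" "y \<in> carrier M" for x y
      using that by (simp add: quot_module_def S.a_rcos_sum)
  qed
  show "module R (M QuotM N)"
    by (rule module_surj_image[OF module_axioms hom surj zero])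
qed

lemma (in module) diff_zero: "x \<in> carrier M \<Longrightarrow> x \<ominus>\<^bsub>M\<^esub> \<zero>\<^bsub>M\<^esub> = x"
  by (simp add: a_minus_def)

lemma (in module) image_submodule:
  assumes "module R N" "h \<in> mod_hom R M N" "submodule S R M"
  shows "submodule (h ` S) R N"
proof -
  interpret N: module R N by fact
  note hD = mod_homD[OF assms(2)] and S = submoduleE[OF assms(3)]
  have SM: "s \<in> carrier M" if "s \<in> S" for s using S(1) that by blast
  show ?thesis
  proof (rule N.submoduleI)
    show "h ` S \<subseteq> carrier N" using hD(1) SM by blast
    show "\<zero>\<^bsub>N\<^esub> \<in> h ` S"
      using mod_hom_zero(1)[OF module_axioms assms(1,2)] submodule_zero[OF assms(3)] by (metis imageI)
    show "\<ominus>\<^bsub>N\<^esub> a \<in> h ` S" if a: "a \<in> h ` S" for a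
    proof -
      obtain s where "s \<in> S" "a = h s" using a by blast
      then show ?thesis using mod_hom_zero(2)[OF module_axioms assms(1,2), of s] S(3)[of s] SM
        by (metis imageI)
    qed
    show "a \<oplus>\<^bsub>N\<^esub> b \<in> h ` S" if ab: "a \<in> h ` S" "b \<in> h ` S" for a b
    proof -
      obtain s t where "s \<in> S" "a = h s" "t \<in> S" "b = h t" using ab by blast
      then show ?thesis using hD(2)[of s t] S(5)[of s t] SM by (metis imageI)
    qed
    show "r \<odot>\<^bsub>N\<^esub> a \<in> h ` S" if ra: "r \<in> carrier R" "a \<in> h ` S" for r a
    proof -
      obtain s where "s \<in> S" "a = h s" using ra by blast
      then show ?thesis using hD(3)[of r s] S(4)[of r s] SM ra by (metis imageI)
    qed
  qed
qed

lemma (in module) preimage_submodule: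
  assumes "module R N" "h \<in> mod_hom R M N" "submodule S R N"
  shows "submodule {m \<in> carrier M. h m \<in> S} R M"
proof -
  interpret N: module R N by fact
  note hD = mod_homD[OF assms(2)] and z = mod_hom_zero[OF module_axioms assms(1,2)]
    and SE = N.submoduleE[OF assms(3)]
  show ?thesis
    by (rule submoduleI) (auto simp: hD z SE N.submodule_zero[OF assms(3)])
qed

lemma (in module) smult_hom:
  assumes "a \<in> carrier R" shows "(\<lambda>m. a \<odot>\<^bsub>M\<^esub> m) \<in> mod_hom R M M"
  using assms by (intro mod_homI) (auto simp: smult_r_distr R.m_comm simp flip: smult_assoc1)

lemma (in module) submodule_if_smult_closed:
  assumes "H \<subseteq> carrier M" "\<zero>\<^bsub>M\<^esub> \<in> H"
    and "\<And>a b. a \<in> H \<Longrightarrow> b \<in> H \<Longrightarrow> a \<oplus>\<^bsub>M\<^esub> b \<in> H"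
    and smult: "\<And>a m. a \<in> carrier R \<Longrightarrow> m \<in> H \<Longrightarrow> a \<odot>\<^bsub>M\<^esub> m \<in> H"
  shows "submodule H R M"
proof (rule submoduleI)
  show "\<ominus>\<^bsub>M\<^esub> m \<in> H" if "m \<in> H" for m
  proof -
    have "m \<in> carrier M" using assms(1) that by blast
    then have "\<ominus>\<^bsub>M\<^esub> m = (\<ominus>\<^bsub>R\<^esub> \<one>\<^bsub>R\<^esub>) \<odot>\<^bsub>M\<^esub> m" by (simp add: smult_l_minus)
    then show ?thesis using smult[OF _ that] by simp
  qed
qed (use assms in auto)

lemma (in module) smult_diff:
  assumes "a \<in> carrier R" "m \<in> carrier M" "n \<in> carrier M"
  shows "a \<odot>\<^bsub>M\<^esub> (m \<ominus>\<^bsub>M\<^esub> n) = a \<odot>\<^bsub>M\<^esub> m \<ominus>\<^bsub>M\<^esub> a \<odot>\<^bsub>M\<^esub> n"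
  by (rule mod_hom_diff[OF module_axioms module_axioms smult_hom[OF assms(1)] assms(2,3)])

lemma (in module) smult_commute:
  assumes "a \<in> carrier R" "b \<in> carrier R" "m \<in> carrier M"
  shows "a \<odot>\<^bsub>M\<^esub> (b \<odot>\<^bsub>M\<^esub> m) = b \<odot>\<^bsub>M\<^esub> (a \<odot>\<^bsub>M\<^esub> m)"
  using assms by (simp add: R.m_comm flip: smult_assoc1)

lemma (in module) diff_eq_iff:
  assumes "x \<in> carrier M" "y \<in> carrier M" "z \<in> carrier M"
  shows "x \<ominus>\<^bsub>M\<^esub> y = z \<longleftrightarrow> x = z \<oplus>\<^bsub>M\<^esub> y"
  using assms by (auto simp: a_minus_def M.a_assoc M.r_neg M.l_neg)

lemma (in module) diff_diff:
  assumes "x \<in> carrier M" "y \<in> carrier M"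
  shows "x \<ominus>\<^bsub>M\<^esub> (x \<ominus>\<^bsub>M\<^esub> y) = y"
  using assms diff_eq_iff[of x "x \<ominus>\<^bsub>M\<^esub> y" y] diff_eq_iff[of x y "x \<ominus>\<^bsub>M\<^esub> y"]
  by (simp add: M.a_comm)

lemma (in module) diff_swap:
  assumes "submodule N R M" "m \<in> carrier M" "n \<in> carrier M" "m \<ominus>\<^bsub>M\<^esub> n \<in> N"
  shows "n \<ominus>\<^bsub>M\<^esub> m \<in> N"
proof -
  have "n \<ominus>\<^bsub>M\<^esub> m = \<ominus>\<^bsub>M\<^esub> (m \<ominus>\<^bsub>M\<^esub> n)"
    using assms(2,3) by (simp add: a_minus_def M.minus_add M.a_comm)
  then show ?thesis using submoduleE(3)[OF assms(1,4)] by simp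
qed

lemma (in abelian_group) finsum_in_subgroup:
  assumes H: "additive_subgroup H G" and "finite S" and f: "\<And>i. i \<in> S \<Longrightarrow> f i \<in> H"
  shows "finsum G f S \<in> H"
  using assms(2) f
proof (induction S)
  case empty
  then show ?case using additive_subgroup.zero_closed[OF H] by simp
next
  case (insert i S)
  have "H \<subseteq> carrier G" by (rule additive_subgroup.a_subset[OF H])
  then show ?case using insert additive_subgroup.a_closed[OF H] by (subst finsum_insert) auto
qed

lemma (in module) finsum_in_submodule:
  assumes "submodule N R M" "finite S" "\<And>i. i \<in> S \<Longrightarrow> f i \<in> N"
  shows "finsum M f S \<in> N"
  using M.finsum_in_subgroup[OF _ assms(2,3)] submodule_abelian_subgroup[OF assms(1)]
  by (simp add: abelian_subgroup_def)

lemma mod_hom_finsum: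
  assumes "module R M" "module R N" "h \<in> mod_hom R M N" "finite S" "\<And>i. i \<in> S \<Longrightarrow> f i \<in> carrier M"
  shows "h (finsum M f S) = finsum N (\<lambda>i. h (f i)) S"
proof -
  interpret M: module R M by fact
  interpret N: module R N by fact
  note hD = mod_homD[OF assms(3)] and hz = mod_hom_zero[OF assms(1-3)]
  show ?thesis
    using assms(4,5)
  proof (induction S)
    case empty
    then show ?case using hz by simp
  next
    case (insert i S)
    then show ?case by (simp add: M.finsum_insert N.finsum_insert hD Pi_def)
  qed
qed

section \<open>Divisible groups\<close>

definition divisible_group :: "('a, 'x) ring_scheme \<Rightarrow> bool"
  where "divisible_group D \<longleftrightarrow>
    (\<forall>d\<in>carrier D. \<forall>n::int. n \<noteq> 0 \<longrightarrow> (\<exists>e\<in>carrier D. add_pow D n e = d))"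

lemma add_pow_int_0 [simp]: "add_pow G (0::int) x = \<zero>\<^bsub>G\<^esub>"
  by (simp add: add_pow_def)

lemma (in abelian_group) int_pow_eqI:
  fixes f :: "int \<Rightarrow> 'a"
  assumes x: "x \<in> carrier G" and cl: "\<And>i. f i \<in> carrier G"
    and z: "f 0 = \<zero>" and step: "\<And>i. f (i + 1) = f i \<oplus> x"
  shows "f n = add_pow G n x"
proof (induction n rule: int_induct[of _ 0])
  case base
  show ?case using z x by simp
next
  case (step1 i)
  then show ?case using x by (simp add: step add.int_pow_mult)
next
  case (step2 i)
  have "f (i - 1) \<oplus> x = add_pow G (i - 1) x \<oplus> x"
    using step[of "i - 1"] step2(2) x add.int_pow_mult[OF x, of "i - 1" 1] by simp
  then show ?case using x cl by simp
qed

text \<open>Partial additive maps from \<open>W\<close> to \<open>D\<close> are handled as their graphs, which are the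
  single-valued subgroups of \<open>W \<times> D\<close>: graphs are ordered by inclusion and closed under unions of
  chains. Single-valuedness amounts to a condition at \<open>\<zero>\<close> and is kept as a separate hypothesis.\<close>

locale additive_relation = W?: abelian_group W + D?: abelian_group D
  for W (structure) and D (structure) +
  fixes H :: "('a \<times> 'c) set"
  assumes sub: "H \<subseteq> carrier W \<times> carrier D"
    and zero: "(\<zero>\<^bsub>W\<^esub>, \<zero>\<^bsub>D\<^esub>) \<in> H"
    and add: "(w, d) \<in> H \<Longrightarrow> (w', d') \<in> H \<Longrightarrow> (w \<oplus>\<^bsub>W\<^esub> w', d \<oplus>\<^bsub>D\<^esub> d') \<in> H"
    and neg: "(w, d) \<in> H \<Longrightarrow> (\<ominus>\<^bsub>W\<^esub> w, \<ominus>\<^bsub>D\<^esub> d) \<in> H"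
begin

lemma int_pow:
  assumes "(w, d) \<in> H" shows "(add_pow W (n::int) w, add_pow D n d) \<in> H"
proof -
  have wd: "w \<in> carrier W" "d \<in> carrier D" using assms sub by auto
  show ?thesis
  proof (induction n rule: int_induct[of _ 0])
    case base
    show ?case using zero by simp
  next
    case (step1 i)
    then show ?case using add[OF step1(2) assms] wd by (simp add: W.add.int_pow_mult D.add.int_pow_mult)
  next
    case (step2 i)
    have "add_pow W (i - 1) w = add_pow W i w \<oplus>\<^bsub>W\<^esub> \<ominus>\<^bsub>W\<^esub> w" "add_pow D (i - 1) d = add_pow D i d \<oplus>\<^bsub>D\<^esub> \<ominus>\<^bsub>D\<^esub> d"
      using W.add.int_pow_diff[OF wd(1), of i 1] D.add.int_pow_diff[OF wd(2), of i 1] wd by auto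
    then show ?case using add[OF step2(2) neg[OF assms]] by simp
  qed
qed

lemma diff:
  assumes "(w, d) \<in> H" "(w, d') \<in> H"
  shows "(\<zero>\<^bsub>W\<^esub>, d \<ominus>\<^bsub>D\<^esub> d') \<in> H"
  using add[OF assms(1) neg[OF assms(2)]] assms sub by (auto simp: a_minus_def W.r_neg)

lemma single_valued:
  assumes sv: "\<And>d. (\<zero>\<^bsub>W\<^esub>, d) \<in> H \<Longrightarrow> d = \<zero>\<^bsub>D\<^esub>"
    and "(w, d) \<in> H" "(w, d') \<in> H"
  shows "d = d'"
proof -
  have "d \<ominus>\<^bsub>D\<^esub> d' = \<zero>\<^bsub>D\<^esub>" using sv[OF diff[OF assms(2,3)]] .
  then show ?thesis using assms sub by (metis D.add.inv_closed D.minus_equality D.minus_minus D.r_neg a_minus_def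
        SigmaD2 subsetD)
qed

text \<open>The multiples of \<open>w\<close> in the domain are the multiples of a single \<open>k w\<close>, so it
  suffices to divide the value at \<open>k w\<close> by \<open>k\<close>.\<close>

lemma compatible_value:
  assumes sv: "\<And>d. (\<zero>\<^bsub>W\<^esub>, d) \<in> H \<Longrightarrow> d = \<zero>\<^bsub>D\<^esub>"
    and div: "divisible_group D" and w: "w \<in> carrier W"
  shows "\<exists>e\<in>carrier D. \<forall>(n::int) d. (add_pow W n w, d) \<in> H \<longrightarrow> d = add_pow D n e"
proof (cases "\<exists>n d. n > (0::int) \<and> (add_pow W n w, d) \<in> H")
  case False
  have "d = add_pow D n \<zero>\<^bsub>D\<^esub>" if nd: "(add_pow W n w, d) \<in> H" for n :: int and d
  proof -
    have "\<not> n > 0" using False nd by blast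
    moreover have "\<not> n < 0"
    proof
      assume "n < 0"
      moreover have "(add_pow W (- n) w, \<ominus>\<^bsub>D\<^esub> d) \<in> H" using neg[OF nd] w by (simp add: W.add.int_pow_neg)
      ultimately show False using False by (meson neg_0_less_iff_less)
    qed
    ultimately have "n = 0" by simp
    then show ?thesis using nd sv by auto
  qed
  then show ?thesis by blast
next
  case True
  define P where "P = (\<lambda>m::nat. m > 0 \<and> (\<exists>d. (add_pow W (int m) w, d) \<in> H))"
  obtain n1 d1 where "n1 > (0::int)" "(add_pow W n1 w, d1) \<in> H" using True by blast
  then have "P (nat n1)" by (auto simp: P_def)
  then have Pk: "P (LEAST m. P m)" and least: "\<And>m. P m \<Longrightarrow> (LEAST m. P m) \<le> m"
    by (auto intro: LeastI Least_le)
  define k where "k = int (LEAST m. P m)"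
  from Pk obtain d0 where d0: "(add_pow W k w, d0) \<in> H" and k: "k > 0"
    by (auto simp: P_def k_def)
  have "d0 \<in> carrier D" using d0 sub by auto
  then obtain e where e: "e \<in> carrier D" "add_pow D k e = d0"
    using div k unfolding divisible_group_def by (metis less_irrefl)
  have "d = add_pow D n e" if nd: "(add_pow W n w, d) \<in> H" for n :: int and d
  proof -
    define q where "q = n div k"
    have q: "(add_pow W (k * q) w, add_pow D (k * q) e) \<in> H"
      using int_pow[OF d0, of q] unfolding e(2)[symmetric]
      by (simp only: W.add.int_pow_pow[OF w] D.add.int_pow_pow[OF e(1)])
    have "(add_pow W (n - k * q) w, d \<oplus>\<^bsub>D\<^esub> \<ominus>\<^bsub>D\<^esub> (add_pow D (k * q) e)) \<in> H"
      using add[OF nd neg[OF q]] W.add.int_pow_diff[OF w, of n "k * q"] by simp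
    moreover have m: "n - k * q = n mod k" by (simp add: q_def minus_mult_div_eq_mod)
    moreover have "0 \<le> n mod k" "n mod k < k" using k by auto
    ultimately have r: "(add_pow W (n mod k) w, d \<oplus>\<^bsub>D\<^esub> \<ominus>\<^bsub>D\<^esub> (add_pow D (k * q) e)) \<in> H"
      "0 \<le> n mod k" "n mod k < k" by simp_all
    have "n mod k = 0"
    proof (rule ccontr)
      assume "n mod k \<noteq> 0"
      then have "P (nat (n mod k))" using r unfolding P_def by (metis nat_0_le order_le_less zero_less_nat_eq)
      then have "k \<le> n mod k" using least[of "nat (n mod k)"] r(2) by (simp add: k_def)
      then show False using r(3) by simp
    qed
    then have "n = k * q" using m by simp
    then show ?thesis using single_valued[OF sv nd] q by simp
  qed
  then show ?thesis using e by blast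
qed

end

text \<open>Divisible groups are injective: by Zorn's lemma there is a maximal additive graph that
  extends the graph of \<open>\<psi>\<close>, and it is defined everywhere because a compatible value at a
  missing point would enlarge it.\<close>

lemma divisible_extension:
  assumes "abelian_group W" "abelian_group D" and div: "divisible_group D"
    and S: "additive_subgroup S W"
    and \<psi>: "\<And>s. s \<in> S \<Longrightarrow> \<psi> s \<in> carrier D"
    and \<psi>add: "\<And>s t. s \<in> S \<Longrightarrow> t \<in> S \<Longrightarrow> \<psi> (s \<oplus>\<^bsub>W\<^esub> t) = \<psi> s \<oplus>\<^bsub>D\<^esub> \<psi> t"
  obtains h where "\<And>w. w \<in> carrier W \<Longrightarrow> h w \<in> carrier D"
    and "\<And>v w. v \<in> carrier W \<Longrightarrow> w \<in> carrier W \<Longrightarrow> h (v \<oplus>\<^bsub>W\<^esub> w) = h v \<oplus>\<^bsub>D\<^esub> h w"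
    and "\<And>s. s \<in> S \<Longrightarrow> h s = \<psi> s"
proof -
  interpret W: abelian_group W by fact
  interpret D: abelian_group D by fact
  interpret S: additive_subgroup S W by fact
  define A where "A = {H. additive_relation W D H \<and> (\<forall>d. (\<zero>\<^bsub>W\<^esub>, d) \<in> H \<longrightarrow> d = \<zero>\<^bsub>D\<^esub>)
    \<and> (\<lambda>s. (s, \<psi> s)) ` S \<subseteq> H}"
  have "\<psi> \<zero>\<^bsub>W\<^esub> \<oplus>\<^bsub>D\<^esub> \<psi> \<zero>\<^bsub>W\<^esub> = \<psi> \<zero>\<^bsub>W\<^esub>"
    using \<psi>add[of "\<zero>\<^bsub>W\<^esub>" "\<zero>\<^bsub>W\<^esub>"] by simp
  then have \<psi>0: "\<psi> \<zero>\<^bsub>W\<^esub> = \<zero>\<^bsub>D\<^esub>"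
    using \<psi>[of "\<zero>\<^bsub>W\<^esub>"] by (simp add: D.add.r_cancel_one)
  have \<psi>neg: "\<psi> (\<ominus>\<^bsub>W\<^esub> s) = \<ominus>\<^bsub>D\<^esub> \<psi> s" if "s \<in> S" for s
  proof -
    have "\<psi> (\<ominus>\<^bsub>W\<^esub> s) \<oplus>\<^bsub>D\<^esub> \<psi> s = \<zero>\<^bsub>D\<^esub>"
      using \<psi>add[of "\<ominus>\<^bsub>W\<^esub> s" s] that \<psi>0 S.a_subset by (auto simp: W.l_neg)
    then show ?thesis using \<psi> that by (simp add: D.minus_equality)
  qed
  have "(\<lambda>s. (s, \<psi> s)) ` S \<in> A"
    unfolding A_def additive_relation_def additive_relation_axioms_def
    using \<psi>0 \<psi>neg \<psi>add \<psi> S.a_subset W.abelian_group_axioms D.abelian_group_axioms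
    by (auto simp: image_iff)
  then have "A \<noteq> {}" by blast
  moreover have "\<Union>C \<in> A" if C: "C \<noteq> {}" "subset.chain A C" for C
  proof -
    have CA: "C \<subseteq> A" and ch: "\<And>X Y. X \<in> C \<Longrightarrow> Y \<in> C \<Longrightarrow> X \<subseteq> Y \<or> Y \<subseteq> X"
      using C unfolding subset.chain_def by auto
    have rel: "additive_relation W D X" if "X \<in> C" for X using that CA A_def by auto
    obtain X0 where X0: "X0 \<in> C" using C by blast
    have "additive_relation W D (\<Union>C)"
    proof
      show "\<Union>C \<subseteq> carrier W \<times> carrier D" using additive_relation.sub[OF rel] by blast
      show "(\<zero>\<^bsub>W\<^esub>, \<zero>\<^bsub>D\<^esub>) \<in> \<Union>C" using additive_relation.zero[OF rel[OF X0]] X0 by blast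
      show "(\<ominus>\<^bsub>W\<^esub> w, \<ominus>\<^bsub>D\<^esub> d) \<in> \<Union>C" if "(w, d) \<in> \<Union>C" for w d
        using that additive_relation.neg[OF rel] by blast
      fix w d w' d' assume "(w, d) \<in> \<Union>C" "(w', d') \<in> \<Union>C"
      then obtain X Y where XY: "X \<in> C" "Y \<in> C" "(w, d) \<in> X" "(w', d') \<in> Y" by blast
      then obtain Z where "Z \<in> C" "(w, d) \<in> Z" "(w', d') \<in> Z" using ch[OF XY(1,2)] by blast
      then show "(w \<oplus>\<^bsub>W\<^esub> w', d \<oplus>\<^bsub>D\<^esub> d') \<in> \<Union>C" using additive_relation.add[OF rel] by blast
    qed
    moreover have "(\<lambda>s. (s, \<psi> s)) ` S \<subseteq> \<Union>C" using X0 CA unfolding A_def by blast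
    moreover have "\<forall>d. (\<zero>\<^bsub>W\<^esub>, d) \<in> \<Union>C \<longrightarrow> d = \<zero>\<^bsub>D\<^esub>" using CA unfolding A_def by blast
    ultimately show ?thesis unfolding A_def by blast
  qed
  ultimately obtain H where H: "H \<in> A" and max: "\<And>X. X \<in> A \<Longrightarrow> H \<subseteq> X \<Longrightarrow> X = H"
    using subset_Zorn_nonempty[of A] by blast
  interpret additive_relation W D H using H by (simp add: A_def)
  have sv: "\<And>d. (\<zero>\<^bsub>W\<^esub>, d) \<in> H \<Longrightarrow> d = \<zero>\<^bsub>D\<^esub>" and GH: "(\<lambda>s. (s, \<psi> s)) ` S \<subseteq> H"
    using H by (auto simp: A_def)
  have total: "\<exists>d. (w, d) \<in> H" if w: "w \<in> carrier W" for w
  proof -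
    obtain e where e: "e \<in> carrier D" and comp: "\<And>(n::int) d. (add_pow W n w, d) \<in> H \<Longrightarrow> d = add_pow D n e"
      using compatible_value[OF sv div w] by blast
    \<comment> \<open>The graph generated by \<open>H\<close> and the pair \<open>(w, e)\<close>.\<close>
    define H' where "H' = {(u \<oplus>\<^bsub>W\<^esub> add_pow W n w, c \<oplus>\<^bsub>D\<^esub> add_pow D n e) | u c (n::int). (u, c) \<in> H}"
    have H'I: "(u \<oplus>\<^bsub>W\<^esub> add_pow W n w, c \<oplus>\<^bsub>D\<^esub> add_pow D n e) \<in> H'" if "(u, c) \<in> H" for u c and n :: int
      using that by (auto simp: H'_def)
    have incl: "H \<subseteq> H'"
    proof
      fix p assume p: "p \<in> H"
      obtain u c where uc: "p = (u, c)" by (cases p)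
      show "p \<in> H'" using H'I[of u c 0] p uc sub by auto
    qed
    have "additive_relation W D H'"
    proof
      show "H' \<subseteq> carrier W \<times> carrier D" using sub w e by (auto simp: H'_def)
      show "(\<zero>\<^bsub>W\<^esub>, \<zero>\<^bsub>D\<^esub>) \<in> H'" using zero incl by blast
      fix v d assume "(v, d) \<in> H'"
      then obtain u c n where u: "(u, c) \<in> H" "v = u \<oplus>\<^bsub>W\<^esub> add_pow W (n::int) w" "d = c \<oplus>\<^bsub>D\<^esub> add_pow D n e"
        by (auto simp: H'_def)
      then have uc: "u \<in> carrier W" "c \<in> carrier D" using sub by auto
      show "(\<ominus>\<^bsub>W\<^esub> v, \<ominus>\<^bsub>D\<^esub> d) \<in> H'"
        using H'I[OF neg[OF u(1)], of "- n"] u uc w e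
        by (simp add: W.add.int_pow_neg D.add.int_pow_neg W.minus_add D.minus_add)
      fix v' d' assume "(v', d') \<in> H'"
      then obtain u' c' n' where u': "(u', c') \<in> H" "v' = u' \<oplus>\<^bsub>W\<^esub> add_pow W (n'::int) w" "d' = c' \<oplus>\<^bsub>D\<^esub> add_pow D (n') e"
        by (auto simp: H'_def)
      then have uc': "u' \<in> carrier W" "c' \<in> carrier D" using sub by auto
      show "(v \<oplus>\<^bsub>W\<^esub> v', d \<oplus>\<^bsub>D\<^esub> d') \<in> H'"
        using H'I[OF add[OF u(1) u'(1)], of "n + n'"] u uc u' uc' w e
        by (simp add: W.add.int_pow_mult D.add.int_pow_mult W.a_ac D.a_ac)
    qed
    moreover have "d = \<zero>\<^bsub>D\<^esub>" if 0: "(\<zero>\<^bsub>W\<^esub>, d) \<in> H'" for d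
    proof -
      obtain u c and n :: int where u: "(u, c) \<in> H" "\<zero>\<^bsub>W\<^esub> = u \<oplus>\<^bsub>W\<^esub> add_pow W n w" "d = c \<oplus>\<^bsub>D\<^esub> add_pow D n e"
        using 0 unfolding H'_def by blast
      then have uc: "u \<in> carrier W" "c \<in> carrier D" using sub by auto
      have "u = add_pow W (- n) w" using u(2) uc w W.minus_equality[of u "add_pow W n w"] by (simp add: W.add.int_pow_neg)
      then have "c = add_pow D (- n) e" using comp u(1) by blast
      then show ?thesis using u(3) e by (simp add: D.add.int_pow_neg D.l_neg)
    qed
    ultimately have "H' \<in> A" using GH incl unfolding A_def by blast
    then have "H' = H" using max incl by blast
    moreover have "(w, e) \<in> H'" using H'I[OF zero, of 1] w e by simp
    ultimately show ?thesis by blast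
  qed
  define h where "h = (\<lambda>w. SOME d. (w, d) \<in> H)"
  have hH: "(w, h w) \<in> H" if "w \<in> carrier W" for w
    using total[OF that] unfolding h_def by (rule someI_ex)
  have heq: "h w = d" if "(w, d) \<in> H" for w d
  proof -
    have "w \<in> carrier W" using that sub by auto
    then show ?thesis using single_valued[OF sv hH that] by blast
  qed
  show thesis
  proof
    show "h w \<in> carrier D" if "w \<in> carrier W" for w using hH[OF that] sub by auto
    show "h (v \<oplus>\<^bsub>W\<^esub> w) = h v \<oplus>\<^bsub>D\<^esub> h w" if "v \<in> carrier W" "w \<in> carrier W" for v w
      using heq[OF add[OF hH[OF that(1)] hH[OF that(2)]]] .
    show "h s = \<psi> s" if "s \<in> S" for s using heq GH that by blast
  qed
qed

section \<open>The divisible hull\<close>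

text \<open>The rational vector space with basis \<open>S\<close>, regarded as an abelian group.\<close>

definition rat_combinations :: "'u set \<Rightarrow> (int, 'u \<Rightarrow> rat) module"
  where "rat_combinations S =
    \<lparr>carrier = {c. finite {u. c u \<noteq> 0} \<and> {u. c u \<noteq> 0} \<subseteq> S},
     monoid.mult = undefined, one = undefined, zero = (\<lambda>u. 0),
     add = (\<lambda>c c' u. c u + c' u), smult = (\<lambda>n c u. of_int n * c u)\<rparr>"

lemma rat_combinations_module: "module \<Z> (rat_combinations S)"
proof (rule moduleI)
  show "cring \<Z>" by (rule int_is_cring)
  show "abelian_group (rat_combinations S)"
  proof (rule abelian_groupI)
    fix x y assume "x \<in> carrier (rat_combinations S)" "y \<in> carrier (rat_combinations S)"
    then have "finite ({u. x u \<noteq> 0} \<union> {u. y u \<noteq> 0})" "{u. x u \<noteq> 0} \<union> {u. y u \<noteq> 0} \<subseteq> S"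
      by (auto simp: rat_combinations_def)
    moreover have "{u. x u + y u \<noteq> 0} \<subseteq> {u. x u \<noteq> 0} \<union> {u. y u \<noteq> 0}" by auto
    ultimately have "finite {u. x u + y u \<noteq> 0}" "{u. x u + y u \<noteq> 0} \<subseteq> S"
      by (meson finite_subset order_trans)+
    then show "x \<oplus>\<^bsub>rat_combinations S\<^esub> y \<in> carrier (rat_combinations S)"
      by (simp add: rat_combinations_def)
  next
    fix x assume "x \<in> carrier (rat_combinations S)"
    then show "\<exists>y\<in>carrier (rat_combinations S). y \<oplus>\<^bsub>rat_combinations S\<^esub> x = \<zero>\<^bsub>rat_combinations S\<^esub>"
      by (intro bexI[of _ "\<lambda>u. - x u"]) (auto simp: rat_combinations_def)
  qed (auto simp: rat_combinations_def algebra_simps)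
next
  fix n x assume "x \<in> carrier (rat_combinations S)"
  then show "n \<odot>\<^bsub>rat_combinations S\<^esub> x \<in> carrier (rat_combinations S)"
    by (auto simp: rat_combinations_def intro: rev_finite_subset)
qed (auto simp: rat_combinations_def algebra_simps)

text \<open>The canonical map from the free abelian group on the carrier of \<open>E\<close> to \<open>E\<close>; its kernel,
  viewed inside the rational vector space on the same basis, is \<open>int_relations\<close>.\<close>

definition int_sum :: "('u, 'y) ring_scheme \<Rightarrow> ('u \<Rightarrow> int) \<Rightarrow> 'u"
  where "int_sum E k = (\<Oplus>\<^bsub>E\<^esub>e\<in>{e. k e \<noteq> 0}. add_pow E (k e) e)"

lemma (in abelian_group) int_sum_superset:
  assumes "finite S" "S \<subseteq> carrier G" "{e. k e \<noteq> 0} \<subseteq> S"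
  shows "int_sum G k = (\<Oplus>e\<in>S. add_pow G (k e) e)"
  unfolding int_sum_def
proof (rule add.finprod_mono_neutral_cong_left)
  show "(\<lambda>e. add_pow G (k e) e) \<in> S \<rightarrow> carrier G" using assms by auto
qed (use assms in auto)

lemma (in abelian_group) int_sum_add:
  assumes "finite {e. k e \<noteq> 0}" "{e. k e \<noteq> 0} \<subseteq> carrier G"
    and "finite {e. l e \<noteq> 0}" "{e. l e \<noteq> 0} \<subseteq> carrier G"
  shows "int_sum G (\<lambda>e. k e + l e) = int_sum G k \<oplus> int_sum G l"
proof -
  let ?S = "{e. k e \<noteq> 0} \<union> {e. l e \<noteq> 0}"
  have S: "finite ?S" "?S \<subseteq> carrier G" using assms by auto
  have "int_sum G (\<lambda>e. k e + l e) = (\<Oplus>e\<in>?S. add_pow G (k e + l e) e)"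
    by (rule int_sum_superset) (use S in auto)
  also have "\<dots> = (\<Oplus>e\<in>?S. add_pow G (k e) e \<oplus> add_pow G (l e) e)"
    using S by (intro finsum_cong') (auto simp: add.int_pow_mult)
  also have "\<dots> = (\<Oplus>e\<in>?S. add_pow G (k e) e) \<oplus> (\<Oplus>e\<in>?S. add_pow G (l e) e)"
    using S by (intro finsum_addf) auto
  also have "\<dots> = int_sum G k \<oplus> int_sum G l"
    using S by (simp add: int_sum_superset[of ?S])
  finally show ?thesis .
qed

lemma (in abelian_group) int_sum_multiple:
  assumes k: "finite {e. k e \<noteq> 0}" "{e. k e \<noteq> 0} \<subseteq> carrier G"
  shows "int_sum G (\<lambda>e. n * k e) = add_pow G n (int_sum G k)"
proof -
  have cl: "int_sum G (\<lambda>e. i * k e) \<in> carrier G" for i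
  proof -
    have "{e. i * k e \<noteq> 0} \<subseteq> carrier G" using k by auto
    then show ?thesis unfolding int_sum_def by (intro finsum_closed) auto
  qed
  show ?thesis
  proof (rule int_pow_eqI[where f = "\<lambda>i. int_sum G (\<lambda>e. i * k e)"])
    show "int_sum G k \<in> carrier G" using cl[of 1] by simp
    show "int_sum G (\<lambda>e. 0 * k e) = \<zero>" by (simp add: int_sum_def)
    show "int_sum G (\<lambda>e. (i + 1) * k e) = int_sum G (\<lambda>e. i * k e) \<oplus> int_sum G k" for i
    proof -
      have "finite {e. i * k e \<noteq> 0}" by (rule finite_subset[OF _ k(1)]) auto
      then have "int_sum G (\<lambda>e. i * k e + k e) = int_sum G (\<lambda>e. i * k e) \<oplus> int_sum G k"
        using k by (intro int_sum_add) auto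
      then show ?thesis by (simp add: algebra_simps)
    qed
  qed (rule cl)
qed

lemma (in abelian_group) int_sum_single:
  assumes "a \<in> carrier G"
  shows "int_sum G (\<lambda>e. if e = a then n else 0) = add_pow G n a"
proof -
  have "int_sum G (\<lambda>e. if e = a then n else 0) = (\<Oplus>e\<in>{a}. add_pow G (if e = a then n else 0) e)"
    by (rule int_sum_superset) (use assms in auto)
  then show ?thesis using assms by simp
qed

definition int_relations :: "('u, 'y) ring_scheme \<Rightarrow> ('u \<Rightarrow> rat) set"
  where "int_relations E =
    {\<lambda>u. of_int (k u) | k. finite {e. k e \<noteq> 0} \<and> {e. k e \<noteq> 0} \<subseteq> carrier E \<and> int_sum E k = \<zero>\<^bsub>E\<^esub>}"

lemma (in abelian_group) int_relations_submodule:
  "submodule (int_relations G) \<Z> (rat_combinations (carrier G))"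
proof -
  interpret F: module \<Z> "rat_combinations (carrier G)" by (rule rat_combinations_module)
  have smult: "(\<lambda>u. of_int n * x u) \<in> int_relations G" if x: "x \<in> int_relations G" for n :: int and x
  proof -
    obtain k where k: "x = (\<lambda>u. of_int (k u))" "finite {e. k e \<noteq> 0}" "{e. k e \<noteq> 0} \<subseteq> carrier G"
      "int_sum G k = \<zero>" using x by (auto simp: int_relations_def)
    have "finite {e. n * k e \<noteq> 0}" by (rule finite_subset[OF _ k(2)]) auto
    moreover have "int_sum G (\<lambda>e. n * k e) = \<zero>" using int_sum_multiple[OF k(2,3)] k(4) by simp
    moreover have "{e. n * k e \<noteq> 0} \<subseteq> carrier G" using k(3) by auto
    moreover have "(\<lambda>u. of_int n * x u) = (\<lambda>u. of_int (n * k u))" using k(1) by simp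
    ultimately show ?thesis unfolding int_relations_def mem_Collect_eq
      by (intro exI[of _ "\<lambda>e. n * k e"]) blast
  qed
  show ?thesis
  proof (rule F.submoduleI)
    show sub: "int_relations G \<subseteq> carrier (rat_combinations (carrier G))"
      by (auto simp: int_relations_def rat_combinations_def)
    show "\<zero>\<^bsub>rat_combinations (carrier G)\<^esub> \<in> int_relations G"
      by (auto simp: int_relations_def rat_combinations_def int_sum_def intro!: exI[of _ "\<lambda>_. 0"])
    show "n \<odot>\<^bsub>rat_combinations (carrier G)\<^esub> x \<in> int_relations G" if "x \<in> int_relations G" for n x
      using smult[OF that] by (simp add: rat_combinations_def)
    show "\<ominus>\<^bsub>rat_combinations (carrier G)\<^esub> x \<in> int_relations G" if x: "x \<in> int_relations G" for x
    proof -
      have "\<ominus>\<^bsub>rat_combinations (carrier G)\<^esub> x = (\<lambda>u. of_int (-1) * x u)"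
        using sub smult[OF x, of "-1"] x
        by (intro F.M.minus_equality) (auto simp: rat_combinations_def)
      then show ?thesis using smult[OF x, of "-1"] by simp
    qed
    show "x \<oplus>\<^bsub>rat_combinations (carrier G)\<^esub> y \<in> int_relations G"
      if x: "x \<in> int_relations G" and y: "y \<in> int_relations G" for x y
    proof -
      obtain k where k: "x = (\<lambda>u. of_int (k u))" "finite {e. k e \<noteq> 0}" "{e. k e \<noteq> 0} \<subseteq> carrier G"
        "int_sum G k = \<zero>" using x by (auto simp: int_relations_def)
      obtain l where l: "y = (\<lambda>u. of_int (l u))" "finite {e. l e \<noteq> 0}" "{e. l e \<noteq> 0} \<subseteq> carrier G"
        "int_sum G l = \<zero>" using y by (auto simp: int_relations_def)
      have "finite {e. k e + l e \<noteq> 0}"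
        by (rule finite_subset[of _ "{e. k e \<noteq> 0} \<union> {e. l e \<noteq> 0}"]) (use k l in auto)
      moreover have "{e. k e + l e \<noteq> 0} \<subseteq> {e. k e \<noteq> 0} \<union> {e. l e \<noteq> 0}" by auto
      moreover from this have "{e. k e + l e \<noteq> 0} \<subseteq> carrier G" using k(3) l(3) by blast
      moreover have "int_sum G (\<lambda>e. k e + l e) = \<zero>" using int_sum_add[OF k(2,3) l(2,3)] k(4) l(4) by simp
      moreover have "x \<oplus>\<^bsub>rat_combinations (carrier G)\<^esub> y = (\<lambda>u. of_int (k u + l u))"
        using k(1) l(1) by (simp add: rat_combinations_def)
      ultimately show ?thesis unfolding int_relations_def mem_Collect_eq
        by (intro exI[of _ "\<lambda>e. k e + l e"]) blast
    qed
  qed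
qed

text \<open>Presenting \<open>E\<close> as $\mathbb Z^{(E)}/K$ embeds it into $\mathbb Q^{(E)}/K$, which is divisible
  as a quotient of a vector space over the rationals. The last conclusion records that the
  elements of \<open>D\<close> have finitely supported representatives; this bounds the size of \<open>D\<close>.\<close>

lemma divisible_hull:
  fixes E :: "('u, 'y) ring_scheme"
  assumes "abelian_group E"
  obtains D :: "(int, ('u \<Rightarrow> rat) set) module" and \<delta>
  where "abelian_group D" "divisible_group D"
    and "\<And>a. a \<in> carrier E \<Longrightarrow> \<delta> a \<in> carrier D"
    and "\<And>a b. a \<in> carrier E \<Longrightarrow> b \<in> carrier E \<Longrightarrow> \<delta> (a \<oplus>\<^bsub>E\<^esub> b) = \<delta> a \<oplus>\<^bsub>D\<^esub> \<delta> b"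
    and "inj_on \<delta> (carrier E)"
    and "\<exists>s :: _ \<Rightarrow> 'u \<Rightarrow> rat. inj_on s (carrier D) \<and> (\<forall>d\<in>carrier D. finite {u. s d u \<noteq> 0})"
proof -
  interpret E: abelian_group E by fact
  define F where "F = rat_combinations (carrier E)"
  define K where "K = int_relations E"
  interpret F: module \<Z> F unfolding F_def by (rule rat_combinations_module)
  have K: "submodule K \<Z> F" unfolding K_def F_def by (rule E.int_relations_submodule)
  define D where "D = F QuotM K"
  define q where "q = (\<lambda>c. K +>\<^bsub>F\<^esub> c)"
  interpret D: module \<Z> D unfolding D_def by (rule F.quot_map(4)[OF K])
  have q: "q \<in> mod_hom \<Z> F D" and surj: "q ` carrier F = carrier D"
    unfolding q_def D_def using F.quot_map[OF K] by auto
  note qD = mod_homD[OF q]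
  define single where "single = (\<lambda>(a::'u) u. if u = a then 1 else (0::rat))"
  have single: "single a \<in> carrier F" if "a \<in> carrier E" for a
    using that by (auto simp: single_def F_def rat_combinations_def)
  have Fadd: "x \<oplus>\<^bsub>F\<^esub> y = (\<lambda>u. x u + y u)" for x y by (simp add: F_def rat_combinations_def)
  have Fneg: "\<ominus>\<^bsub>F\<^esub> x = (\<lambda>u. - x u)" if "x \<in> carrier F" for x
    using that by (intro F.M.minus_equality) (auto simp: F_def rat_combinations_def)
  have Fdiff: "x \<ominus>\<^bsub>F\<^esub> y = (\<lambda>u. x u - y u)" if "y \<in> carrier F" for x y
    using that by (simp add: a_minus_def Fadd Fneg)
  have q_eq: "q x = q y \<longleftrightarrow> (\<lambda>u. x u - y u) \<in> K" if "x \<in> carrier F" "y \<in> carrier F" for x y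
    using F.coset_eq_iff[OF K that] Fdiff that by (simp add: q_def)
  show thesis
  proof (rule that[of D "\<lambda>a. q (single a)"])
    show "abelian_group D" by (rule D.M.abelian_group_axioms)
    show "divisible_group D" unfolding divisible_group_def
    proof (intro ballI allI impI)
      fix d and n :: int assume "d \<in> carrier D" and n: "n \<noteq> 0"
      then obtain c where c: "c \<in> carrier F" "d = q c" using surj by blast
      have cl: "(\<lambda>u. of_int i * c u / of_int n) \<in> carrier F" for i :: int
        using c(1) by (auto simp: F_def rat_combinations_def intro: rev_finite_subset)
      have "q (\<lambda>u. of_int n * c u / of_int n) = add_pow D n (q (\<lambda>u. c u / of_int n))"
      proof (rule D.M.int_pow_eqI[where f = "\<lambda>i. q (\<lambda>u. of_int i * c u / of_int n)"])
        show "q (\<lambda>u. c u / of_int n) \<in> carrier D" using qD(1)[OF cl[of 1]] by simp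
        show "q (\<lambda>u. of_int i * c u / of_int n) \<in> carrier D" for i using qD(1)[OF cl] .
        have "(\<lambda>u. of_int 0 * c u / of_int n) = \<zero>\<^bsub>F\<^esub>" by (simp add: F_def rat_combinations_def)
        then show "q (\<lambda>u. of_int 0 * c u / of_int n) = \<zero>\<^bsub>D\<^esub>"
          using mod_hom_zero(1)[OF F.module_axioms D.module_axioms q] by simp
        show "q (\<lambda>u. of_int (i + 1) * c u / of_int n) =
          q (\<lambda>u. of_int i * c u / of_int n) \<oplus>\<^bsub>D\<^esub> q (\<lambda>u. c u / of_int n)" for i
          using qD(2)[OF cl[of i] cl[of 1]] by (simp add: Fadd algebra_simps add_divide_distrib)
      qed
      then have "add_pow D n (q (\<lambda>u. c u / of_int n)) = d" using n c(2) by simp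
      then show "\<exists>e\<in>carrier D. add_pow D n e = d" using qD(1)[OF cl[of 1]] by auto
    qed
    show "q (single a) \<in> carrier D" if "a \<in> carrier E" for a using qD(1) single that by blast
    show "q (single (a \<oplus>\<^bsub>E\<^esub> b)) = q (single a) \<oplus>\<^bsub>D\<^esub> q (single b)"
      if a: "a \<in> carrier E" and b: "b \<in> carrier E" for a b
    proof -
      let ?d = "\<lambda>c u. if u = c then 1 else (0::int)"
      let ?k = "\<lambda>u. ?d (a \<oplus>\<^bsub>E\<^esub> b) u + (-1) * (?d a u + ?d b u)"
      have fin: "finite {u. ?d a u + ?d b u \<noteq> 0}" "finite {u. (-1) * (?d a u + ?d b u) \<noteq> 0}"
        by (rule finite_subset[of _ "{a, b}"]; auto)+
      have "int_sum E ?k = int_sum E (?d (a \<oplus>\<^bsub>E\<^esub> b)) \<oplus>\<^bsub>E\<^esub> int_sum E (\<lambda>u. (-1) * (?d a u + ?d b u))"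
        by (rule E.int_sum_add) (use a b fin in auto)
      also have "int_sum E (\<lambda>u. (-1) * (?d a u + ?d b u)) = add_pow E (- 1::int) (int_sum E (\<lambda>u. ?d a u + ?d b u))"
        by (rule E.int_sum_multiple) (use a b fin in auto)
      also have "int_sum E (\<lambda>u. ?d a u + ?d b u) = int_sum E (?d a) \<oplus>\<^bsub>E\<^esub> int_sum E (?d b)"
        by (rule E.int_sum_add) (use a b in auto)
      also have "int_sum E (?d (a \<oplus>\<^bsub>E\<^esub> b)) \<oplus>\<^bsub>E\<^esub> add_pow E (- 1::int) (int_sum E (?d a) \<oplus>\<^bsub>E\<^esub> int_sum E (?d b)) = \<zero>\<^bsub>E\<^esub>"
        using a b by (simp add: E.int_sum_single E.add.int_pow_neg E.r_neg)
      finally have "int_sum E ?k = \<zero>\<^bsub>E\<^esub>" .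
      moreover have "finite {u. ?k u \<noteq> 0}" "{u. ?k u \<noteq> 0} \<subseteq> carrier E"
        using a b by (auto intro: finite_subset[of _ "{a, b, a \<oplus>\<^bsub>E\<^esub> b}"])
      moreover have "(\<lambda>u. single (a \<oplus>\<^bsub>E\<^esub> b) u - (single a \<oplus>\<^bsub>F\<^esub> single b) u) = (\<lambda>u. of_int (?k u))"
        by (auto simp: single_def Fadd)
      ultimately have "(\<lambda>u. single (a \<oplus>\<^bsub>E\<^esub> b) u - (single a \<oplus>\<^bsub>F\<^esub> single b) u) \<in> K"
        unfolding K_def int_relations_def mem_Collect_eq by (intro exI[of _ ?k] conjI)
      then have "q (single (a \<oplus>\<^bsub>E\<^esub> b)) = q (single a \<oplus>\<^bsub>F\<^esub> single b)"
        using q_eq single a b by simp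
      then show ?thesis using qD(2) single a b by simp
    qed
    show "inj_on (\<lambda>a. q (single a)) (carrier E)"
    proof (rule inj_onI)
      fix a b assume a: "a \<in> carrier E" and b: "b \<in> carrier E" and eq: "q (single a) = q (single b)"
      let ?d = "\<lambda>c u. if u = c then 1 else (0::int)"
      have "(\<lambda>u. single a u - single b u) \<in> K" using q_eq single a b eq by simp
      then obtain k where k: "(\<lambda>u. single a u - single b u) = (\<lambda>u. of_int (k u))"
        and fk: "finite {e. k e \<noteq> 0}" "{e. k e \<noteq> 0} \<subseteq> carrier E" and k0: "int_sum E k = \<zero>\<^bsub>E\<^esub>"
        unfolding K_def int_relations_def by blast
      have "k u + ?d b u = ?d a u" for u
      proof -
        have "of_int (k u) = (single a u - single b u)" using fun_cong[OF k, of u] by simp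
        also have "\<dots> = of_int (?d a u - ?d b u)" by (simp add: single_def)
        finally have "k u = ?d a u - ?d b u" by (simp only: of_int_eq_iff)
        then show ?thesis by simp
      qed
      then have "int_sum E (?d a) = int_sum E (\<lambda>u. k u + ?d b u)" by simp
      also have "\<dots> = int_sum E k \<oplus>\<^bsub>E\<^esub> int_sum E (?d b)"
        by (rule E.int_sum_add) (use b fk in auto)
      finally show "a = b" using a b k0 by (simp add: E.int_sum_single)
    qed
    have fin: "finite {u. inv_into (carrier F) q d u \<noteq> 0}" if "d \<in> carrier D" for d
    proof -
      have "inv_into (carrier F) q d \<in> carrier F" using that surj inv_into_into by metis
      then show ?thesis by (simp add: F_def rat_combinations_def)
    qed
    show "\<exists>s :: _ \<Rightarrow> 'u \<Rightarrow> rat. inj_on s (carrier D) \<and> (\<forall>d\<in>carrier D. finite {u. s d u \<noteq> 0})"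
    proof (intro exI conjI ballI)
      show "inj_on (inv_into (carrier F) q) (carrier D)" by (rule inj_on_inv_into) (simp add: surj)
    qed (rule fin)
  qed
qed

section \<open>Transport of structure and coinduced modules\<close>

definition transport_module :: "('u \<Rightarrow> 'v) \<Rightarrow> ('r, 'u) module \<Rightarrow> ('r, 'v) module"
  where "transport_module f M =
    (let g = inv_into (carrier M) f in
     \<lparr>carrier = f ` carrier M, monoid.mult = undefined, one = undefined, zero = f \<zero>\<^bsub>M\<^esub>,
      add = (\<lambda>x y. f (g x \<oplus>\<^bsub>M\<^esub> g y)), smult = (\<lambda>a x. f (a \<odot>\<^bsub>M\<^esub> g x))\<rparr>)"

lemma transport_module:
  assumes M: "module R M" and inj: "inj_on f (carrier M)"
  shows "carrier (transport_module f M) = f ` carrier M"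
    and "f \<in> mod_hom R M (transport_module f M)"
    and "module R (transport_module f M)"
    and "inv_into (carrier M) f \<in> mod_hom R (transport_module f M) M"
proof -
  interpret M: module R M by fact
  show c: "carrier (transport_module f M) = f ` carrier M"
    by (simp add: transport_module_def Let_def)
  show f: "f \<in> mod_hom R M (transport_module f M)"
    using inj by (intro mod_homI) (auto simp: transport_module_def Let_def)
  show "module R (transport_module f M)"
    by (rule module_surj_image[OF M f]) (auto simp: transport_module_def Let_def)
  show "inv_into (carrier M) f \<in> mod_hom R (transport_module f M) M"
    using inj by (intro mod_homI) (auto simp: transport_module_def Let_def)
qed

text \<open>An isomorphic copy of an injective module is injective; this moves injective modules to
  another type.\<close>

lemma injective_transport:
  fixes R :: "('r, 'x) ring_scheme" and M :: "('r, 'u) module"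
  assumes M: "injective_module R M" and inj: "inj_on f (carrier M)"
  shows "injective_module R (transport_module f M)"
  unfolding injective_module_def
proof (intro conjI allI impI)
  have mod: "module R M" using M by (simp add: injective_module_def)
  note T = transport_module[OF mod inj]
  show "module R (transport_module f M)" by (rule T(3))
  fix V W :: "('r, 'r) module" and i g
  assume *: "module R V \<and> module R W \<and> i \<in> mod_hom R V W \<and> inj_on i (carrier V) \<and>
    g \<in> mod_hom R V (transport_module f M)"
  then have "(\<lambda>x. inv_into (carrier M) f (g x)) \<in> mod_hom R V M"
    using mod_hom_comp[OF _ T(4)] by blast
  then obtain h where h: "h \<in> mod_hom R W M" "\<forall>x\<in>carrier V. h (i x) = inv_into (carrier M) f (g x)"
    using M * unfolding injective_module_def by blast
  have "f (inv_into (carrier M) f (g x)) = g x" if "x \<in> carrier V" for x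
    using mod_homD(1)[of g R V "transport_module f M" x] * that T(1) by (auto simp: f_inv_into_f)
  then show "\<exists>h\<in>mod_hom R W (transport_module f M). \<forall>x\<in>carrier V. h (i x) = g x"
    using h by (intro bexI[OF _ mod_hom_comp[OF h(1) T(2)]]) simp
qed

text \<open>The \<open>R\<close>-module $\mathrm{Hom}_{\mathbb Z}(R, D)$.\<close>

definition coinduced_module :: "('r, 'x) ring_scheme \<Rightarrow> ('d, 'y) ring_scheme \<Rightarrow> ('r, 'r \<Rightarrow> 'd) module"
  where "coinduced_module R D =
    \<lparr>carrier = {h. (\<forall>r\<in>carrier R. h r \<in> carrier D) \<and> (\<forall>r. r \<notin> carrier R \<longrightarrow> h r = undefined) \<and>
       (\<forall>r\<in>carrier R. \<forall>s\<in>carrier R. h (r \<oplus>\<^bsub>R\<^esub> s) = h r \<oplus>\<^bsub>D\<^esub> h s)},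
     monoid.mult = undefined, one = undefined, zero = (\<lambda>r\<in>carrier R. \<zero>\<^bsub>D\<^esub>),
     add = (\<lambda>h k. \<lambda>r\<in>carrier R. h r \<oplus>\<^bsub>D\<^esub> k r),
     smult = (\<lambda>a h. \<lambda>r\<in>carrier R. h (a \<otimes>\<^bsub>R\<^esub> r))\<rparr>"

lemma coinduced_module_is_module:
  assumes "cring R" "abelian_group D"
  shows "module R (coinduced_module R D)"
proof -
  interpret R: cring R by fact
  interpret D: abelian_group D by fact
  let ?H = "coinduced_module R D"
  have ext: "h = k" if "h \<in> carrier ?H" "k \<in> carrier ?H" "\<And>r. r \<in> carrier R \<Longrightarrow> h r = k r" for h k
  proof
    fix r show "h r = k r" using that by (cases "r \<in> carrier R") (auto simp: coinduced_module_def)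
  qed
  have cl: "h r \<in> carrier D" if "h \<in> carrier ?H" "r \<in> carrier R" for h r
    using that by (simp add: coinduced_module_def)
  have ad: "h (r \<oplus>\<^bsub>R\<^esub> s) = h r \<oplus>\<^bsub>D\<^esub> h s" if "h \<in> carrier ?H" "r \<in> carrier R" "s \<in> carrier R" for h r s
    using that by (simp add: coinduced_module_def)
  have add: "(h \<oplus>\<^bsub>?H\<^esub> k) r = h r \<oplus>\<^bsub>D\<^esub> k r" and zero: "\<zero>\<^bsub>?H\<^esub> r = \<zero>\<^bsub>D\<^esub>"
    and smult: "(a \<odot>\<^bsub>?H\<^esub> h) r = h (a \<otimes>\<^bsub>R\<^esub> r)" if "r \<in> carrier R" for h k r a
    using that by (auto simp: coinduced_module_def)
  have addc: "h \<oplus>\<^bsub>?H\<^esub> k \<in> carrier ?H" if "h \<in> carrier ?H" "k \<in> carrier ?H" for h k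
    using that by (auto simp: coinduced_module_def D.a_ac)
  have zeroc: "\<zero>\<^bsub>?H\<^esub> \<in> carrier ?H" by (auto simp: coinduced_module_def)
  have smultc: "a \<odot>\<^bsub>?H\<^esub> h \<in> carrier ?H" if "a \<in> carrier R" "h \<in> carrier ?H" for a h
    using that by (auto simp: coinduced_module_def R.r_distr)
  show ?thesis
  proof (rule moduleI)
    show "cring R" by fact
    show "abelian_group ?H"
    proof (rule abelian_groupI)
      fix h assume h: "h \<in> carrier ?H"
      have "(\<lambda>r\<in>carrier R. \<ominus>\<^bsub>D\<^esub> h r) \<in> carrier ?H"
        using h by (auto simp: coinduced_module_def D.minus_add)
      moreover from this have "(\<lambda>r\<in>carrier R. \<ominus>\<^bsub>D\<^esub> h r) \<oplus>\<^bsub>?H\<^esub> h = \<zero>\<^bsub>?H\<^esub>"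
        using h cl by (intro ext addc zeroc) (auto simp: add zero D.l_neg)
      ultimately show "\<exists>k\<in>carrier ?H. k \<oplus>\<^bsub>?H\<^esub> h = \<zero>\<^bsub>?H\<^esub>" by blast
      show "\<zero>\<^bsub>?H\<^esub> \<oplus>\<^bsub>?H\<^esub> h = h" using h by (intro ext addc zeroc) (auto simp: add zero cl)
    next
      show "h \<oplus>\<^bsub>?H\<^esub> k = k \<oplus>\<^bsub>?H\<^esub> h" if "h \<in> carrier ?H" "k \<in> carrier ?H" for h k
        using that by (intro ext addc) (auto simp: add cl D.a_comm)
      show "h \<oplus>\<^bsub>?H\<^esub> k \<oplus>\<^bsub>?H\<^esub> l = h \<oplus>\<^bsub>?H\<^esub> (k \<oplus>\<^bsub>?H\<^esub> l)"
        if "h \<in> carrier ?H" "k \<in> carrier ?H" "l \<in> carrier ?H" for h k l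
        using that by (intro ext addc) (auto simp: add cl D.a_assoc)
    qed (fact addc zeroc)+
    show "a \<odot>\<^bsub>?H\<^esub> h \<in> carrier ?H" if "a \<in> carrier R" "h \<in> carrier ?H" for a h
      using smultc[OF that] .
    show "(a \<oplus>\<^bsub>R\<^esub> b) \<odot>\<^bsub>?H\<^esub> h = a \<odot>\<^bsub>?H\<^esub> h \<oplus>\<^bsub>?H\<^esub> b \<odot>\<^bsub>?H\<^esub> h"
      if "a \<in> carrier R" "b \<in> carrier R" "h \<in> carrier ?H" for a b h
      using that by (intro ext addc smultc) (auto simp: add smult ad R.l_distr)
    show "a \<odot>\<^bsub>?H\<^esub> (h \<oplus>\<^bsub>?H\<^esub> k) = a \<odot>\<^bsub>?H\<^esub> h \<oplus>\<^bsub>?H\<^esub> a \<odot>\<^bsub>?H\<^esub> k"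
      if "a \<in> carrier R" "h \<in> carrier ?H" "k \<in> carrier ?H" for a h k
      using that by (intro ext addc smultc) (auto simp: add smult)
    show "a \<otimes>\<^bsub>R\<^esub> b \<odot>\<^bsub>?H\<^esub> h = a \<odot>\<^bsub>?H\<^esub> (b \<odot>\<^bsub>?H\<^esub> h)"
      if "a \<in> carrier R" "b \<in> carrier R" "h \<in> carrier ?H" for a b h
      using that by (intro ext smultc) (auto simp: smult R.m_ac)
    show "\<one>\<^bsub>R\<^esub> \<odot>\<^bsub>?H\<^esub> h = h" if "h \<in> carrier ?H" for h
      using that by (intro ext smultc) (auto simp: smult)
  qed
qed

text \<open>Evaluation at \<open>\<one>\<close> identifies the \<open>R\<close>-linear maps into $\mathrm{Hom}_{\mathbb Z}(R, D)$
  with the additive maps into \<open>D\<close>, so the extension problem reduces to the one for \<open>D\<close>.\<close>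

lemma coinduced_module_injective:
  fixes R :: "('r, 'x) ring_scheme" and D :: "('d, 'y) ring_scheme"
  assumes "cring R" "abelian_group D" "divisible_group D"
  shows "injective_module R (coinduced_module R D)"
  unfolding injective_module_def
proof (intro conjI allI impI)
  let ?H = "coinduced_module R D"
  show H: "module R ?H" by (rule coinduced_module_is_module[OF assms(1,2)])
  fix V W :: "('r, 'r) module" and f g
  assume *: "module R V \<and> module R W \<and> f \<in> mod_hom R V W \<and> inj_on f (carrier V) \<and> g \<in> mod_hom R V ?H"
  then interpret V: module R V by blast
  interpret W: module R W using * by blast
  interpret D: abelian_group D by fact
  have f: "f \<in> mod_hom R V W" and inj: "inj_on f (carrier V)" and g: "g \<in> mod_hom R V ?H" using * by auto
  note fD = mod_homD[OF f] and gD = mod_homD[OF g]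
  let ?i = "inv_into (carrier V) f"
  have i: "?i (f v) = v" if "v \<in> carrier V" for v using that inj by simp
  have gc: "g v r \<in> carrier D" if "v \<in> carrier V" "r \<in> carrier R" for v r
    using gD(1)[OF that(1)] that(2) by (simp add: coinduced_module_def)
  have S: "additive_subgroup (f ` carrier V) W"
  proof (rule additive_subgroupI, rule W.add.subgroupI)
    show "f ` carrier V \<subseteq> carrier W" using fD(1) by blast
    show "f ` carrier V \<noteq> {}" by blast
    show "\<ominus>\<^bsub>W\<^esub> a \<in> f ` carrier V" if a: "a \<in> f ` carrier V" for a
    proof -
      obtain v where v: "v \<in> carrier V" "a = f v" using a by blast
      have "\<ominus>\<^bsub>W\<^esub> a = f (\<ominus>\<^bsub>V\<^esub> v)"
        using mod_hom_zero(2)[OF V.module_axioms W.module_axioms f v(1)] v(2) by simp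
      then show ?thesis using v by simp
    qed
    show "a \<oplus>\<^bsub>W\<^esub> b \<in> f ` carrier V" if ab: "a \<in> f ` carrier V" "b \<in> f ` carrier V" for a b
    proof -
      obtain v w where "v \<in> carrier V" "a = f v" "w \<in> carrier V" "b = f w" using ab by blast
      then show ?thesis using fD(2)[of v w] by (metis V.M.a_closed imageI)
    qed
  qed
  obtain \<psi> where \<psi>: "\<And>w. w \<in> carrier W \<Longrightarrow> \<psi> w \<in> carrier D"
      "\<And>v w. v \<in> carrier W \<Longrightarrow> w \<in> carrier W \<Longrightarrow> \<psi> (v \<oplus>\<^bsub>W\<^esub> w) = \<psi> v \<oplus>\<^bsub>D\<^esub> \<psi> w"
      "\<And>s. s \<in> f ` carrier V \<Longrightarrow> \<psi> s = g (?i s) \<one>\<^bsub>R\<^esub>"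
  proof (rule divisible_extension[OF W.M.abelian_group_axioms assms(2,3) S, of "\<lambda>s. g (?i s) \<one>\<^bsub>R\<^esub>"])
    show "g (?i s) \<one>\<^bsub>R\<^esub> \<in> carrier D" if "s \<in> f ` carrier V" for s using that gc i by auto
    show "g (?i (s \<oplus>\<^bsub>W\<^esub> t)) \<one>\<^bsub>R\<^esub> = g (?i s) \<one>\<^bsub>R\<^esub> \<oplus>\<^bsub>D\<^esub> g (?i t) \<one>\<^bsub>R\<^esub>"
      if st: "s \<in> f ` carrier V" "t \<in> f ` carrier V" for s t
    proof -
      obtain v w where v: "v \<in> carrier V" "s = f v" and w: "w \<in> carrier V" "t = f w" using st by blast
      have "?i (s \<oplus>\<^bsub>W\<^esub> t) = v \<oplus>\<^bsub>V\<^esub> w" using v w fD(2)[of v w] i[of "v \<oplus>\<^bsub>V\<^esub> w"] by simp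
      then show ?thesis using v w i gD(2)[of v w] by (simp add: coinduced_module_def)
    qed
  qed blast
  define h where "h = (\<lambda>w. \<lambda>r\<in>carrier R. \<psi> (r \<odot>\<^bsub>W\<^esub> w))"
  have "h \<in> mod_hom R W ?H"
  proof (rule mod_homI)
    show "h w \<in> carrier ?H" if "w \<in> carrier W" for w
      using that \<psi>(1,2) by (auto simp: h_def coinduced_module_def W.smult_l_distr)
    show "h (v \<oplus>\<^bsub>W\<^esub> w) = h v \<oplus>\<^bsub>?H\<^esub> h w" if "v \<in> carrier W" "w \<in> carrier W" for v w
      using that \<psi>(2) by (auto simp: h_def coinduced_module_def W.smult_r_distr)
    show "h (a \<odot>\<^bsub>W\<^esub> w) = a \<odot>\<^bsub>?H\<^esub> h w" if "a \<in> carrier R" "w \<in> carrier W" for a w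
      using that by (auto simp: h_def coinduced_module_def W.smult_assoc1 V.R.m_comm[of a]
          simp flip: W.smult_assoc1)
  qed
  moreover have "h (f v) = g v" if v: "v \<in> carrier V" for v
  proof
    fix r show "h (f v) r = g v r"
    proof (cases "r \<in> carrier R")
      case True
      have "h (f v) r = \<psi> (f (r \<odot>\<^bsub>V\<^esub> v))" using True v fD(3) by (simp add: h_def)
      also have "\<dots> = g (r \<odot>\<^bsub>V\<^esub> v) \<one>\<^bsub>R\<^esub>" using \<psi>(3) True v i by simp
      also have "\<dots> = g v r" using gD(3)[OF True v] True by (simp add: coinduced_module_def)
      finally show ?thesis .
    next
      case False
      then show ?thesis using gD(1)[OF v] by (simp add: h_def coinduced_module_def)
    qed
  qed
  ultimately show "\<exists>h\<in>mod_hom R W ?H. \<forall>x\<in>carrier V. h (f x) = g x" by blast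
qed

text \<open>With \<open>D\<close> the divisible hull of \<open>E\<close>, the map $E \to \mathrm{Hom}_{\mathbb Z}(R, D)$ that
  sends $e$ to $r \mapsto r e$ is an embedding. The injections \<open>\<Psi>\<close> and \<open>\<Phi>\<close> express that the
  type of \<open>E\<close> is large enough to hold the finitely supported rational combinations of its
  elements and the functions on \<open>R\<close>; they bring the injective module back to the type of \<open>E\<close>.\<close>

lemma injective_embedding:
  fixes R :: "('r, 'x) ring_scheme" and E :: "('r, 'u) module"
    and \<Phi> :: "('r \<Rightarrow> 'u) \<Rightarrow> 'u" and \<Psi> :: "('u \<times> rat) list \<Rightarrow> 'u"
  assumes E: "module R E" and \<Phi>: "inj \<Phi>" and \<Psi>: "inj \<Psi>"
  shows "\<exists>(J :: ('r, 'u) module) \<iota>. injective_module R J \<and> \<iota> \<in> mod_hom R E J \<and> inj_on \<iota> (carrier E)"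
proof -
  interpret E: module R E by fact
  obtain D :: "(int, ('u \<Rightarrow> rat) set) module" and \<delta>
    where D: "abelian_group D" "divisible_group D"
      and \<delta>c: "\<And>a. a \<in> carrier E \<Longrightarrow> \<delta> a \<in> carrier D"
      and \<delta>a: "\<And>a b. a \<in> carrier E \<Longrightarrow> b \<in> carrier E \<Longrightarrow> \<delta> (a \<oplus>\<^bsub>E\<^esub> b) = \<delta> a \<oplus>\<^bsub>D\<^esub> \<delta> b"
      and \<delta>i: "inj_on \<delta> (carrier E)"
      and s: "\<exists>s :: _ \<Rightarrow> 'u \<Rightarrow> rat. inj_on s (carrier D) \<and> (\<forall>d\<in>carrier D. finite {u. s d u \<noteq> 0})"
    using divisible_hull[OF E.M.abelian_group_axioms] by metis
  obtain s :: "_ \<Rightarrow> 'u \<Rightarrow> rat" where s: "inj_on s (carrier D)" "\<And>d. d \<in> carrier D \<Longrightarrow> finite {u. s d u \<noteq> 0}" using s by blast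
  define supp where "supp d = (SOME us. set us = {u. s d u \<noteq> 0})" for d
  have supp: "set (supp d) = {u. s d u \<noteq> 0}" if "d \<in> carrier D" for d
    unfolding supp_def using someI_ex[OF finite_list[OF s(2)[OF that]]] .
  \<comment> \<open>A finitely supported representative is determined by the list of its nonzero values.\<close>
  define j where "j = (\<lambda>d. \<Psi> (map (\<lambda>u. (u, s d u)) (supp d)))"
  have j: "inj_on j (carrier D)"
  proof (rule inj_onI)
    fix d e assume d: "d \<in> carrier D" and e: "e \<in> carrier D" and "j d = j e"
    then have eq: "map (\<lambda>u. (u, s d u)) (supp d) = map (\<lambda>u. (u, s e u)) (supp e)"
      using injD[OF \<Psi>] by (simp add: j_def)
    have graph: "(u, q) \<in> set (map (\<lambda>u. (u, s d u)) (supp d)) \<longleftrightarrow> q = s d u \<and> q \<noteq> 0"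
      if "d \<in> carrier D" for u q d using supp[OF that] by auto
    have "s d u = s e u" for u
      using graph[OF d, of u "s d u"] graph[OF e, of u "s d u"] graph[OF d, of u "s e u"]
        graph[OF e, of u "s e u"] eq by auto
    then show "d = e" using inj_onD[OF s(1) _ d e] by blast
  qed
  let ?H = "coinduced_module R D"
  define k where "k = (\<lambda>h r. if r \<in> carrier R then j (h r) else undefined)"
  have k: "inj_on k (carrier ?H)"
  proof (rule inj_onI)
    fix h h' assume h: "h \<in> carrier ?H" "h' \<in> carrier ?H" and eq: "k h = k h'"
    show "h = h'"
    proof
      fix r show "h r = h' r"
      proof (cases "r \<in> carrier R")
        case True
        then have "j (h r) = j (h' r)" using fun_cong[OF eq, of r] by (simp add: k_def)
        then show ?thesis using inj_onD[OF j] h True by (auto simp: coinduced_module_def)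
      qed (use h in \<open>auto simp: coinduced_module_def\<close>)
    qed
  qed
  have Hinj: "injective_module R ?H" by (rule coinduced_module_injective[OF E.R.cring_axioms D])
  then have H: "module R ?H" by (simp add: injective_module_def)
  have inj: "inj_on (\<Phi> \<circ> k) (carrier ?H)" using k \<Phi> by (auto intro!: comp_inj_on intro: inj_on_subset)
  define \<iota> where "\<iota> = (\<lambda>e. \<lambda>r\<in>carrier R. \<delta> (r \<odot>\<^bsub>E\<^esub> e))"
  have \<iota>: "\<iota> \<in> mod_hom R E ?H"
  proof (rule mod_homI)
    show "\<iota> w \<in> carrier ?H" if "w \<in> carrier E" for w
      using that \<delta>c \<delta>a by (auto simp: \<iota>_def coinduced_module_def E.smult_l_distr)
    show "\<iota> (v \<oplus>\<^bsub>E\<^esub> w) = \<iota> v \<oplus>\<^bsub>?H\<^esub> \<iota> w" if "v \<in> carrier E" "w \<in> carrier E" for v w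
      using that \<delta>a by (auto simp: \<iota>_def coinduced_module_def E.smult_r_distr intro!: restrict_ext)
    show "\<iota> (a \<odot>\<^bsub>E\<^esub> w) = a \<odot>\<^bsub>?H\<^esub> \<iota> w" if "a \<in> carrier R" "w \<in> carrier E" for a w
      using that by (auto simp: \<iota>_def coinduced_module_def E.R.m_comm[of a] E.smult_assoc1 intro!: restrict_ext)
  qed
  have "inj_on \<iota> (carrier E)"
  proof (rule inj_onI)
    fix a b assume ab: "a \<in> carrier E" "b \<in> carrier E" and eq: "\<iota> a = \<iota> b"
    have "\<delta> a = \<delta> b" using fun_cong[OF eq, of "\<one>\<^bsub>R\<^esub>"] ab by (simp add: \<iota>_def)
    then show "a = b" using inj_onD[OF \<delta>i] ab by blast
  qed
  then have "inj_on (\<lambda>x. (\<Phi> \<circ> k) (\<iota> x)) (carrier E)"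
    using inj mod_homD(1)[OF \<iota>] unfolding inj_on_def by blast
  then show ?thesis
    using injective_transport[OF Hinj inj] mod_hom_comp[OF \<iota> transport_module(2)[OF H inj]] by blast
qed

section \<open>Injective resolutions\<close>

text \<open>The type \<open>'r list\<close> is infinite whether or not \<open>'r\<close> is, so it is in bijection with its
  square, and functions of two arguments can be encoded by functions of one.\<close>

lemma ex_inj_fun_code:
  "\<exists>\<Phi> :: ('r list \<Rightarrow> ('r list \<Rightarrow> 'b)) \<Rightarrow> ('r list \<Rightarrow> 'b). inj \<Phi>"
proof -
  obtain p :: "'r list \<times> 'r list \<Rightarrow> 'r list" where p: "bij p"
    using card_of_Times_same_infinite[OF infinite_UNIV_listI[where 'a = 'r]]
    unfolding card_of_ordIso[symmetric] by auto
  define q where "q = inv_into UNIV p"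
  have q: "q (p x) = x" for x using p by (simp add: q_def bij_is_inj)
  have "inj (\<lambda>(f :: 'r list \<Rightarrow> 'r list \<Rightarrow> 'b) x. f (fst (q x)) (snd (q x)))"
  proof (rule injI, intro ext)
    fix f g :: "'r list \<Rightarrow> 'r list \<Rightarrow> 'b" and x y
    assume "(\<lambda>x. f (fst (q x)) (snd (q x))) = (\<lambda>x. g (fst (q x)) (snd (q x)))"
    from fun_cong[OF this, of "p (x, y)"] show "f x y = g x y" by (simp add: q)
  qed
  then show ?thesis by blast
qed

text \<open>A list is encoded by its length, stored at the argument \<open>[]\<close>, and by its entries, stored at
  arguments of positive length.\<close>

lemma ex_inj_list_code:
  "\<exists>\<Lambda> :: ('r list \<Rightarrow> 'e + nat) list \<Rightarrow> ('r list \<Rightarrow> 'e + nat). inj \<Lambda>"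
proof -
  obtain \<Phi> :: "('r list \<Rightarrow> ('r list \<Rightarrow> 'e + nat)) \<Rightarrow> ('r list \<Rightarrow> 'e + nat)" where \<Phi>: "inj \<Phi>"
    using ex_inj_fun_code by blast
  define enc :: "('r list \<Rightarrow> 'e + nat) list \<Rightarrow> ('r list \<Rightarrow> ('r list \<Rightarrow> 'e + nat))" where
    "enc = (\<lambda>l x. if x = [] then (\<lambda>_. Inr (length l)) else l ! (length x - 1))"
  have len: "length l = length l'" if "enc l = enc l'" for l l'
  proof -
    have "enc l [] undefined = Inr (length l)" for l by (simp add: enc_def)
    then show ?thesis using that by (metis sum.inject(2))
  qed
  have nth: "l ! i = l' ! i" if "enc l = enc l'" for l l' i
  proof -
    have "enc l (replicate (Suc i) undefined) = l ! i" for l by (simp add: enc_def)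
    then show ?thesis using that by metis
  qed
  have "inj enc"
  proof (rule injI)
    fix l l' assume eq: "enc l = enc l'"
    show "l = l'" by (rule nth_equalityI[OF len[OF eq] nth[OF eq]])
  qed
  then show ?thesis using inj_compose[OF \<Phi>] by blast
qed

lemma ex_inj_pair_list_code:
  "\<exists>\<Psi> :: (('r list \<Rightarrow> 'e + nat) \<times> rat) list \<Rightarrow> ('r list \<Rightarrow> 'e + nat). inj \<Psi>"
proof -
  obtain \<Lambda> :: "('r list \<Rightarrow> 'e + nat) list \<Rightarrow> ('r list \<Rightarrow> 'e + nat)" where \<Lambda>: "inj \<Lambda>"
    using ex_inj_list_code by blast
  define pc :: "('r list \<Rightarrow> 'e + nat) \<times> rat \<Rightarrow> ('r list \<Rightarrow> 'e + nat)" where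
    "pc = (\<lambda>(u, q). \<Lambda> [u, \<lambda>_. Inr (to_nat q)])"
  have const_eq: "(\<lambda>_ :: 'r list. Inr (to_nat q) :: 'e + nat) = (\<lambda>_. Inr (to_nat q')) \<longleftrightarrow> q = q'"
    for q q' :: rat by (simp add: fun_eq_iff)
  have "inj pc"
    by (rule injI) (auto simp: pc_def inj_eq[OF \<Lambda>] const_eq)
  then have "inj (map pc)" by simp
  then show ?thesis using inj_compose[OF \<Lambda>] by blast
qed

lemma ex_inj_coeff_code:
  "\<exists>\<Phi> :: ('r \<Rightarrow> ('r list \<Rightarrow> 'b)) \<Rightarrow> ('r list \<Rightarrow> 'b). inj \<Phi>"
proof -
  obtain \<Phi> :: "('r list \<Rightarrow> ('r list \<Rightarrow> 'b)) \<Rightarrow> ('r list \<Rightarrow> 'b)" where \<Phi>: "inj \<Phi>"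
    using ex_inj_fun_code by blast
  have "inj (\<lambda>(f :: 'r \<Rightarrow> ('r list \<Rightarrow> 'b)) x. f (hd x))"
  proof (rule injI, rule ext)
    fix f g :: "'r \<Rightarrow> ('r list \<Rightarrow> 'b)" and r assume "(\<lambda>x. f (hd x)) = (\<lambda>x. g (hd x))"
    from fun_cong[OF this, of "[r]"] show "f r = g r" by simp
  qed
  then show ?thesis using inj_compose[OF \<Phi>] by blast
qed

text \<open>One step of a resolution: an embedding into an injective module \<open>J\<close>, together with
  the cokernel of the embedding, realized on the same type.\<close>

lemma resolution_step:
  fixes R :: "('r, 'x) ring_scheme" and C :: "('r, 'r list \<Rightarrow> 'e + nat) module"
  assumes C: "module R C"
  shows "\<exists>(J :: ('r, 'r list \<Rightarrow> 'e + nat) module) \<iota> (C' :: ('r, 'r list \<Rightarrow> 'e + nat) module) q.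
    injective_module R J \<and> \<iota> \<in> mod_hom R C J \<and> inj_on \<iota> (carrier C) \<and> module R C' \<and>
    q \<in> mod_hom R J C' \<and> q ` carrier J = carrier C' \<and>
    {y \<in> carrier J. q y = \<zero>\<^bsub>C'\<^esub>} = \<iota> ` carrier C"
proof -
  obtain \<Phi> :: "('r \<Rightarrow> ('r list \<Rightarrow> 'e + nat)) \<Rightarrow> ('r list \<Rightarrow> 'e + nat)" where \<Phi>: "inj \<Phi>"
    using ex_inj_coeff_code by blast
  obtain \<Psi> :: "(('r list \<Rightarrow> 'e + nat) \<times> rat) list \<Rightarrow> ('r list \<Rightarrow> 'e + nat)" where \<Psi>: "inj \<Psi>"
    using ex_inj_pair_list_code by blast
  obtain J :: "('r, 'r list \<Rightarrow> 'e + nat) module" and \<iota>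
    where J: "injective_module R J" and \<iota>: "\<iota> \<in> mod_hom R C J" "inj_on \<iota> (carrier C)"
    using injective_embedding[OF C \<Phi> \<Psi>] by blast
  interpret C: module R C by fact
  interpret J: module R J using J by (simp add: injective_module_def)
  have S: "submodule (\<iota> ` carrier C) R J"
    by (rule C.image_submodule[OF J.module_axioms \<iota>(1) C.carrier_is_submodule])
  define Q where "Q = J QuotM (\<iota> ` carrier C)"
  define p where "p = (\<lambda>y. \<iota> ` carrier C +>\<^bsub>J\<^esub> y)"
  have Q: "module R Q" "p \<in> mod_hom R J Q" "p ` carrier J = carrier Q" "p \<zero>\<^bsub>J\<^esub> = \<zero>\<^bsub>Q\<^esub>"
    unfolding Q_def p_def using J.quot_map[OF S] by auto
  \<comment> \<open>Choosing a representative in every coset moves the cokernel back to the type of \<open>J\<close>.\<close>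
  define f where "f = inv_into (carrier J) p"
  have f: "inj_on f (carrier Q)" unfolding f_def by (rule inj_on_inv_into) (simp add: Q(3))
  note T = transport_module[OF Q(1) f]
  let ?q = "\<lambda>y. f (p y)"
  have "f (p y) = \<zero>\<^bsub>transport_module f Q\<^esub> \<longleftrightarrow> y \<in> \<iota> ` carrier C" if y: "y \<in> carrier J" for y
  proof -
    have "f (p y) = \<zero>\<^bsub>transport_module f Q\<^esub> \<longleftrightarrow> f (p y) = f (p \<zero>\<^bsub>J\<^esub>)"
      using mod_hom_zero(1)[OF Q(1) T(3) T(2)] Q(4) by simp
    also have "\<dots> \<longleftrightarrow> p y = p \<zero>\<^bsub>J\<^esub>"
      using inj_on_eq_iff[OF f] mod_homD(1)[OF Q(2)] y by simp
    also have "\<dots> \<longleftrightarrow> y \<ominus>\<^bsub>J\<^esub> \<zero>\<^bsub>J\<^esub> \<in> \<iota> ` carrier C"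
      unfolding p_def by (rule J.coset_eq_iff[OF S y J.M.zero_closed])
    also have "y \<ominus>\<^bsub>J\<^esub> \<zero>\<^bsub>J\<^esub> = y" using y by (rule J.diff_zero)
    finally show ?thesis .
  qed
  then have "{y \<in> carrier J. ?q y = \<zero>\<^bsub>transport_module f Q\<^esub>} = \<iota> ` carrier C"
    using mod_homD(1)[OF \<iota>(1)] by blast
  moreover have "?q ` carrier J = carrier (transport_module f Q)"
    unfolding T(1) Q(3)[symmetric] by (simp add: image_image)
  ultimately show ?thesis
    using J \<iota> T(3) mod_hom_comp[OF Q(2) T(2)] by blast
qed

text \<open>The resolution is obtained by iterating \<open>resolution_step\<close> on cokernels, starting from a copy
  of \<open>E\<close> on the target type.\<close>

lemma ex_injective_resolution:
  fixes R :: "('r, 'x) ring_scheme" and E :: "('r, 'e) module"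
  assumes E: "module R E"
  shows "\<exists>(J :: nat \<Rightarrow> ('r, 'r list \<Rightarrow> 'e + nat) module) d \<epsilon>. injective_resolution R E \<epsilon> J d"
proof -
  have "\<exists>s. \<forall>C :: ('r, 'r list \<Rightarrow> 'e + nat) module. module R C \<longrightarrow>
    (case s C of (J :: ('r, 'r list \<Rightarrow> 'e + nat) module, \<iota>, C' :: ('r, 'r list \<Rightarrow> 'e + nat) module, q) \<Rightarrow>
      injective_module R J \<and> \<iota> \<in> mod_hom R C J \<and> inj_on \<iota> (carrier C) \<and> module R C' \<and>
      q \<in> mod_hom R J C' \<and> q ` carrier J = carrier C' \<and>
      {y \<in> carrier J. q y = \<zero>\<^bsub>C'\<^esub>} = \<iota> ` carrier C)"
    by (intro choice allI) (use resolution_step in fastforce)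
  then obtain s where s: "\<And>C :: ('r, 'r list \<Rightarrow> 'e + nat) module. module R C \<Longrightarrow>
    (case s C of (J :: ('r, 'r list \<Rightarrow> 'e + nat) module, \<iota>, C' :: ('r, 'r list \<Rightarrow> 'e + nat) module, q) \<Rightarrow>
      injective_module R J \<and> \<iota> \<in> mod_hom R C J \<and> inj_on \<iota> (carrier C) \<and> module R C' \<and>
      q \<in> mod_hom R J C' \<and> q ` carrier J = carrier C' \<and>
      {y \<in> carrier J. q y = \<zero>\<^bsub>C'\<^esub>} = \<iota> ` carrier C)"
    by blast
  define Jf where "Jf C = fst (s C)" for C
  define \<iota>f where "\<iota>f C = fst (snd (s C))" for C
  define Cf where "Cf C = fst (snd (snd (s C)))" for C
  define qf where "qf C = snd (snd (snd (s C)))" for C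
  have step: "injective_module R (Jf C)" "\<iota>f C \<in> mod_hom R C (Jf C)" "inj_on (\<iota>f C) (carrier C)"
    "module R (Cf C)" "qf C \<in> mod_hom R (Jf C) (Cf C)" "qf C ` carrier (Jf C) = carrier (Cf C)"
    "{y \<in> carrier (Jf C). qf C y = \<zero>\<^bsub>Cf C\<^esub>} = \<iota>f C ` carrier C" if "module R C" for C
    using s[OF that] by (simp_all add: Jf_def \<iota>f_def Cf_def qf_def case_prod_beta)
  define e :: "'e \<Rightarrow> 'r list \<Rightarrow> 'e + nat" where "e = (\<lambda>x _. Inl x)"
  have e: "inj_on e (carrier E)" by (auto simp: e_def inj_on_def dest: fun_cong)
  note T = transport_module[OF E e]
  define C where "C n = (Cf ^^ n) (transport_module e E)" for n
  have C: "module R (C n)" for n by (induction n) (simp_all add: C_def T(3) step(4))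
  have C0: "C 0 = transport_module e E" and CS: "C (Suc n) = Cf (C n)" for n by (simp_all add: C_def)
  define J where "J n = Jf (C n)" for n
  define d where "d n = (\<lambda>y. \<iota>f (C (Suc n)) (qf (C n) y))" for n
  define \<epsilon> where "\<epsilon> = (\<lambda>x. \<iota>f (C 0) (e x))"
  have J: "injective_module R (J n)" for n unfolding J_def by (rule step(1)[OF C])
  then have Jm: "module R (J n)" for n by (simp add: injective_module_def)
  have q: "qf (C n) \<in> mod_hom R (J n) (C (Suc n))" for n
    using step(5)[OF C] by (simp add: J_def CS)
  have \<iota>: "\<iota>f (C n) \<in> mod_hom R (C n) (J n)" for n
    using step(2)[OF C] by (simp add: J_def)
  have ker: "{y \<in> carrier (J n). d n y = \<zero>\<^bsub>J (Suc n)\<^esub>} = \<iota>f (C n) ` carrier (C n)" for n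
  proof -
    have "d n y = \<zero>\<^bsub>J (Suc n)\<^esub> \<longleftrightarrow> qf (C n) y = \<zero>\<^bsub>C (Suc n)\<^esub>" if y: "y \<in> carrier (J n)" for y
    proof -
      interpret CS: module R "C (Suc n)" by (rule C)
      have "\<iota>f (C (Suc n)) \<zero>\<^bsub>C (Suc n)\<^esub> = \<zero>\<^bsub>J (Suc n)\<^esub>"
        by (rule mod_hom_zero(1)[OF C Jm \<iota>])
      then show ?thesis using inj_on_eq_iff[OF step(3)[OF C] mod_homD(1)[OF q y] CS.M.zero_closed]
        by (simp add: d_def)
    qed
    then show ?thesis using step(7)[OF C[of n]] by (auto simp: J_def CS)
  qed
  have "injective_resolution R E \<epsilon> J d"
    unfolding injective_resolution_def
  proof (intro conjI allI)
    show "\<epsilon> \<in> mod_hom R E (J 0)"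
      unfolding \<epsilon>_def using mod_hom_comp[OF T(2)[folded C0] \<iota>] .
    show "d n \<in> mod_hom R (J n) (J (Suc n))" for n
      unfolding d_def by (rule mod_hom_comp[OF q \<iota>])
    show "inj_on \<epsilon> (carrier E)"
      using e step(3)[OF C[of 0]] by (auto simp: inj_on_def \<epsilon>_def C0 T(1))
    show "\<epsilon> ` carrier E = {y \<in> carrier (J 0). d 0 y = \<zero>\<^bsub>J 1\<^esub>}"
      using ker[of 0] by (auto simp: \<epsilon>_def C0 T(1))
    show "d n ` carrier (J n) = {y \<in> carrier (J (Suc n)). d (Suc n) y = \<zero>\<^bsub>J (Suc (Suc n))\<^esub>}" for n
    proof -
      have "d n ` carrier (J n) = \<iota>f (C (Suc n)) ` (qf (C n) ` carrier (J n))"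
        by (auto simp: d_def)
      also have "qf (C n) ` carrier (J n) = carrier (C (Suc n))"
        using step(6)[OF C[of n]] by (simp add: J_def CS)
      finally show ?thesis using ker[of "Suc n"] by simp
    qed
  qed (use E J in auto)
  then show ?thesis by blast
qed

section \<open>The first local cohomology module\<close>

lemma (in cring) ideal_power_ideal:
  assumes "ideal I R" shows "ideal (ideal_power R I n) R"
  by (induction n) (auto intro: oneideal ideal_prod_is_ideal assms)

lemma (in cring) ideal_power_antimono:
  assumes I: "ideal I R" and le: "m \<le> n" shows "ideal_power R I n \<subseteq> ideal_power R I m"
  using le
proof (induction rule: dec_induct)
  case (step n)
  have "ideal_power R I (Suc n) \<subseteq> ideal_power R I n"
    using ideal_prod_inter[OF I ideal_power_ideal[OF I, of n]] by simp
  then show ?case using step.IH by blast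
qed simp

definition ideal_module :: "('r, 'x) ring_scheme \<Rightarrow> 'r set \<Rightarrow> ('r, 'r) module"
  where "ideal_module R I =
    \<lparr>carrier = I, monoid.mult = undefined, one = undefined, zero = \<zero>\<^bsub>R\<^esub>, add = add R, smult = monoid.mult R\<rparr>"

lemma (in cring) ideal_module_is_module:
  assumes I: "ideal I R" shows "module R (ideal_module R I)"
proof -
  interpret I: ideal I R by fact
  note c = I.Icarr
  show ?thesis
  proof (rule moduleI)
    show "cring R" by (rule is_cring)
    show "abelian_group (ideal_module R I)"
    proof (rule abelian_groupI)
      fix x assume x: "x \<in> carrier (ideal_module R I)"
      then show "\<exists>y\<in>carrier (ideal_module R I). y \<oplus>\<^bsub>ideal_module R I\<^esub> x = \<zero>\<^bsub>ideal_module R I\<^esub>"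
        by (intro bexI[of _ "\<ominus> x"]) (auto simp: ideal_module_def c l_neg)
    qed (auto simp: ideal_module_def c a_ac I.a_closed)
  qed (auto simp: ideal_module_def c l_distr r_distr m_assoc I.I_l_closed)
qed

lemma torsion_part_submodule:
  assumes "module R E" and I: "ideal I R"
  shows "submodule (torsion_part R I E) R E"
proof -
  interpret E: module R E by fact
  note carr = ideal.Icarr[OF E.R.ideal_power_ideal[OF I]]
  show ?thesis
  proof (rule E.submoduleI)
    show "torsion_part R I E \<subseteq> carrier E" by (auto simp: torsion_part_def)
    show "\<zero>\<^bsub>E\<^esub> \<in> torsion_part R I E" using carr by (auto simp: torsion_part_def)
    show "\<ominus>\<^bsub>E\<^esub> e \<in> torsion_part R I E" if "e \<in> torsion_part R I E" for e
      using that carr by (fastforce simp: torsion_part_def E.smult_r_minus)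
    show "e \<oplus>\<^bsub>E\<^esub> f \<in> torsion_part R I E" if ef: "e \<in> torsion_part R I E" "f \<in> torsion_part R I E" for e f
    proof -
      obtain m where m: "\<And>a. a \<in> ideal_power R I m \<Longrightarrow> a \<odot>\<^bsub>E\<^esub> e = \<zero>\<^bsub>E\<^esub>" using ef by (auto simp: torsion_part_def)
      obtain n where n: "\<And>a. a \<in> ideal_power R I n \<Longrightarrow> a \<odot>\<^bsub>E\<^esub> f = \<zero>\<^bsub>E\<^esub>" using ef by (auto simp: torsion_part_def)
      have "a \<odot>\<^bsub>E\<^esub> (e \<oplus>\<^bsub>E\<^esub> f) = \<zero>\<^bsub>E\<^esub>" if a: "a \<in> ideal_power R I (max m n)" for a
      proof -
        have "a \<odot>\<^bsub>E\<^esub> e = \<zero>\<^bsub>E\<^esub>"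
          by (rule m) (use a E.R.ideal_power_antimono[OF I, of m "max m n"] in auto)
        moreover have "a \<odot>\<^bsub>E\<^esub> f = \<zero>\<^bsub>E\<^esub>"
          by (rule n) (use a E.R.ideal_power_antimono[OF I, of n "max m n"] in auto)
        ultimately show ?thesis using carr[OF a] ef by (simp add: E.smult_r_distr torsion_part_def)
      qed
      then show ?thesis using ef by (auto simp: torsion_part_def)
    qed
    show "r \<odot>\<^bsub>E\<^esub> e \<in> torsion_part R I E" if r: "r \<in> carrier R" and e: "e \<in> torsion_part R I E" for r e
    proof -
      obtain m where m: "\<And>a. a \<in> ideal_power R I m \<Longrightarrow> a \<odot>\<^bsub>E\<^esub> e = \<zero>\<^bsub>E\<^esub>" using e by (auto simp: torsion_part_def)
      have "a \<odot>\<^bsub>E\<^esub> (r \<odot>\<^bsub>E\<^esub> e) = \<zero>\<^bsub>E\<^esub>" if "a \<in> ideal_power R I m" for a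
      proof -
        have "a \<odot>\<^bsub>E\<^esub> (r \<odot>\<^bsub>E\<^esub> e) = r \<odot>\<^bsub>E\<^esub> (a \<odot>\<^bsub>E\<^esub> e)"
          using r e carr[OF that] by (simp add: torsion_part_def E.R.m_comm flip: E.smult_assoc1)
        then show ?thesis using m[OF that] r by simp
      qed
      then show ?thesis using r e by (auto simp: torsion_part_def)
    qed
  qed
qed

lemma ideal_module_hom_iff:
  "f \<in> mod_hom R (ideal_module R J) E \<longleftrightarrow>
    (\<forall>p\<in>J. f p \<in> carrier E) \<and> (\<forall>p\<in>J. \<forall>q\<in>J. f (p \<oplus>\<^bsub>R\<^esub> q) = f p \<oplus>\<^bsub>E\<^esub> f q) \<and>
    (\<forall>a\<in>carrier R. \<forall>p\<in>J. f (a \<otimes>\<^bsub>R\<^esub> p) = a \<odot>\<^bsub>E\<^esub> f p)"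
  by (auto simp: mod_hom_def ideal_module_def)

text \<open>The vanishing of $\varinjlim \mathrm{Ext}^1(R/\mathfrak a^n, E)$, where
  $\mathrm{Ext}^1(R/\mathfrak a^n, E)$ is the cokernel of the map
  $E \to \mathrm{Hom}(\mathfrak a^n, E)$ that sends an element to multiplication by it.\<close>

definition homs_eventually_scalar ::
    "('r, 'x) ring_scheme \<Rightarrow> 'r set \<Rightarrow> ('r, 'e) module \<Rightarrow> bool"
  where "homs_eventually_scalar R \<aa> E \<longleftrightarrow>
    (\<forall>n. \<forall>f\<in>mod_hom R (ideal_module R (ideal_power R \<aa> n)) E.
       \<exists>k\<ge>n. \<exists>z\<in>carrier E. \<forall>p\<in>ideal_power R \<aa> k. f p = p \<odot>\<^bsub>E\<^esub> z)"

text \<open>Dimension shifting. A homomorphism $f : \mathfrak a^n \to E$ extends to $R \to J^0$, so it is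
  multiplication by some $e \in J^0$, and $de$ is a torsion cocycle. Conversely a torsion
  cocycle has the form $de$, and multiplication by \<open>e\<close> maps some $\mathfrak a^n$ into \<open>E\<close>. The
  cocycle $de$ is the boundary of a torsion element iff \<open>e\<close> differs from an element of \<open>E\<close> by a
  torsion element, that is, iff \<open>f\<close> is eventually multiplication by an element of \<open>E\<close>.\<close>

lemma first_torsion_cohomology_zero_iff:
  fixes R :: "('r, 'x) ring_scheme" and E :: "('r, 'e) module" and J :: "nat \<Rightarrow> ('r, 'b) module"
  assumes res: "injective_resolution R E \<epsilon> J d" and \<aa>: "ideal \<aa> R"
  shows "carrier (torsion_cohomology R \<aa> J d 1) = {\<zero>\<^bsub>torsion_cohomology R \<aa> J d 1\<^esub>} \<longleftrightarrow>
    homs_eventually_scalar R \<aa> E"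
proof -
  \<comment> \<open>The facts about the terms of the resolution are instantiated for \<open>J 1\<close>, not \<open>J (Suc 0)\<close>.\<close>
  note One_nat_def [simp del]
  have E: "module R E" and Jinj: "\<And>n. injective_module R (J n)" and \<epsilon>: "\<epsilon> \<in> mod_hom R E (J 0)"
    and d: "\<And>n. d n \<in> mod_hom R (J n) (J (Suc n))" and inj: "inj_on \<epsilon> (carrier E)"
    and ex0: "\<epsilon> ` carrier E = {y \<in> carrier (J 0). d 0 y = \<zero>\<^bsub>J 1\<^esub>}"
    and ex: "\<And>n. d n ` carrier (J n) = {y \<in> carrier (J (Suc n)). d (Suc n) y = \<zero>\<^bsub>J (Suc (Suc n))\<^esub>}"
    using res unfolding injective_resolution_def by blast+
  have Jm: "module R (J n)" for n using Jinj by (simp add: injective_module_def)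
  interpret E: module R E by fact
  interpret J0: module R "J 0" by (rule Jm)
  interpret J1: module R "J 1" by (rule Jm)
  have d0: "d 0 \<in> mod_hom R (J 0) (J 1)" using d[of 0] by (simp add: One_nat_def)
  note dD = mod_homD[OF d0] and \<epsilon>D = mod_homD[OF \<epsilon>]
  have d\<epsilon>: "d 0 (\<epsilon> z) = \<zero>\<^bsub>J 1\<^esub>" if "z \<in> carrier E" for z using ex0 that by blast
  define Z where "Z = {y \<in> torsion_part R \<aa> (J 1). d 1 y = \<zero>\<^bsub>J 2\<^esub>}"
  define N where "N = d 0 ` torsion_part R \<aa> (J 0)"
  have \<aa>n: "ideal (ideal_power R \<aa> n) R" for n by (rule E.R.ideal_power_ideal[OF \<aa>])
  note carr = ideal.Icarr[OF \<aa>n]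
  have N: "submodule N R (J 1)"
    unfolding N_def by (rule J0.image_submodule[OF Jm d0 torsion_part_submodule[OF Jm \<aa>]])
  have zeroZ: "\<zero>\<^bsub>J 1\<^esub> \<in> Z"
    using J1.submodule_zero[OF torsion_part_submodule[OF Jm \<aa>]]
      mod_hom_zero(1)[OF Jm Jm d[of 1]] by (simp add: Z_def eval_nat_numeral One_nat_def)
  have ZJ: "y \<in> carrier (J 1)" if "y \<in> Z" for y using that by (auto simp: Z_def torsion_part_def)
  have "torsion_cohomology R \<aa> J d 1 = (J 1)\<lparr>carrier := Z\<rparr> QuotM N"
    unfolding torsion_cohomology_def by (simp add: Z_def N_def eval_nat_numeral One_nat_def)
  then have Hc: "carrier (torsion_cohomology R \<aa> J d 1) = (\<lambda>y. N +>\<^bsub>J 1\<^esub> y) ` Z"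
    and H0: "\<zero>\<^bsub>torsion_cohomology R \<aa> J d 1\<^esub> = N"
    by (auto simp: quot_module_def A_RCOSETS_def' a_r_coset_def')
  have NZ: "N +>\<^bsub>J 1\<^esub> y = N \<longleftrightarrow> y \<in> N" if y: "y \<in> Z" for y
  proof -
    have "N +>\<^bsub>J 1\<^esub> \<zero>\<^bsub>J 1\<^esub> = N" using J1.quot_map(3)[OF N] by (simp add: quot_module_def)
    then show ?thesis
      using J1.coset_eq_iff[OF N ZJ[OF y] J1.M.zero_closed] ZJ[OF y] by (simp add: J1.diff_zero)
  qed
  have const: "g ` Z = {c} \<longleftrightarrow> (\<forall>y\<in>Z. g y = c)" for g :: "_ \<Rightarrow> 'b set" and c
    using zeroZ by blast
  have "(\<lambda>y. N +>\<^bsub>J 1\<^esub> y) ` Z = {N} \<longleftrightarrow> (\<forall>y\<in>Z. N +>\<^bsub>J 1\<^esub> y = N)"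
    by (rule const)
  also have "\<dots> \<longleftrightarrow> Z \<subseteq> N" using NZ by (simp add: subset_eq)
  finally have "carrier (torsion_cohomology R \<aa> J d 1) = {\<zero>\<^bsub>torsion_cohomology R \<aa> J d 1\<^esub>} \<longleftrightarrow> Z \<subseteq> N"
    by (simp only: Hc H0)
  also have "Z \<subseteq> N \<longleftrightarrow> homs_eventually_scalar R \<aa> E"
  proof
    assume ZN: "Z \<subseteq> N"
    show "homs_eventually_scalar R \<aa> E" unfolding homs_eventually_scalar_def
    proof (intro allI ballI)
      fix n f assume f: "f \<in> mod_hom R (ideal_module R (ideal_power R \<aa> n)) E"
      let ?V = "ideal_module R (ideal_power R \<aa> n)" and ?W = "ideal_module R (carrier R)"
      have "module R ?V \<and> module R ?W \<and> (\<lambda>p. p) \<in> mod_hom R ?V ?W \<and> inj_on (\<lambda>p. p) (carrier ?V) \<and>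
        (\<lambda>p. \<epsilon> (f p)) \<in> mod_hom R ?V (J 0)"
        using E.R.ideal_module_is_module[OF \<aa>n] E.R.ideal_module_is_module[OF E.R.oneideal]
          mod_hom_comp[OF f \<epsilon>] carr by (auto simp: mod_hom_def ideal_module_def)
      then obtain h where h: "h \<in> mod_hom R ?W (J 0)" "\<forall>p\<in>carrier ?V. h p = \<epsilon> (f p)"
        using Jinj[of 0] unfolding injective_module_def by blast
      define e where "e = h \<one>\<^bsub>R\<^esub>"
      have e: "e \<in> carrier (J 0)" using mod_homD(1)[OF h(1), of "\<one>\<^bsub>R\<^esub>"] by (simp add: e_def ideal_module_def)
      have pe: "p \<odot>\<^bsub>J 0\<^esub> e = \<epsilon> (f p)" if p: "p \<in> ideal_power R \<aa> n" for p
      proof -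
        have "h (p \<otimes>\<^bsub>R\<^esub> \<one>\<^bsub>R\<^esub>) = p \<odot>\<^bsub>J 0\<^esub> e"
          using mod_homD(3)[OF h(1), of p "\<one>\<^bsub>R\<^esub>"] carr[OF p] by (simp add: ideal_module_def e_def)
        then show ?thesis using h(2) p carr[OF p] by (simp add: ideal_module_def)
      qed
      have fc: "f p \<in> carrier E" if "p \<in> ideal_power R \<aa> n" for p
        using mod_homD(1)[OF f] that by (simp add: ideal_module_def)
      have de: "d 0 e \<in> Z"
      proof -
        have "p \<odot>\<^bsub>J 1\<^esub> d 0 e = \<zero>\<^bsub>J 1\<^esub>" if p: "p \<in> ideal_power R \<aa> n" for p
          using dD(3)[OF carr[OF p] e] pe[OF p] d\<epsilon>[OF fc[OF p]] by simp
        moreover have "d 1 (d 0 e) = \<zero>\<^bsub>J 2\<^esub>" using ex[of 0] e by (auto simp: eval_nat_numeral One_nat_def)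
        ultimately show ?thesis using dD(1)[OF e] by (auto simp: Z_def torsion_part_def)
      qed
      then obtain e' where e': "e' \<in> torsion_part R \<aa> (J 0)" "d 0 e = d 0 e'"
        using ZN by (auto simp: N_def)
      then obtain k where e'c: "e' \<in> carrier (J 0)" and k: "\<And>p. p \<in> ideal_power R \<aa> k \<Longrightarrow> p \<odot>\<^bsub>J 0\<^esub> e' = \<zero>\<^bsub>J 0\<^esub>"
        by (auto simp: torsion_part_def)
      have "d 0 (e \<ominus>\<^bsub>J 0\<^esub> e') = \<zero>\<^bsub>J 1\<^esub>"
        using mod_hom_diff[OF Jm Jm d0 e e'c] e'(2) dD(1)[OF e'c] by (simp add: a_minus_def J1.M.r_neg)
      then have "e \<ominus>\<^bsub>J 0\<^esub> e' \<in> \<epsilon> ` carrier E" using ex0 e e'c by simp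
      then obtain z where z: "z \<in> carrier E" "e \<ominus>\<^bsub>J 0\<^esub> e' = \<epsilon> z" by blast
      have "f p = p \<odot>\<^bsub>E\<^esub> z" if p: "p \<in> ideal_power R \<aa> (max n k)" for p
      proof -
        have pn: "p \<in> ideal_power R \<aa> n" and pk: "p \<in> ideal_power R \<aa> k"
          using p E.R.ideal_power_antimono[OF \<aa>, of _ "max n k"] by (metis max.cobounded1 max.cobounded2 subsetD)+
        have "\<epsilon> (p \<odot>\<^bsub>E\<^esub> z) = p \<odot>\<^bsub>J 0\<^esub> (e \<ominus>\<^bsub>J 0\<^esub> e')" using \<epsilon>D(3)[OF carr[OF p] z(1)] z(2) by simp
        also have "\<dots> = p \<odot>\<^bsub>J 0\<^esub> e"
          using carr[OF p] e e'c k[OF pk] by (simp add: a_minus_def J0.smult_r_distr J0.smult_r_minus)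
        also have "\<dots> = \<epsilon> (f p)" by (rule pe[OF pn])
        finally show ?thesis using inj_onD[OF inj] fc[OF pn] carr[OF p] z(1) by (metis E.smult_closed)
      qed
      then show "\<exists>k\<ge>n. \<exists>z\<in>carrier E. \<forall>p\<in>ideal_power R \<aa> k. f p = p \<odot>\<^bsub>E\<^esub> z"
        using z(1) by (intro exI[of _ "max n k"]) auto
    qed
  next
    assume sc: "homs_eventually_scalar R \<aa> E"
    show "Z \<subseteq> N"
    proof
      fix y assume y: "y \<in> Z"
      then have "y \<in> d 0 ` carrier (J 0)" using ex[of 0] ZJ[OF y] by (auto simp: Z_def eval_nat_numeral One_nat_def)
      then obtain e where e: "e \<in> carrier (J 0)" "y = d 0 e" by blast
      obtain n where n: "\<And>p. p \<in> ideal_power R \<aa> n \<Longrightarrow> p \<odot>\<^bsub>J 1\<^esub> y = \<zero>\<^bsub>J 1\<^esub>"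
        using y by (auto simp: Z_def torsion_part_def)
      define f where "f p = inv_into (carrier E) \<epsilon> (p \<odot>\<^bsub>J 0\<^esub> e)" for p
      have f: "f p \<in> carrier E" "\<epsilon> (f p) = p \<odot>\<^bsub>J 0\<^esub> e" if p: "p \<in> ideal_power R \<aa> n" for p
      proof -
        have "d 0 (p \<odot>\<^bsub>J 0\<^esub> e) = \<zero>\<^bsub>J 1\<^esub>" using dD(3)[OF carr[OF p] e(1)] n[OF p] e(2) by simp
        then have "p \<odot>\<^bsub>J 0\<^esub> e \<in> \<epsilon> ` carrier E" using ex0 carr[OF p] e(1) by simp
        then show "f p \<in> carrier E" "\<epsilon> (f p) = p \<odot>\<^bsub>J 0\<^esub> e"
          unfolding f_def by (rule inv_into_into, rule f_inv_into_f)
      qed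
      note \<epsilon>eq = inj_onD[OF inj]
      have "f \<in> mod_hom R (ideal_module R (ideal_power R \<aa> n)) E"
      proof (rule mod_homI)
        show "f p \<in> carrier E" if "p \<in> carrier (ideal_module R (ideal_power R \<aa> n))" for p
          using f(1) that by (simp add: ideal_module_def)
        show "f (p \<oplus>\<^bsub>ideal_module R (ideal_power R \<aa> n)\<^esub> q) = f p \<oplus>\<^bsub>E\<^esub> f q"
          if "p \<in> carrier (ideal_module R (ideal_power R \<aa> n))"
            "q \<in> carrier (ideal_module R (ideal_power R \<aa> n))" for p q
        proof -
          have p: "p \<in> ideal_power R \<aa> n" and q: "q \<in> ideal_power R \<aa> n"
            using that by (auto simp: ideal_module_def)
          have pq: "p \<oplus>\<^bsub>R\<^esub> q \<in> ideal_power R \<aa> n"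
            using additive_subgroup.a_closed[OF ideal.axioms(1)[OF \<aa>n] p q] .
          have "\<epsilon> (f (p \<oplus>\<^bsub>R\<^esub> q)) = \<epsilon> (f p \<oplus>\<^bsub>E\<^esub> f q)"
            using f[OF p] f[OF q] f[OF pq] carr[OF p] carr[OF q] e(1) \<epsilon>D(2) by (simp add: J0.smult_l_distr)
          then show ?thesis using \<epsilon>eq f[OF p] f[OF q] f[OF pq] by (simp add: ideal_module_def)
        qed
        show "f (a \<odot>\<^bsub>ideal_module R (ideal_power R \<aa> n)\<^esub> p) = a \<odot>\<^bsub>E\<^esub> f p"
          if "a \<in> carrier R" "p \<in> carrier (ideal_module R (ideal_power R \<aa> n))" for a p
        proof -
          have p: "p \<in> ideal_power R \<aa> n" using that by (auto simp: ideal_module_def)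
          have ap: "a \<otimes>\<^bsub>R\<^esub> p \<in> ideal_power R \<aa> n"
            using ideal.I_l_closed[OF \<aa>n p that(1)] .
          have "\<epsilon> (f (a \<otimes>\<^bsub>R\<^esub> p)) = \<epsilon> (a \<odot>\<^bsub>E\<^esub> f p)"
            using f[OF p] f[OF ap] carr[OF p] that(1) e(1) \<epsilon>D(3) by (simp add: J0.smult_assoc1)
          then show ?thesis using \<epsilon>eq f[OF p] f[OF ap] that(1) by (simp add: ideal_module_def)
        qed
      qed
      then obtain k z where kn: "k \<ge> n" and z: "z \<in> carrier E"
        and fz: "\<And>p. p \<in> ideal_power R \<aa> k \<Longrightarrow> f p = p \<odot>\<^bsub>E\<^esub> z"
        using sc unfolding homs_eventually_scalar_def by meson
      have \<epsilon>z: "\<epsilon> z \<in> carrier (J 0)" by (rule \<epsilon>D(1)[OF z])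
      have "p \<odot>\<^bsub>J 0\<^esub> (e \<ominus>\<^bsub>J 0\<^esub> \<epsilon> z) = \<zero>\<^bsub>J 0\<^esub>" if p: "p \<in> ideal_power R \<aa> k" for p
      proof -
        have pn: "p \<in> ideal_power R \<aa> n" using E.R.ideal_power_antimono[OF \<aa> kn] p by blast
        have "p \<odot>\<^bsub>J 0\<^esub> \<epsilon> z = p \<odot>\<^bsub>J 0\<^esub> e" using \<epsilon>D(3)[OF carr[OF p] z] fz[OF p] f(2)[OF pn] by simp
        then show ?thesis using carr[OF p] e(1) \<epsilon>z
          by (simp add: a_minus_def J0.smult_r_distr J0.smult_r_minus J0.M.r_neg)
      qed
      then have "e \<ominus>\<^bsub>J 0\<^esub> \<epsilon> z \<in> torsion_part R \<aa> (J 0)" using e(1) \<epsilon>z by (auto simp: torsion_part_def)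
      moreover have "d 0 (e \<ominus>\<^bsub>J 0\<^esub> \<epsilon> z) = y"
      proof -
        show ?thesis using d\<epsilon>[OF z] mod_hom_diff[OF Jm Jm d0 e(1) \<epsilon>z] e dD(1)[OF e(1)] by (simp add: a_minus_def)
      qed
      ultimately show "y \<in> N" unfolding N_def by blast
    qed
  qed
  finally show ?thesis .
qed

lemma first_local_cohomology_zero_iff:
  fixes R :: "('r, 'x) ring_scheme" and E :: "('r, 'e) module"
  assumes E: "module R E" and \<aa>: "ideal \<aa> R"
  shows "carrier (local_cohomology R \<aa> 1 E) = {\<zero>\<^bsub>local_cohomology R \<aa> 1 E\<^esub>} \<longleftrightarrow>
    homs_eventually_scalar R \<aa> E"
proof -
  define Jd :: "(nat \<Rightarrow> ('r, 'r list \<Rightarrow> 'e + nat) module) \<times> (nat \<Rightarrow> ('r list \<Rightarrow> 'e + nat) \<Rightarrow> ('r list \<Rightarrow> 'e + nat))"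
    where "Jd = (SOME (J, d). \<exists>\<epsilon>. injective_resolution R E \<epsilon> J d)"
  have "\<exists>p. case p of (J :: nat \<Rightarrow> ('r, 'r list \<Rightarrow> 'e + nat) module, d) \<Rightarrow> \<exists>\<epsilon>. injective_resolution R E \<epsilon> J d"
    using ex_injective_resolution[OF E] by auto
  then have "case Jd of (J, d) \<Rightarrow> \<exists>\<epsilon>. injective_resolution R E \<epsilon> J d"
    unfolding Jd_def by (rule someI_ex)
  then obtain J d \<epsilon> where Jd: "Jd = (J, d)" and res: "injective_resolution R E \<epsilon> J d"
    by (cases Jd) auto
  have "local_cohomology R \<aa> 1 E = torsion_cohomology R \<aa> J d 1"
    unfolding local_cohomology_def Jd_def[symmetric] Jd by simp
  then show ?thesis using first_torsion_cohomology_zero_iff[OF res \<aa>] by simp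
qed

section \<open>Powers of ideals\<close>

text \<open>Keeps $I^{n+1}$ from being rewritten to $I \cdot I^n$, so that facts about $I^n$ for variable
  \<open>n\<close> apply.\<close>

declare ideal_power.simps(2) [simp del]

lemma (in cring) ideal_power_add:
  assumes I: "ideal I R"
  shows "ideal_power R I (i + j) = ideal_prod R (ideal_power R I i) (ideal_power R I j)"
proof (induction i)
  case 0
  show ?case
    using ideal_prod_one[OF ideal_power_ideal[OF I, of j]]
      ideal_prod_commute[OF oneideal ideal_power_ideal[OF I, of j]] by simp
next
  case (Suc i)
  then show ?case
    using ideal_prod_assoc[OF I ideal_power_ideal[OF I, of i] ideal_power_ideal[OF I, of j]]
    by (simp add: ideal_power.simps(2))
qed

lemma (in cring) ideal_power_mult:
  assumes I: "ideal I R" and "a \<in> ideal_power R I i" "b \<in> ideal_power R I j"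
  shows "a \<otimes> b \<in> ideal_power R I (i + j)"
  unfolding ideal_power_add[OF I] using assms by (intro ideal_prod.prod)

text \<open>Additive properties of elements of $I^{i+j}$ need to be checked only for products of an
  element of $I^i$ and an element of $I^j$.\<close>

lemma (in cring) ideal_power_split:
  assumes I: "ideal I R" and a: "a \<in> ideal_power R I (i + j)"
    and prod: "\<And>b c. b \<in> ideal_power R I i \<Longrightarrow> c \<in> ideal_power R I j \<Longrightarrow> P (b \<otimes> c)"
    and sum: "\<And>b c. b \<in> ideal_power R I (i + j) \<Longrightarrow> c \<in> ideal_power R I (i + j) \<Longrightarrow> P b \<Longrightarrow> P c \<Longrightarrow> P (b \<oplus> c)"
  shows "P a"
  using a unfolding ideal_power_add[OF I]
proof (induction rule: ideal_prod.induct)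
  case (sum b c)
  then show ?case using assms(4) by (simp add: ideal_power_add[OF I])
qed (rule prod)

lemma (in cring) ideal_power_one: "ideal I R \<Longrightarrow> ideal_power R I (Suc 0) = I"
  by (simp add: ideal_power.simps(2) ideal_prod_one)

lemma (in module) mod_span_submodule:
  assumes "S \<subseteq> carrier M" shows "submodule (mod_span R M S) R M"
proof -
  have c: "carrier M \<in> {N. submodule N R M \<and> S \<subseteq> N}" using assms carrier_is_submodule by simp
  show ?thesis
    unfolding mod_span_def
  proof (rule submoduleI)
    show "\<Inter> {N. submodule N R M \<and> S \<subseteq> N} \<subseteq> carrier M" using c by blast
  qed (auto intro: submodule_zero dest: submoduleE)
qed

lemma (in module) ideal_mult_submodule:
  assumes "J \<subseteq> carrier R" shows "submodule (ideal_mult_module R J M) R M"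
  unfolding ideal_mult_module_def by (rule mod_span_submodule) (use assms in auto)

lemma ideal_mult_module_prod:
  assumes "a \<in> J" "m \<in> carrier M" shows "a \<odot>\<^bsub>M\<^esub> m \<in> ideal_mult_module R J M"
  using assms by (auto simp: ideal_mult_module_def mod_span_def)

lemma ideal_mult_module_least:
  assumes "submodule N R M" "\<And>a m. a \<in> J \<Longrightarrow> m \<in> carrier M \<Longrightarrow> a \<odot>\<^bsub>M\<^esub> m \<in> N"
  shows "ideal_mult_module R J M \<subseteq> N"
  using assms by (auto simp: ideal_mult_module_def mod_span_def)

text \<open>Both inclusions hold because $J M$ is the least submodule containing the products: images and
  preimages of submodules under \<open>h\<close> are submodules.\<close>

lemma ideal_mult_module_image:
  assumes "module R M" "module R N" and h: "h \<in> mod_hom R M N" "h ` carrier M = carrier N"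
    and J: "J \<subseteq> carrier R"
  shows "ideal_mult_module R J N = h ` ideal_mult_module R J M"
proof
  interpret M: module R M by fact
  interpret N: module R N by fact
  note SM = M.ideal_mult_submodule[OF J] and SN = N.ideal_mult_submodule[OF J]
  note hD = mod_homD[OF h(1)]
  show "ideal_mult_module R J N \<subseteq> h ` ideal_mult_module R J M"
  proof (rule ideal_mult_module_least)
    show "submodule (h ` ideal_mult_module R J M) R N"
      by (rule M.image_submodule[OF assms(2) h(1) SM])
    fix a n assume a: "a \<in> J" and "n \<in> carrier N"
    then obtain m where m: "m \<in> carrier M" "n = h m" using h(2) by blast
    then have "a \<odot>\<^bsub>N\<^esub> n = h (a \<odot>\<^bsub>M\<^esub> m)" using hD(3) a J by auto
    then show "a \<odot>\<^bsub>N\<^esub> n \<in> h ` ideal_mult_module R J M"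
      using ideal_mult_module_prod[OF a m(1)] by blast
  qed
  have "ideal_mult_module R J M \<subseteq> {m \<in> carrier M. h m \<in> ideal_mult_module R J N}"
  proof (rule ideal_mult_module_least)
    show "submodule {m \<in> carrier M. h m \<in> ideal_mult_module R J N} R M"
      by (rule M.preimage_submodule[OF assms(2) h(1) SN])
    fix a m assume "a \<in> J" "m \<in> carrier M"
    then show "a \<odot>\<^bsub>M\<^esub> m \<in> {m \<in> carrier M. h m \<in> ideal_mult_module R J N}"
      using ideal_mult_module_prod[of a J "h m" N R] hD J by auto
  qed
  then show "h ` ideal_mult_module R J M \<subseteq> ideal_mult_module R J N" by blast
qed

section \<open>Modules of finite length over a local ring\<close>

lemma (in noetherian_ring) ex_maximal_ideal_containing:
  assumes "cring R" and a: "a \<in> carrier R" "a \<notin> Units R"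
  shows "\<exists>J. maximalideal J R \<and> a \<in> J"
proof -
  interpret cring R by fact
  let ?S = "{J. ideal J R \<and> a \<in> J \<and> \<one> \<notin> J}"
  have "PIdl a \<in> ?S"
  proof -
    have "\<one> \<notin> PIdl a"
    proof
      assume "\<one> \<in> PIdl a"
      then obtain b where b: "b \<in> carrier R" "b \<otimes> a = \<one>" by (auto simp: cgenideal_def)
      then have "a \<otimes> b = \<one>" using m_comm[OF a(1) b(1)] by simp
      then have "a \<in> Units R" unfolding Units_def using a(1) b by blast
      then show False using a(2) by blast
    qed
    then show ?thesis using cgenideal_ideal[OF a(1)] cgenideal_self[OF a(1)] by simp
  qed
  then have "?S \<noteq> {}" by blast
  moreover have "\<Union>C \<in> ?S" if C: "C \<noteq> {}" "subset.chain ?S C" for C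
  proof -
    have "subset.chain {J. ideal J R} C"
      using C(2) unfolding subset.chain_def by auto
    then have "\<Union>C \<in> C" by (rule ideal_chain_is_trivial[OF C(1)])
    then show ?thesis using C(2) unfolding subset.chain_def by auto
  qed
  ultimately have "\<exists>J\<in>?S. \<forall>H\<in>?S. J \<subseteq> H \<longrightarrow> H = J" by (rule subset_Zorn_nonempty)
  then obtain J where J: "J \<in> ?S" and max: "\<And>H. H \<in> ?S \<Longrightarrow> J \<subseteq> H \<Longrightarrow> H = J"
    by blast
  have "maximalideal J R"
  proof (rule maximalidealI)
    show "ideal J R" using J by blast
    show "carrier R \<noteq> J" using J by blast
    fix H assume H: "ideal H R" "J \<subseteq> H" "H \<subseteq> carrier R"
    show "H = J \<or> H = carrier R"
    proof (cases "\<one> \<in> H")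
      case True
      then show ?thesis using ideal.one_imp_carrier[OF H(1)] by blast
    next
      case False
      then show ?thesis using max[of H] H J by blast
    qed
  qed
  then show ?thesis using J by blast
qed

lemma local_ring_one_minus_unit:
  assumes A: "noetherian_ring A" "local_ring A \<mm>" and a: "a \<in> \<mm>"
  shows "\<one>\<^bsub>A\<^esub> \<ominus>\<^bsub>A\<^esub> a \<in> Units A"
proof (rule ccontr)
  interpret A: cring A using A(2) by (simp add: local_ring_def)
  interpret m: maximalideal \<mm> A using A(2) by (simp add: local_ring_def)
  have ac: "a \<in> carrier A" using m.Icarr[OF a] .
  assume "\<one>\<^bsub>A\<^esub> \<ominus>\<^bsub>A\<^esub> a \<notin> Units A"
  then obtain J where "maximalideal J A" "\<one>\<^bsub>A\<^esub> \<ominus>\<^bsub>A\<^esub> a \<in> J"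
    using noetherian_ring.ex_maximal_ideal_containing[OF A(1) A.is_cring, of "\<one>\<^bsub>A\<^esub> \<ominus>\<^bsub>A\<^esub> a"] ac by auto
  then have "\<one>\<^bsub>A\<^esub> \<ominus>\<^bsub>A\<^esub> a \<in> \<mm>" using A(2) by (simp add: local_ring_def)
  then have "(\<one>\<^bsub>A\<^esub> \<ominus>\<^bsub>A\<^esub> a) \<oplus>\<^bsub>A\<^esub> a \<in> \<mm>" using a by (rule m.a_closed)
  moreover have "(\<one>\<^bsub>A\<^esub> \<ominus>\<^bsub>A\<^esub> a) \<oplus>\<^bsub>A\<^esub> a = \<one>\<^bsub>A\<^esub>"
    using ac by (simp add: a_minus_def A.a_assoc A.l_neg)
  ultimately have "carrier A = \<mm>" using m.one_imp_carrier by simp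
  then show False using m.I_notcarr by blast
qed

text \<open>Nakayama's argument. If \<open>a \<odot> y\<close> were not in \<open>C\<close>, then by simplicity \<open>D\<close> would be generated
  by \<open>C\<close> and \<open>a \<odot> y\<close>, so $(1 - ra)y \in C$ for some \<open>r\<close>; as $1 - ra$ is a unit, \<open>y\<close> and hence
  \<open>a \<odot> y\<close> would lie in \<open>C\<close>.\<close>

lemma simple_factor_annihilated:
  assumes A: "noetherian_ring A" "local_ring A \<mm>" and N: "module A N"
    and C: "submodule C A N" and D: "submodule D A N" and CD: "C \<subseteq> D"
    and simple: "\<not> (\<exists>B. submodule B A N \<and> C \<subset> B \<and> B \<subset> D)"
    and a: "a \<in> \<mm>" and y: "y \<in> D"
  shows "a \<odot>\<^bsub>N\<^esub> y \<in> C"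
proof (rule ccontr)
  interpret N: module A N by fact
  interpret m: maximalideal \<mm> A using A(2) by (simp add: local_ring_def)
  note CE = N.submoduleE[OF C] and DE = N.submoduleE[OF D]
  assume not: "a \<odot>\<^bsub>N\<^esub> y \<notin> C"
  have ac: "a \<in> carrier A" using m.Icarr[OF a] .
  have yc: "y \<in> carrier N" using y DE(1) by blast
  define B where "B = {c \<oplus>\<^bsub>N\<^esub> r \<odot>\<^bsub>N\<^esub> (a \<odot>\<^bsub>N\<^esub> y) | c r. c \<in> C \<and> r \<in> carrier A}"
  have BI: "c \<oplus>\<^bsub>N\<^esub> r \<odot>\<^bsub>N\<^esub> (a \<odot>\<^bsub>N\<^esub> y) \<in> B" if "c \<in> C" "r \<in> carrier A" for c r
    using that by (auto simp: B_def)
  have Cc: "c \<in> carrier N" if "c \<in> C" for c using that CE(1) by blast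
  have B: "submodule B A N"
  proof (rule N.submodule_if_smult_closed)
    show "B \<subseteq> carrier N" using Cc ac yc by (auto simp: B_def)
    show "\<zero>\<^bsub>N\<^esub> \<in> B" using BI[OF N.submodule_zero[OF C], of "\<zero>\<^bsub>A\<^esub>"] ac yc by simp
    fix b b' assume "b \<in> B" "b' \<in> B"
    then obtain c r c' r' where b: "c \<in> C" "r \<in> carrier A" "b = c \<oplus>\<^bsub>N\<^esub> r \<odot>\<^bsub>N\<^esub> (a \<odot>\<^bsub>N\<^esub> y)"
      "c' \<in> C" "r' \<in> carrier A" "b' = c' \<oplus>\<^bsub>N\<^esub> r' \<odot>\<^bsub>N\<^esub> (a \<odot>\<^bsub>N\<^esub> y)" by (auto simp: B_def)
    have "b \<oplus>\<^bsub>N\<^esub> b' = (c \<oplus>\<^bsub>N\<^esub> c') \<oplus>\<^bsub>N\<^esub> (r \<oplus>\<^bsub>A\<^esub> r') \<odot>\<^bsub>N\<^esub> (a \<odot>\<^bsub>N\<^esub> y)"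
      using b Cc ac yc by (simp add: N.smult_l_distr N.M.a_ac)
    then show "b \<oplus>\<^bsub>N\<^esub> b' \<in> B" using BI[OF CE(5)[OF b(1,4)]] b by simp
  next
    fix s b assume s: "s \<in> carrier A" and "b \<in> B"
    then obtain c r where b: "c \<in> C" "r \<in> carrier A" "b = c \<oplus>\<^bsub>N\<^esub> r \<odot>\<^bsub>N\<^esub> (a \<odot>\<^bsub>N\<^esub> y)" by (auto simp: B_def)
    have "s \<odot>\<^bsub>N\<^esub> b = s \<odot>\<^bsub>N\<^esub> c \<oplus>\<^bsub>N\<^esub> (s \<otimes>\<^bsub>A\<^esub> r) \<odot>\<^bsub>N\<^esub> (a \<odot>\<^bsub>N\<^esub> y)"
      using b Cc ac yc s by (simp add: N.smult_r_distr N.smult_assoc1)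
    then show "s \<odot>\<^bsub>N\<^esub> b \<in> B" using BI[OF CE(4)[OF s b(1)]] b s by simp
  qed
  have ay: "a \<odot>\<^bsub>N\<^esub> y \<in> B" using BI[OF N.submodule_zero[OF C], of "\<one>\<^bsub>A\<^esub>"] ac yc by simp
  have "C \<subseteq> B"
  proof
    fix c assume c: "c \<in> C"
    show "c \<in> B" using BI[OF c, of "\<zero>\<^bsub>A\<^esub>"] Cc[OF c] ac yc by simp
  qed
  then have "C \<subset> B" using ay not by blast
  moreover have "B \<subseteq> D"
    using CD DE(4)[OF ac y] DE(4,5) unfolding B_def by blast
  ultimately have "B = D" using simple B by blast
  then obtain c r where cr: "c \<in> C" "r \<in> carrier A" "y = c \<oplus>\<^bsub>N\<^esub> r \<odot>\<^bsub>N\<^esub> (a \<odot>\<^bsub>N\<^esub> y)"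
    using y by (auto simp: B_def)
  have ra: "r \<otimes>\<^bsub>A\<^esub> a \<in> \<mm>" using m.I_l_closed[OF a cr(2)] .
  note rac = m.Icarr[OF ra]
  obtain u where u: "u \<in> carrier A" "u \<otimes>\<^bsub>A\<^esub> (\<one>\<^bsub>A\<^esub> \<ominus>\<^bsub>A\<^esub> r \<otimes>\<^bsub>A\<^esub> a) = \<one>\<^bsub>A\<^esub>"
    using local_ring_one_minus_unit[OF A ra] by (auto simp: Units_def)
  have "y \<ominus>\<^bsub>N\<^esub> r \<odot>\<^bsub>N\<^esub> (a \<odot>\<^bsub>N\<^esub> y) = c"
    using N.diff_eq_iff[of y "r \<odot>\<^bsub>N\<^esub> (a \<odot>\<^bsub>N\<^esub> y)" c] cr Cc ac yc by simp
  moreover have "(\<one>\<^bsub>A\<^esub> \<ominus>\<^bsub>A\<^esub> r \<otimes>\<^bsub>A\<^esub> a) \<odot>\<^bsub>N\<^esub> y = y \<ominus>\<^bsub>N\<^esub> r \<odot>\<^bsub>N\<^esub> (a \<odot>\<^bsub>N\<^esub> y)"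
    using rac cr(2) ac yc by (simp add: a_minus_def N.smult_l_distr N.smult_l_minus N.smult_assoc1)
  ultimately have "(\<one>\<^bsub>A\<^esub> \<ominus>\<^bsub>A\<^esub> r \<otimes>\<^bsub>A\<^esub> a) \<odot>\<^bsub>N\<^esub> y \<in> C" using cr(1) by simp
  then have "u \<odot>\<^bsub>N\<^esub> ((\<one>\<^bsub>A\<^esub> \<ominus>\<^bsub>A\<^esub> r \<otimes>\<^bsub>A\<^esub> a) \<odot>\<^bsub>N\<^esub> y) \<in> C" by (rule CE(4)[OF u(1)])
  then have "y \<in> C" using u rac yc by (simp flip: N.smult_assoc1)
  then show False using not CE(4)[OF ac] by blast
qed

text \<open>Elements of \<open>\<mm>\<close> map every member of a composition series into the preceding one.\<close>

lemma finite_length_annihilated: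
  assumes A: "noetherian_ring A" "local_ring A \<mm>" and N: "finite_length A N"
  shows "\<exists>t. \<forall>a\<in>ideal_power A \<mm> t. \<forall>y\<in>carrier N. a \<odot>\<^bsub>N\<^esub> y = \<zero>\<^bsub>N\<^esub>"
proof -
  interpret N: module A N using N by (simp add: finite_length_def)
  have mi: "ideal \<mm> A" using A(2) by (simp add: local_ring_def maximalideal_def)
  note carr = ideal.Icarr[OF N.R.ideal_power_ideal[OF mi]]
  have "\<exists>n C. C 0 = {\<zero>\<^bsub>N\<^esub>} \<and> C n = carrier N \<and> (\<forall>i\<le>n. submodule (C i) A N) \<and>
    (\<forall>i<n. C i \<subset> C (Suc i) \<and> \<not> (\<exists>B. submodule B A N \<and> C i \<subset> B \<and> B \<subset> C (Suc i)))"
    using N unfolding finite_length_def by (rule conjunct2)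
  then obtain n C where "C 0 = {\<zero>\<^bsub>N\<^esub>} \<and> C n = carrier N \<and> (\<forall>i\<le>n. submodule (C i) A N) \<and>
    (\<forall>i<n. C i \<subset> C (Suc i) \<and> \<not> (\<exists>B. submodule B A N \<and> C i \<subset> B \<and> B \<subset> C (Suc i)))"
    by (elim exE)
  then have C: "C 0 = {\<zero>\<^bsub>N\<^esub>}" "C n = carrier N" "\<And>i. i \<le> n \<Longrightarrow> submodule (C i) A N"
    "\<And>i. i < n \<Longrightarrow> C i \<subset> C (Suc i)"
    "\<And>i. i < n \<Longrightarrow> \<not> (\<exists>B. submodule B A N \<and> C i \<subset> B \<and> B \<subset> C (Suc i))"
    by simp_all
  have "a \<odot>\<^bsub>N\<^esub> y = \<zero>\<^bsub>N\<^esub>" if "i \<le> n" "a \<in> ideal_power A \<mm> i" "y \<in> C i" for i a y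
    using that
  proof (induction i arbitrary: a y)
    case 0
    then show ?case using C(1) by simp
  next
    case (Suc i)
    have sub: "C (Suc i) \<subseteq> carrier N" using N.submoduleE(1)[OF C(3)[OF Suc.prems(1)]] .
    then have yc: "y \<in> carrier N" using Suc.prems(3) by blast
    show ?case using Suc.prems(2) unfolding ideal_power.simps(2)
    proof (induction a rule: ideal_prod.induct)
      case (prod a b)
      have "a \<odot>\<^bsub>N\<^esub> y \<in> C i"
        by (rule simple_factor_annihilated[OF A N.module_axioms C(3) C(3)[OF Suc.prems(1)] _ C(5) prod(1) Suc.prems(3)])
          (use Suc.prems(1) C(4)[of i] in auto)
      then have "b \<odot>\<^bsub>N\<^esub> (a \<odot>\<^bsub>N\<^esub> y) = \<zero>\<^bsub>N\<^esub>" using Suc.IH[OF _ prod(2)] Suc.prems(1) by simp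
      then show ?case
        using N.smult_commute[OF carr[OF prod(2)] ideal.Icarr[OF mi prod(1)] yc]
          N.smult_assoc1[OF ideal.Icarr[OF mi prod(1)] carr[OF prod(2)] yc] by simp
    next
      case (sum a b)
      have "a \<in> carrier A" "b \<in> carrier A"
        using sum(1,2) carr[of _ "Suc i"] by (simp_all add: ideal_power.simps(2))
      then show ?case using sum(3,4) yc by (simp add: N.smult_l_distr)
    qed
  qed
  from this[of n] show ?thesis using C(2) by blast
qed

section \<open>The adic filtration of a module\<close>

locale adic_module = module A M for A :: "('a, 'x) ring_scheme" and M :: "('a, 'm) module" (structure) +
  fixes I :: "'a set"
  assumes I_ideal: "ideal I A"
begin

abbreviation IM :: "nat \<Rightarrow> 'm set" where "IM n \<equiv> ideal_mult_module A (ideal_power A I n) M"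

lemma power_carr: "a \<in> ideal_power A I n \<Longrightarrow> a \<in> carrier A"
  using ideal.Icarr[OF R.ideal_power_ideal[OF I_ideal]] .

lemma power_zero: "\<zero>\<^bsub>A\<^esub> \<in> ideal_power A I n"
  using R.ideal_power_ideal[OF I_ideal] by (simp add: additive_subgroup.zero_closed ideal.axioms(1))

lemma IM_submodule: "submodule (IM n) A M"
  using ideal_mult_submodule power_carr by blast

lemma IM_carr: "m \<in> IM n \<Longrightarrow> m \<in> carrier M"
  using submoduleE(1)[OF IM_submodule] by blast

lemma IM_zero: "\<zero> \<in> IM n"
  by (rule submodule_zero[OF IM_submodule])

lemmas IM_add = submoduleE(5)[OF IM_submodule]
lemmas IM_smult = submoduleE(4)[OF IM_submodule]
lemmas IM_diff = submodule_diff[OF IM_submodule]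

lemma IM_0: "IM 0 = carrier M"
proof
  show "carrier M \<subseteq> IM 0"
    using ideal_mult_module_prod[of "\<one>\<^bsub>A\<^esub>" "carrier A" _ M A] by auto
qed (use IM_carr in blast)

lemma IM_antimono: "i \<le> j \<Longrightarrow> IM j \<subseteq> IM i"
  using ideal_mult_module_least[OF IM_submodule] ideal_mult_module_prod
    R.ideal_power_antimono[OF I_ideal] by (meson subsetD)

lemma IM_mono_mem: "m \<in> IM j \<Longrightarrow> i \<le> j \<Longrightarrow> m \<in> IM i"
  using IM_antimono by blast

lemma IM_power_smult:
  assumes a: "a \<in> ideal_power A I i" and m: "m \<in> IM j"
  shows "a \<odot> m \<in> IM (i + j)"
proof -
  have "IM j \<subseteq> {m \<in> carrier M. a \<odot> m \<in> IM (i + j)}"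
  proof (rule ideal_mult_module_least)
    show "submodule {m \<in> carrier M. a \<odot> m \<in> IM (i + j)} A M"
      by (rule preimage_submodule[OF module_axioms smult_hom IM_submodule]) (rule power_carr[OF a])
    fix b n assume b: "b \<in> ideal_power A I j" and n: "n \<in> carrier M"
    have "a \<odot> (b \<odot> n) = (a \<otimes>\<^bsub>A\<^esub> b) \<odot> n"
      using a b n power_carr by (simp add: smult_assoc1)
    then show "b \<odot> n \<in> {m \<in> carrier M. a \<odot> m \<in> IM (i + j)}"
      using ideal_mult_module_prod[OF R.ideal_power_mult[OF I_ideal a b] n] n power_carr[OF b] by simp
  qed
  then show ?thesis using m by blast
qed

lemma power_smult_split:
  assumes J: "ideal J A" and a: "a \<in> ideal_power A J (i + j)" and m: "m \<in> carrier M" and N: "submodule N A M"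
    and prod: "\<And>b c. b \<in> ideal_power A J i \<Longrightarrow> c \<in> ideal_power A J j \<Longrightarrow> b \<odot> (c \<odot> m) \<in> N"
  shows "a \<odot> m \<in> N"
proof (rule R.ideal_power_split[OF J a])
  note carr = ideal.Icarr[OF R.ideal_power_ideal[OF J]]
  show "(b \<otimes>\<^bsub>A\<^esub> c) \<odot> m \<in> N" if "b \<in> ideal_power A J i" "c \<in> ideal_power A J j" for b c
    using prod[OF that] that carr m by (simp add: smult_assoc1)
  show "(b \<oplus>\<^bsub>A\<^esub> c) \<odot> m \<in> N" if "b \<in> ideal_power A J (i + j)" "c \<in> ideal_power A J (i + j)"
    "b \<odot> m \<in> N" "c \<odot> m \<in> N" for b c
    using that carr m submoduleE(5)[OF N] by (simp add: smult_l_distr)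
qed

section \<open>The Rees algebra\<close>

abbreviation "Rees \<equiv> rees_algebra A I"

lemma rees_carrier: "p \<in> carrier Rees \<longleftrightarrow> p \<in> up A \<and> (\<forall>n. p n \<in> ideal_power A I n)"
  by (simp add: rees_algebra_def)

lemma rees_coeff: "p \<in> carrier Rees \<Longrightarrow> p n \<in> ideal_power A I n"
  by (simp add: rees_carrier)

lemma rees_coeff_carr: "p \<in> carrier Rees \<Longrightarrow> p n \<in> carrier A"
  using power_carr rees_coeff by blast

lemma rees_zero: "\<zero>\<^bsub>Rees\<^esub> n = \<zero>\<^bsub>A\<^esub>" and rees_one: "\<one>\<^bsub>Rees\<^esub> n = (if n = 0 then \<one>\<^bsub>A\<^esub> else \<zero>\<^bsub>A\<^esub>)"
  by (simp_all add: rees_algebra_def UP_def)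

lemma rees_add: "p \<in> carrier Rees \<Longrightarrow> q \<in> carrier Rees \<Longrightarrow> (p \<oplus>\<^bsub>Rees\<^esub> q) n = p n \<oplus>\<^bsub>A\<^esub> q n"
  by (simp add: rees_algebra_def UP_def)

lemma rees_mult: "p \<in> carrier Rees \<Longrightarrow> q \<in> carrier Rees \<Longrightarrow>
    (p \<otimes>\<^bsub>Rees\<^esub> q) n = (\<Oplus>\<^bsub>A\<^esub>i\<in>{..n}. p i \<otimes>\<^bsub>A\<^esub> q (n - i))"
  by (simp add: rees_algebra_def UP_def)

lemma rees_cring: "cring Rees"
proof -
  interpret U: UP_cring A "UP A"
    by (intro UP_cring.intro R.is_cring) simp
  note powerI = R.ideal_power_ideal[OF I_ideal]
  let ?H = "{p \<in> up A. \<forall>n. p n \<in> ideal_power A I n}"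
  have carr: "carrier (UP A) = up A" by (simp add: UP_def)
  have "subring ?H (UP A)"
  proof (rule ring.subringI[OF U.UP_ring])
    show "?H \<subseteq> carrier (UP A)" by (auto simp: carr)
    show "\<one>\<^bsub>UP A\<^esub> \<in> ?H"
      using U.UP_one_closed power_zero by (auto simp: carr UP_def)
    show "\<ominus>\<^bsub>UP A\<^esub> p \<in> ?H" if "p \<in> ?H" for p
    proof -
      have p: "p \<in> up A" "\<And>n. p n \<in> ideal_power A I n" using that by auto
      have "\<ominus>\<^bsub>UP A\<^esub> p = (\<lambda>n. \<ominus>\<^bsub>A\<^esub> (p n))"
      proof (rule abelian_group.minus_equality[OF ring.is_abelian_group[OF U.UP_ring]])
        show "(\<lambda>n. \<ominus>\<^bsub>A\<^esub> p n) \<oplus>\<^bsub>UP A\<^esub> p = \<zero>\<^bsub>UP A\<^esub>"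
          using p(1) R.up_a_inv_closed[OF p(1)] by (auto simp: UP_def R.l_neg mem_upD)
      qed (use p(1) R.up_a_inv_closed[OF p(1)] in \<open>auto simp: carr\<close>)
      moreover have "\<ominus>\<^bsub>A\<^esub> p n \<in> ideal_power A I n" for n
        using additive_subgroup.a_inv_closed[OF ideal.axioms(1)[OF powerI] p(2)] .
      ultimately show ?thesis using R.up_a_inv_closed[OF p(1)] by auto
    qed
    show "p \<otimes>\<^bsub>UP A\<^esub> q \<in> ?H" if pq: "p \<in> ?H" "q \<in> ?H" for p q
    proof -
      have "(\<Oplus>\<^bsub>A\<^esub>i\<in>{..n}. p i \<otimes>\<^bsub>A\<^esub> q (n - i)) \<in> ideal_power A I n" for n
      proof (rule R.finsum_in_subgroup[OF ideal.axioms(1)[OF powerI]])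
        fix i assume "i \<in> {..n}"
        then show "p i \<otimes>\<^bsub>A\<^esub> q (n - i) \<in> ideal_power A I n"
          using R.ideal_power_mult[OF I_ideal, of "p i" i "q (n - i)" "n - i"] pq by simp
      qed simp
      then show ?thesis using pq R.up_mult_closed[of p q] by (simp add: UP_def)
    qed
    show "p \<oplus>\<^bsub>UP A\<^esub> q \<in> ?H" if pq: "p \<in> ?H" "q \<in> ?H" for p q
      using pq R.up_add_closed[of p q] additive_subgroup.a_closed[OF ideal.axioms(1)[OF powerI]]
      by (simp add: UP_def)
  qed
  then have "subcring ?H (UP A)" by (rule cring.subcringI'[OF U.UP_cring])
  then show ?thesis
    using ring.subcring_iff[OF U.UP_ring, of ?H] unfolding rees_algebra_def by (auto simp: carr)
qed

definition rees_monom :: "'a \<Rightarrow> nat \<Rightarrow> nat \<Rightarrow> 'a"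
  where "rees_monom a k = (\<lambda>i. if i = k then a else \<zero>\<^bsub>A\<^esub>)"

lemma rees_monom_closed: "a \<in> ideal_power A I k \<Longrightarrow> rees_monom a k \<in> carrier Rees"
  using power_zero power_carr[of a] power_carr[of _ 0] unfolding rees_carrier rees_monom_def
  by (auto intro!: mem_upI exI[of _ k])

lemma rees_monom_coeff_sum:
  assumes g: "\<And>i. g i \<in> carrier M" and a: "a \<in> carrier A"
  shows "(\<Oplus>i\<in>{..n}. rees_monom a k i \<odot> g i) = (if k \<le> n then a \<odot> g k else \<zero>)"
proof -
  have "(\<Oplus>i\<in>{..n}. rees_monom a k i \<odot> g i) = (\<Oplus>i\<in>{..n}. if k = i then a \<odot> g i else \<zero>)"
    using g a by (intro M.finsum_cong') (auto simp: rees_monom_def)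
  also have "\<dots> = (if k \<le> n then a \<odot> g k else \<zero>)"
  proof (cases "k \<le> n")
    case True
    then show ?thesis
      using M.finsum_singleton[of k "{..n}" "\<lambda>i. a \<odot> g i"] g a by simp
  next
    case False
    then have "(\<Oplus>i\<in>{..n}. if k = i then a \<odot> g i else \<zero>) = (\<Oplus>i\<in>{..n}. \<zero>)"
      by (intro M.finsum_cong') auto
    then show ?thesis using False by simp
  qed
  finally show ?thesis .
qed

section \<open>The module \<open>L\<close> as a quotient of a module of sequences\<close>

text \<open>The module $M[t]$ over the Rees algebra. Working with it, and with the class map \<open>L_class\<close> onto
  \<open>L\<close>, reduces identities in \<open>L\<close> to identities in \<open>M\<close> modulo the submodules $I^{n+1}M$.\<close>

definition seq_module :: "(nat \<Rightarrow> 'a, nat \<Rightarrow> 'm) module"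
  where "seq_module =
    \<lparr>carrier = {m. (\<forall>n. m n \<in> carrier M) \<and> finite {n. m n \<noteq> \<zero>}},
     monoid.mult = undefined, one = undefined, zero = (\<lambda>n. \<zero>),
     add = (\<lambda>m m' n. m n \<oplus> m' n),
     smult = (\<lambda>p m n. \<Oplus>i\<in>{..n}. p i \<odot> m (n - i))\<rparr>"

lemma seq_carr: "m \<in> carrier seq_module \<Longrightarrow> m n \<in> carrier M"
  and seq_fin: "m \<in> carrier seq_module \<Longrightarrow> finite {n. m n \<noteq> \<zero>}"
  and seq_add: "(m \<oplus>\<^bsub>seq_module\<^esub> m') n = m n \<oplus> m' n"
  and seq_smult: "(p \<odot>\<^bsub>seq_module\<^esub> m) n = (\<Oplus>i\<in>{..n}. p i \<odot> m (n - i))"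
  by (simp_all add: seq_module_def)

lemma seqI: "(\<And>n. m n \<in> carrier M) \<Longrightarrow> (\<And>n. n > b \<Longrightarrow> m n = \<zero>) \<Longrightarrow> m \<in> carrier seq_module"
  by (auto simp: seq_module_def intro!: finite_subset[of "{n. m n \<noteq> \<zero>}" "{..b}"] leI)

lemma seq_bound:
  assumes "m \<in> carrier seq_module" obtains b where "\<And>n. n > b \<Longrightarrow> m n = \<zero>"
proof -
  obtain b where b: "\<forall>n\<in>{n. m n \<noteq> \<zero>}. n \<le> b"
    using seq_fin[OF assms] unfolding finite_nat_set_iff_bounded_le by (rule exE)
  show thesis
  proof (rule that)
    show "m n = \<zero>" if "n > b" for n using b that by force
  qed
qed

lemma rees_bound:
  assumes "p \<in> carrier Rees" obtains b where "\<And>n. n > b \<Longrightarrow> p n = \<zero>\<^bsub>A\<^esub>"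
  using assms R.bound_upD[of p] by (auto simp: rees_carrier bound_def)

lemma seq_smult_closed:
  assumes p: "p \<in> carrier Rees" and m: "m \<in> carrier seq_module"
  shows "p \<odot>\<^bsub>seq_module\<^esub> m \<in> carrier seq_module"
proof -
  obtain b where b: "\<And>n. n > b \<Longrightarrow> p n = \<zero>\<^bsub>A\<^esub>" using rees_bound[OF p] by blast
  obtain c where c: "\<And>n. n > c \<Longrightarrow> m n = \<zero>" using seq_bound[OF m] by blast
  note [simp] = rees_coeff_carr[OF p] seq_carr[OF m]
  show ?thesis
  proof (rule seqI[of _ "b + c"])
    show "(p \<odot>\<^bsub>seq_module\<^esub> m) n \<in> carrier M" for n
      unfolding seq_smult by (rule M.finsum_closed) auto
    fix n assume n: "n > b + c"
    have "p i \<odot> m (n - i) = \<zero>" for i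
    proof (cases "i > b")
      case False
      then have "n - i > c" using n by simp
      then show ?thesis using c by simp
    qed (simp add: b)
    then show "(p \<odot>\<^bsub>seq_module\<^esub> m) n = \<zero>" by (simp add: seq_smult)
  qed
qed

text \<open>The associativity of the action of $A[t]$ on $M[t]$, in the form in which it can be proved by
  induction on the number of summands.\<close>

lemma convolution_assoc:
  fixes k n :: nat
  assumes a: "a \<in> UNIV \<rightarrow> carrier A" and b: "b \<in> UNIV \<rightarrow> carrier A" and c: "c \<in> UNIV \<rightarrow> carrier M"
  shows "k \<le> n \<Longrightarrow> (\<Oplus>j\<in>{..k}. (\<Oplus>\<^bsub>A\<^esub>i\<in>{..j}. a i \<otimes>\<^bsub>A\<^esub> b (j - i)) \<odot> c (n - j)) =
    (\<Oplus>j\<in>{..k}. a j \<odot> (\<Oplus>i\<in>{..k - j}. b i \<odot> c (n - j - i)))"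
proof (induction k)
  case 0
  then show ?case using a b c by (simp add: Pi_def smult_assoc1)
next
  case (Suc k)
  have "\<And>j. a j \<in> carrier A" "\<And>j. b j \<in> carrier A" "\<And>j. c j \<in> carrier M" using a b c by auto
  note [simp] = this
  have fld: "finsum A g S \<odot> x = (\<Oplus>i\<in>S. g i \<odot> x)"
    if "finite S" "g \<in> S \<rightarrow> carrier A" "x \<in> carrier M" for g S x
    using that by (induction S) (auto simp: smult_l_distr Pi_def R.finsum_insert M.finsum_insert)
  let ?T = "\<lambda>j. b (Suc k - j) \<odot> c (n - Suc k)"
  have "(\<Oplus>j\<in>{..k}. a j \<odot> (\<Oplus>i\<in>{..Suc k - j}. b i \<odot> c (n - j - i))) =
    (\<Oplus>j\<in>{..k}. a j \<odot> ?T j \<oplus> a j \<odot> (\<Oplus>i\<in>{..k - j}. b i \<odot> c (n - j - i)))"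
  proof (rule M.finsum_cong')
    fix j assume j: "j \<in> {..k}"
    have "(\<Oplus>i\<in>{..Suc (k - j)}. b i \<odot> c (n - j - i)) =
        b (Suc (k - j)) \<odot> c (n - j - Suc (k - j)) \<oplus> (\<Oplus>i\<in>{..k - j}. b i \<odot> c (n - j - i))"
      by (rule M.finsum_Suc) auto
    moreover have "Suc k - j = Suc (k - j)" "n - j - Suc (k - j) = n - Suc k" using j Suc.prems by auto
    ultimately show "a j \<odot> (\<Oplus>i\<in>{..Suc k - j}. b i \<odot> c (n - j - i)) =
        a j \<odot> ?T j \<oplus> a j \<odot> (\<Oplus>i\<in>{..k - j}. b i \<odot> c (n - j - i))"
      by (simp add: smult_r_distr Pi_def)
  qed (auto simp: Pi_def)
  also have "\<dots> = (\<Oplus>j\<in>{..k}. a j \<odot> ?T j) \<oplus>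
      (\<Oplus>j\<in>{..k}. a j \<odot> (\<Oplus>i\<in>{..k - j}. b i \<odot> c (n - j - i)))"
    by (rule M.finsum_addf) (auto simp: Pi_def)
  finally have R: "(\<Oplus>j\<in>{..Suc k}. a j \<odot> (\<Oplus>i\<in>{..Suc k - j}. b i \<odot> c (n - j - i))) =
    a (Suc k) \<odot> ?T (Suc k) \<oplus> ((\<Oplus>j\<in>{..k}. a j \<odot> ?T j) \<oplus>
      (\<Oplus>j\<in>{..k}. a j \<odot> (\<Oplus>i\<in>{..k - j}. b i \<odot> c (n - j - i))))"
    by (subst M.finsum_Suc) (auto simp: Pi_def)
  have "(\<Oplus>\<^bsub>A\<^esub>i\<in>{..Suc k}. a i \<otimes>\<^bsub>A\<^esub> b (Suc k - i)) \<odot> c (n - Suc k) =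
      (\<Oplus>i\<in>{..Suc k}. a i \<odot> ?T i)"
    by (subst fld) (auto simp: smult_assoc1 Pi_def intro!: M.finsum_cong')
  also have "\<dots> = a (Suc k) \<odot> ?T (Suc k) \<oplus> (\<Oplus>i\<in>{..k}. a i \<odot> ?T i)"
    by (rule M.finsum_Suc) auto
  finally have "(\<Oplus>j\<in>{..Suc k}. (\<Oplus>\<^bsub>A\<^esub>i\<in>{..j}. a i \<otimes>\<^bsub>A\<^esub> b (j - i)) \<odot> c (n - j)) =
    (a (Suc k) \<odot> ?T (Suc k) \<oplus> (\<Oplus>i\<in>{..k}. a i \<odot> ?T i)) \<oplus>
    (\<Oplus>j\<in>{..k}. (\<Oplus>\<^bsub>A\<^esub>i\<in>{..j}. a i \<otimes>\<^bsub>A\<^esub> b (j - i)) \<odot> c (n - j))"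
    by (subst M.finsum_Suc) (auto simp: Pi_def)
  then show ?case
    unfolding R using Suc by (simp add: M.a_assoc Pi_def)
qed

lemma seq_module_is_module: "module Rees seq_module"
proof (rule moduleI)
  show "cring Rees" by (rule rees_cring)
  have addc: "m \<oplus>\<^bsub>seq_module\<^esub> m' \<in> carrier seq_module" if mm: "m \<in> carrier seq_module" "m' \<in> carrier seq_module" for m m'
  proof -
    obtain b where b: "\<And>n. n > b \<Longrightarrow> m n = \<zero>" using seq_bound[OF mm(1)] by blast
    obtain c where c: "\<And>n. n > c \<Longrightarrow> m' n = \<zero>" using seq_bound[OF mm(2)] by blast
    show ?thesis by (rule seqI[of _ "max b c"]) (simp_all add: seq_add seq_carr[OF mm(1)] seq_carr[OF mm(2)] b c)
  qed
  show "abelian_group seq_module"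
  proof (rule abelian_groupI)
    show "\<zero>\<^bsub>seq_module\<^esub> \<in> carrier seq_module" by (simp add: seq_module_def)
    fix m assume m: "m \<in> carrier seq_module"
    show "\<zero>\<^bsub>seq_module\<^esub> \<oplus>\<^bsub>seq_module\<^esub> m = m" using seq_carr[OF m] by (simp add: seq_module_def)
    obtain b where b: "\<And>n. n > b \<Longrightarrow> m n = \<zero>" using seq_bound[OF m] by blast
    show "\<exists>m'\<in>carrier seq_module. m' \<oplus>\<^bsub>seq_module\<^esub> m = \<zero>\<^bsub>seq_module\<^esub>"
    proof (rule bexI)
      show "(\<lambda>n. \<ominus> m n) \<oplus>\<^bsub>seq_module\<^esub> m = \<zero>\<^bsub>seq_module\<^esub>"
        using seq_carr[OF m] by (simp add: seq_module_def M.l_neg)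
      show "(\<lambda>n. \<ominus> m n) \<in> carrier seq_module"
        by (rule seqI[of _ b]) (simp_all add: seq_carr[OF m] b)
    qed
  next
    fix m m' m'' assume m: "m \<in> carrier seq_module" "m' \<in> carrier seq_module" "m'' \<in> carrier seq_module"
    show "m \<oplus>\<^bsub>seq_module\<^esub> m' \<oplus>\<^bsub>seq_module\<^esub> m'' = m \<oplus>\<^bsub>seq_module\<^esub> (m' \<oplus>\<^bsub>seq_module\<^esub> m'')"
      by (intro ext) (simp add: seq_add M.a_assoc seq_carr[OF m(1)] seq_carr[OF m(2)] seq_carr[OF m(3)])
  next
    fix m m' assume m: "m \<in> carrier seq_module" "m' \<in> carrier seq_module"
    show "m \<oplus>\<^bsub>seq_module\<^esub> m' = m' \<oplus>\<^bsub>seq_module\<^esub> m"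
      by (intro ext) (simp add: seq_add M.a_comm seq_carr[OF m(1)] seq_carr[OF m(2)])
  qed (rule addc)
  show "p \<odot>\<^bsub>seq_module\<^esub> m \<in> carrier seq_module" if "p \<in> carrier Rees" "m \<in> carrier seq_module" for p m
    by (rule seq_smult_closed[OF that])
  show "(p \<oplus>\<^bsub>Rees\<^esub> q) \<odot>\<^bsub>seq_module\<^esub> m = p \<odot>\<^bsub>seq_module\<^esub> m \<oplus>\<^bsub>seq_module\<^esub> q \<odot>\<^bsub>seq_module\<^esub> m"
    if p: "p \<in> carrier Rees" and q: "q \<in> carrier Rees" and m: "m \<in> carrier seq_module" for p q m
    by (intro ext) (simp add: seq_smult seq_add rees_add p q smult_l_distr M.finsum_addf Pi_def
        rees_coeff_carr[OF p] rees_coeff_carr[OF q] seq_carr[OF m])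
  show "p \<odot>\<^bsub>seq_module\<^esub> (m \<oplus>\<^bsub>seq_module\<^esub> m') = p \<odot>\<^bsub>seq_module\<^esub> m \<oplus>\<^bsub>seq_module\<^esub> p \<odot>\<^bsub>seq_module\<^esub> m'"
    if p: "p \<in> carrier Rees" and m: "m \<in> carrier seq_module" and m': "m' \<in> carrier seq_module" for p m m'
    by (intro ext) (simp add: seq_smult seq_add smult_r_distr M.finsum_addf Pi_def
        rees_coeff_carr[OF p] seq_carr[OF m] seq_carr[OF m'])
  show "(p \<otimes>\<^bsub>Rees\<^esub> q) \<odot>\<^bsub>seq_module\<^esub> m = p \<odot>\<^bsub>seq_module\<^esub> (q \<odot>\<^bsub>seq_module\<^esub> m)"
    if p: "p \<in> carrier Rees" and q: "q \<in> carrier Rees" and m: "m \<in> carrier seq_module" for p q m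
  proof
    fix n
    show "((p \<otimes>\<^bsub>Rees\<^esub> q) \<odot>\<^bsub>seq_module\<^esub> m) n = (p \<odot>\<^bsub>seq_module\<^esub> (q \<odot>\<^bsub>seq_module\<^esub> m)) n"
      using convolution_assoc[of p q m n n] rees_coeff_carr[OF p] rees_coeff_carr[OF q] seq_carr[OF m]
      by (simp add: seq_smult rees_mult[OF p q] Pi_def)
  qed
  show "\<one>\<^bsub>Rees\<^esub> \<odot>\<^bsub>seq_module\<^esub> m = m" if m: "m \<in> carrier seq_module" for m
  proof
    fix n
    have "\<one>\<^bsub>Rees\<^esub> = rees_monom \<one>\<^bsub>A\<^esub> 0" by (intro ext) (simp add: rees_one rees_monom_def)
    then show "(\<one>\<^bsub>Rees\<^esub> \<odot>\<^bsub>seq_module\<^esub> m) n = m n"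
      using rees_monom_coeff_sum[of "\<lambda>i. m (n - i)" "\<one>\<^bsub>A\<^esub>" 0 n] seq_carr[OF m] by (simp add: seq_smult)
  qed
qed

abbreviation "L \<equiv> L_module A I M"

definition L_class :: "(nat \<Rightarrow> 'm) \<Rightarrow> nat \<Rightarrow> 'm set" where "L_class m = (\<lambda>n. IM (n + 1) +> m n)"

lemma L_comp_quot:
  "module A (L_comp A I M n)" "(\<lambda>m. IM (n + 1) +> m) \<in> mod_hom A M (L_comp A I M n)"
  "(\<lambda>m. IM (n + 1) +> m) ` carrier M = carrier (L_comp A I M n)"
  "IM (n + 1) +> \<zero> = \<zero>\<^bsub>L_comp A I M n\<^esub>"
  unfolding L_comp_def by (rule quot_map[OF IM_submodule])+

lemma L_class_eq_iff:
  assumes "m \<in> carrier seq_module" "m' \<in> carrier seq_module"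
  shows "L_class m = L_class m' \<longleftrightarrow> (\<forall>n. m n \<ominus> m' n \<in> IM (n + 1))"
  using coset_eq_iff[OF IM_submodule seq_carr[OF assms(1)] seq_carr[OF assms(2)]]
  by (simp add: L_class_def fun_eq_iff)

lemma L_class_closed:
  assumes m: "m \<in> carrier seq_module" shows "L_class m \<in> carrier L"
proof -
  have "{n. L_class m n \<noteq> \<zero>\<^bsub>L_comp A I M n\<^esub>} \<subseteq> {n. m n \<noteq> \<zero>}"
    using L_comp_quot(4) by (auto simp: L_class_def)
  then have "finite {n. L_class m n \<noteq> \<zero>\<^bsub>L_comp A I M n\<^esub>}" using seq_fin[OF m] finite_subset by blast
  moreover have "L_class m n \<in> carrier (L_comp A I M n)" for n
    using mod_homD(1)[OF L_comp_quot(2) seq_carr[OF m]] by (simp add: L_class_def)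
  ultimately show ?thesis by (simp add: L_module_def)
qed

text \<open>The union over a coset in the definition of the action on \<open>L\<close> collapses to a single coset:
  if two elements of \<open>M\<close> are congruent modulo $I^{n-i+1}M$, then their products with an element of
  $I^i$ are congruent modulo $I^{n+1}M$.\<close>

lemma L_class_hom: "L_class \<in> mod_hom Rees seq_module L"
proof (rule mod_homI)
  show "L_class m \<in> carrier L" if "m \<in> carrier seq_module" for m using L_class_closed[OF that] .
  show "L_class (m \<oplus>\<^bsub>seq_module\<^esub> m') = L_class m \<oplus>\<^bsub>L\<^esub> L_class m'"
    if "m \<in> carrier seq_module" "m' \<in> carrier seq_module" for m m'
    using mod_homD(2)[OF L_comp_quot(2) seq_carr[OF that(1)] seq_carr[OF that(2)]]
    by (simp add: L_class_def L_module_def seq_add)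
  show "L_class (p \<odot>\<^bsub>seq_module\<^esub> m) = p \<odot>\<^bsub>L\<^esub> L_class m"
    if p: "p \<in> carrier Rees" and m: "m \<in> carrier seq_module" for p m
  proof
    fix n
    let ?q = "\<lambda>x. IM (n + 1) +> x"
    interpret Ln: module A "L_comp A I M n" by (rule L_comp_quot(1))
    have pm: "p i \<odot> m (n - i) \<in> carrier M" for i using rees_coeff_carr[OF p] seq_carr[OF m] by simp
    have U: "(\<Union>x\<in>L_class m (n - i). ?q (p i \<odot> x)) = ?q (p i \<odot> m (n - i))" if i: "i \<le> n" for i
    proof -
      interpret S: abelian_subgroup "IM (n - i + 1)" M by (rule submodule_abelian_subgroup[OF IM_submodule])
      have "?q (p i \<odot> x) = ?q (p i \<odot> m (n - i))" if x: "x \<in> L_class m (n - i)" for x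
      proof -
        have xc: "x \<in> carrier M"
          using x M.a_r_coset_subset_G[OF S.a_subset seq_carr[OF m]] by (auto simp: L_class_def)
        have "IM (n - i + 1) +> x = IM (n - i + 1) +> m (n - i)"
          using S.a_repr_independence'[OF x[unfolded L_class_def] seq_carr[OF m]] by simp
        then have "x \<ominus> m (n - i) \<in> IM (n - i + 1)"
          using coset_eq_iff[OF IM_submodule xc seq_carr[OF m]] by blast
        then have "p i \<odot> (x \<ominus> m (n - i)) \<in> IM (i + (n - i + 1))"
          using IM_power_smult[OF rees_coeff[OF p]] by blast
        moreover have "i + (n - i + 1) = n + 1" using i by simp
        ultimately have "p i \<odot> (x \<ominus> m (n - i)) \<in> IM (n + 1)" by (simp only:)
        moreover have "p i \<odot> (x \<ominus> m (n - i)) = p i \<odot> x \<ominus> p i \<odot> m (n - i)"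
          by (rule mod_hom_diff[OF module_axioms module_axioms smult_hom[OF rees_coeff_carr[OF p]] xc seq_carr[OF m]])
        ultimately show ?thesis
          using coset_eq_iff[OF IM_submodule _ pm] rees_coeff_carr[OF p] xc by simp
      qed
      moreover have "L_class m (n - i) \<noteq> {}"
        using S.a_rcos_self[OF seq_carr[OF m]] unfolding L_class_def by blast
      ultimately show ?thesis by (rule SUP_eq_const[rotated])
    qed
    have "L_class (p \<odot>\<^bsub>seq_module\<^esub> m) n = (\<Oplus>\<^bsub>L_comp A I M n\<^esub>i\<in>{..n}. ?q (p i \<odot> m (n - i)))"
      unfolding L_class_def seq_smult
      by (rule mod_hom_finsum[OF module_axioms L_comp_quot(1,2)]) (use pm in auto)
    also have "\<dots> = (\<Oplus>\<^bsub>L_comp A I M n\<^esub>i\<in>{..n}. (\<Union>x\<in>L_class m (n - i). ?q (p i \<odot> x)))"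
    proof (rule Ln.M.finsum_cong')
      show "?q (p i \<odot> m (n - i)) = (\<Union>x\<in>L_class m (n - i). ?q (p i \<odot> x))" if "i \<in> {..n}" for i
        using U[of i] that by (simp only: atMost_iff)
      show "(\<lambda>i. \<Union>x\<in>L_class m (n - i). ?q (p i \<odot> x)) \<in> {..n} \<rightarrow> carrier (L_comp A I M n)"
      proof (rule funcsetI)
        fix i assume "i \<in> {..n}"
        then show "(\<Union>x\<in>L_class m (n - i). ?q (p i \<odot> x)) \<in> carrier (L_comp A I M n)"
          using mod_homD(1)[OF L_comp_quot(2) pm, of n i] by (simp only: U atMost_iff)
      qed
    qed simp
    also have "\<dots> = (p \<odot>\<^bsub>L\<^esub> L_class m) n" by (simp add: L_module_def)
    finally show "L_class (p \<odot>\<^bsub>seq_module\<^esub> m) n = (p \<odot>\<^bsub>L\<^esub> L_class m) n" .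
  qed
qed

lemma L_class_surj: "L_class ` carrier seq_module = carrier L"
proof
  show "L_class ` carrier seq_module \<subseteq> carrier L" using L_class_closed by blast
  show "carrier L \<subseteq> L_class ` carrier seq_module"
  proof
    fix z assume z: "z \<in> carrier L"
    have "\<exists>m. m \<in> carrier M \<and> IM (n + 1) +> m = z n \<and> (z n = \<zero>\<^bsub>L_comp A I M n\<^esub> \<longrightarrow> m = \<zero>)" for n
    proof (cases "z n = \<zero>\<^bsub>L_comp A I M n\<^esub>")
      case True
      then show ?thesis using L_comp_quot(4) by (intro exI[of _ "\<zero>"]) simp
    next
      case False
      have "z n \<in> (\<lambda>m. IM (n + 1) +> m) ` carrier M"
        unfolding L_comp_quot(3) using z by (simp add: L_module_def)
      then show ?thesis using False by auto
    qed
    then obtain m where m: "\<And>n. m n \<in> carrier M" "\<And>n. IM (n + 1) +> m n = z n"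
      "\<And>n. z n = \<zero>\<^bsub>L_comp A I M n\<^esub> \<Longrightarrow> m n = \<zero>" by metis
    have "{n. m n \<noteq> \<zero>} \<subseteq> {n. z n \<noteq> \<zero>\<^bsub>L_comp A I M n\<^esub>}" using m(3) by blast
    then have "m \<in> carrier seq_module"
      using z m(1) finite_subset by (auto simp: L_module_def seq_module_def)
    moreover have "L_class m = z" using m(2) by (simp add: L_class_def)
    ultimately show "z \<in> L_class ` carrier seq_module" by blast
  qed
qed

lemma L_zero: "L_class \<zero>\<^bsub>seq_module\<^esub> = \<zero>\<^bsub>L\<^esub>"
  using L_comp_quot(4) by (simp add: L_class_def L_module_def seq_module_def)

lemma L_module_is_module: "module Rees L"
proof -
  note * = module_surj_image[OF seq_module_is_module L_class_hom]
  note * = *[OF L_class_surj]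
  show ?thesis by (rule *) (rule L_zero)
qed

lemma rees_monom_smult:
  assumes m: "m \<in> carrier seq_module" and a: "a \<in> carrier A"
  shows "(rees_monom a k \<odot>\<^bsub>seq_module\<^esub> m) n = (if k \<le> n then a \<odot> m (n - k) else \<zero>)"
  using rees_monom_coeff_sum[of "\<lambda>i. m (n - i)" a k n] seq_carr[OF m] a by (simp add: seq_smult)

definition single :: "'m \<Rightarrow> nat \<Rightarrow> nat \<Rightarrow> 'm"
  where "single m k = (\<lambda>i. if i = k then m else \<zero>)"

lemma single_seq: "m \<in> carrier M \<Longrightarrow> single m k \<in> carrier seq_module"
  by (rule seqI[of _ k]) (auto simp: single_def)

lemma smult_single:
  assumes p: "p \<in> carrier Rees" and m: "m \<in> carrier M"
  shows "(p \<odot>\<^bsub>seq_module\<^esub> single m k) n = (if k \<le> n then p (n - k) \<odot> m else \<zero>)"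
proof (cases "k \<le> n")
  case True
  have "(p \<odot>\<^bsub>seq_module\<^esub> single m k) n = (\<Oplus>i\<in>{..n}. if n - k = i then p i \<odot> m else \<zero>)"
    unfolding seq_smult
  proof (rule M.finsum_cong')
    fix i assume "i \<in> {..n}"
    then have "n - i = k \<longleftrightarrow> n - k = i" using True by auto
    then show "p i \<odot> single m k (n - i) = (if n - k = i then p i \<odot> m else \<zero>)"
      using rees_coeff_carr[OF p, of i] by (simp add: single_def)
  qed (use rees_coeff_carr[OF p] m in auto)
  also have "\<dots> = p (n - k) \<odot> m"
    using M.finsum_singleton[of "n - k" "{..n}" "\<lambda>i. p i \<odot> m"] rees_coeff_carr[OF p] m by simp
  finally show ?thesis using True by simp
next
  case False
  have "(p \<odot>\<^bsub>seq_module\<^esub> single m k) n = (\<Oplus>i\<in>{..n}. \<zero>)"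
    unfolding seq_smult
    by (rule M.finsum_cong') (use False rees_coeff_carr[OF p] in \<open>auto simp: single_def\<close>)
  then show ?thesis using False by simp
qed

lemma L_rep:
  assumes "z \<in> carrier L" obtains g where "g \<in> carrier seq_module" "z = L_class g"
  using assms L_class_surj by blast

lemma L_class_zero_iff:
  assumes "g \<in> carrier seq_module" shows "L_class g = \<zero>\<^bsub>L\<^esub> \<longleftrightarrow> (\<forall>n. g n \<in> IM (n + 1))"
proof -
  interpret S: module Rees seq_module by (rule seq_module_is_module)
  have "\<zero>\<^bsub>seq_module\<^esub> n = \<zero>" for n by (simp add: seq_module_def)
  then show ?thesis
    using L_class_eq_iff[OF assms S.M.zero_closed] diff_zero[OF seq_carr[OF assms]] by (simp add: L_zero)
qed

lemmas L_class_smult = mod_homD(3)[OF L_class_hom]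

lemma L_class_diff:
  "g \<in> carrier seq_module \<Longrightarrow> h \<in> carrier seq_module \<Longrightarrow> L_class (g \<ominus>\<^bsub>seq_module\<^esub> h) = L_class g \<ominus>\<^bsub>L\<^esub> L_class h"
  by (rule mod_hom_diff[OF seq_module_is_module L_module_is_module L_class_hom])

text \<open>These submodules of \<open>L\<close> are where $\varphi$ is injective, once \<open>J\<close> is large.\<close>

definition L_above :: "nat \<Rightarrow> (nat \<Rightarrow> 'm set) set"
  where "L_above J = L_class ` {g \<in> carrier seq_module. \<forall>j<J. g j = \<zero>}"

lemma L_above_submodule: "submodule (L_above J) Rees L"
  unfolding L_above_def
proof (rule module.image_submodule[OF seq_module_is_module L_module_is_module L_class_hom])
  interpret S: module Rees seq_module by (rule seq_module_is_module)
  show "submodule {g \<in> carrier seq_module. \<forall>j<J. g j = \<zero>} Rees seq_module"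
  proof (rule S.submodule_if_smult_closed)
    show "\<zero>\<^bsub>seq_module\<^esub> \<in> {g \<in> carrier seq_module. \<forall>j<J. g j = \<zero>}"
      using S.M.zero_closed by (simp add: seq_module_def)
    fix p g assume p: "p \<in> carrier Rees" and g: "g \<in> {g \<in> carrier seq_module. \<forall>j<J. g j = \<zero>}"
    have "(p \<odot>\<^bsub>seq_module\<^esub> g) j = \<zero>" if "j < J" for j
    proof -
      have "(p \<odot>\<^bsub>seq_module\<^esub> g) j = (\<Oplus>i\<in>{..j}. \<zero>)"
        unfolding seq_smult
        by (rule M.finsum_cong') (use g that rees_coeff_carr[OF p] in auto)
      then show ?thesis by simp
    qed
    then show "p \<odot>\<^bsub>seq_module\<^esub> g \<in> {g \<in> carrier seq_module. \<forall>j<J. g j = \<zero>}"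
      using seq_smult_closed[OF p] g by simp
  qed (auto simp: seq_add)
qed

section \<open>The Ratliff--Rush filtration modulo an element\<close>

text \<open>Membership of \<open>m\<close> in $\widetilde{I^nM}$ and, for \<open>in_RR_mod\<close>, membership of its class in
  $\widetilde{I^nN}$ with $N = M/xM$, both expressed through elements of \<open>M\<close>.\<close>

definition in_RR :: "nat \<Rightarrow> 'm \<Rightarrow> bool"
  where "in_RR n m \<longleftrightarrow> (\<exists>k\<ge>1. \<forall>a\<in>ideal_power A I k. a \<odot> m \<in> IM (n + k))"

definition in_RR_mod :: "'a \<Rightarrow> nat \<Rightarrow> 'm \<Rightarrow> bool"
  where "in_RR_mod x n m \<longleftrightarrow>
    (\<exists>k\<ge>1. \<forall>a\<in>ideal_power A I k. \<exists>v\<in>carrier M. a \<odot> m \<ominus> x \<odot> v \<in> IM (n + k))"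

text \<open>Every element of $\widetilde{I^nN}$ comes from $\widetilde{I^nM}$.\<close>

definition lifts_mod :: "'a \<Rightarrow> bool"
  where "lifts_mod x \<longleftrightarrow>
    (\<forall>n\<ge>1. \<forall>m\<in>carrier M. in_RR_mod x n m \<longrightarrow> (\<exists>v\<in>carrier M. in_RR n (m \<ominus> x \<odot> v)))"

lemma in_RR_mem: "m \<in> carrier M \<Longrightarrow> in_RR n m \<longleftrightarrow> m \<in> ratliff_rush A I M n"
  by (auto simp: in_RR_def ratliff_rush_def colon_module_def)

text \<open>The inclusion $\rho(\widetilde{I^nM}) \subseteq \widetilde{I^nN}$ always holds, so only the
  lifting of elements remains. The translation rests on $I^jN$ being the image of $I^jM$.\<close>

lemma behaves_well_iff_lifts_mod:
  assumes x: "x \<in> carrier A"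
  shows "ratliff_rush_behaves_well A I M x \<longleftrightarrow> lifts_mod x"
proof -
  define xM where "xM = elem_mult_module x M"
  define N where "N = M QuotM xM"
  define \<rho> where "\<rho> = (\<lambda>m. xM +> m)"
  have xM: "submodule xM A M"
    unfolding xM_def elem_mult_module_def
    by (rule image_submodule[OF module_axioms smult_hom[OF x] carrier_is_submodule])
  have \<rho>: "\<rho> \<in> mod_hom A M N" "\<rho> ` carrier M = carrier N" and N: "module A N"
    unfolding \<rho>_def N_def using quot_map[OF xM] by auto
  have \<rho>_eq: "\<rho> m = \<rho> m' \<longleftrightarrow> (\<exists>v\<in>carrier M. m \<ominus> m' = x \<odot> v)"
    if "m \<in> carrier M" "m' \<in> carrier M" for m m'
    using coset_eq_iff[OF xM that] by (auto simp: \<rho>_def xM_def elem_mult_module_def)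
  have \<rho>_IM: "\<rho> y \<in> ideal_mult_module A (ideal_power A I j) N \<longleftrightarrow>
      (\<exists>v\<in>carrier M. y \<ominus> x \<odot> v \<in> IM j)" if y: "y \<in> carrier M" for y j
  proof -
    have im: "ideal_mult_module A (ideal_power A I j) N = \<rho> ` IM j"
      by (rule ideal_mult_module_image[OF module_axioms N \<rho>]) (use power_carr in blast)
    have "\<rho> y \<in> \<rho> ` IM j \<longleftrightarrow> (\<exists>w\<in>IM j. \<exists>v\<in>carrier M. y \<ominus> w = x \<odot> v)"
      using \<rho>_eq[OF y] IM_carr by (auto simp: image_iff)
    also have "\<dots> \<longleftrightarrow> (\<exists>v\<in>carrier M. y \<ominus> x \<odot> v \<in> IM j)"
    proof -
      have sub: "y \<ominus> w = u \<longleftrightarrow> w = y \<ominus> u" if "w \<in> carrier M" "u \<in> carrier M" for w u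
        using diff_eq_iff[OF y that] diff_eq_iff[OF y that(2,1)] M.a_comm[OF that] by auto
      show ?thesis using sub x IM_carr by (metis smult_closed)
    qed
    finally show ?thesis unfolding im .
  qed
  have mem: "\<rho> m \<in> ratliff_rush A I N n \<longleftrightarrow> in_RR_mod x n m" if m: "m \<in> carrier M" for m n
  proof -
    have "a \<odot>\<^bsub>N\<^esub> \<rho> m \<in> ideal_mult_module A (ideal_power A I (n + k)) N \<longleftrightarrow>
        (\<exists>v\<in>carrier M. a \<odot> m \<ominus> x \<odot> v \<in> IM (n + k))" if a: "a \<in> ideal_power A I k" for a k
      using \<rho>_IM[of "a \<odot> m" "n + k"] mod_homD(3)[OF \<rho>(1) power_carr[OF a] m] power_carr[OF a] m
      by simp
    then show ?thesis
      using mod_homD(1)[OF \<rho>(1) m] by (simp add: ratliff_rush_def colon_module_def in_RR_mod_def Bex_def)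
  qed
  have in_RR_in_RR_mod: "in_RR_mod x n m" if rr: "in_RR n m" and m: "m \<in> carrier M" for n m
  proof -
    obtain k where k: "k \<ge> 1" "\<And>a. a \<in> ideal_power A I k \<Longrightarrow> a \<odot> m \<in> IM (n + k)"
      using rr unfolding in_RR_def by blast
    have "a \<odot> m \<ominus> x \<odot> \<zero> \<in> IM (n + k)" if "a \<in> ideal_power A I k" for a
      using k(2)[OF that] x diff_zero[OF IM_carr[OF k(2)[OF that]]] by simp
    then show ?thesis using k(1) unfolding in_RR_mod_def by blast
  qed
  have eq: "\<rho> ` ratliff_rush A I M n = ratliff_rush A I N n \<longleftrightarrow>
    (\<forall>m\<in>carrier M. in_RR_mod x n m \<longrightarrow> (\<exists>v\<in>carrier M. in_RR n (m \<ominus> x \<odot> v)))" for n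
  proof
    assume e: "\<rho> ` ratliff_rush A I M n = ratliff_rush A I N n"
    show "\<forall>m\<in>carrier M. in_RR_mod x n m \<longrightarrow> (\<exists>v\<in>carrier M. in_RR n (m \<ominus> x \<odot> v))"
    proof (intro ballI impI)
      fix m assume m: "m \<in> carrier M" "in_RR_mod x n m"
      then have "\<rho> m \<in> \<rho> ` ratliff_rush A I M n" using e mem by simp
      then obtain m' where m': "m' \<in> ratliff_rush A I M n" "\<rho> m = \<rho> m'" by blast
      then have m'c: "m' \<in> carrier M" by (auto simp: ratliff_rush_def colon_module_def)
      then obtain v where v: "v \<in> carrier M" "m \<ominus> m' = x \<odot> v" using \<rho>_eq m(1) m'(2) by blast
      have "m \<ominus> (m \<ominus> m') = m'"
        by (rule diff_diff[OF m(1) m'c])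
      then have "m \<ominus> x \<odot> v = m'" using v(2) by simp
      then show "\<exists>v\<in>carrier M. in_RR n (m \<ominus> x \<odot> v)" using v(1) m'(1) in_RR_mem[OF m'c] by metis
    qed
  next
    assume l: "\<forall>m\<in>carrier M. in_RR_mod x n m \<longrightarrow> (\<exists>v\<in>carrier M. in_RR n (m \<ominus> x \<odot> v))"
    show "\<rho> ` ratliff_rush A I M n = ratliff_rush A I N n"
    proof
      show "\<rho> ` ratliff_rush A I M n \<subseteq> ratliff_rush A I N n"
      proof
        fix c assume "c \<in> \<rho> ` ratliff_rush A I M n"
        then obtain m where m: "m \<in> ratliff_rush A I M n" "c = \<rho> m" by blast
        then have mc: "m \<in> carrier M" by (auto simp: ratliff_rush_def colon_module_def)
        then show "c \<in> ratliff_rush A I N n" using mem in_RR_in_RR_mod in_RR_mem m by blast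
      qed
      show "ratliff_rush A I N n \<subseteq> \<rho> ` ratliff_rush A I M n"
      proof
        fix c assume c: "c \<in> ratliff_rush A I N n"
        then have "c \<in> carrier N" by (auto simp: ratliff_rush_def colon_module_def)
        then obtain m where m: "m \<in> carrier M" "c = \<rho> m" using \<rho>(2) by blast
        then obtain v where v: "v \<in> carrier M" "in_RR n (m \<ominus> x \<odot> v)" using l mem c by blast
        have mv: "m \<ominus> x \<odot> v \<in> carrier M" using m v x by simp
        have "m \<ominus> (m \<ominus> x \<odot> v) = x \<odot> v"
          using m(1) v(1) x by (simp add: diff_diff)
        then have "c = \<rho> (m \<ominus> x \<odot> v)" using \<rho>_eq[OF m(1) mv] v(1) m(2) by blast
        then show "c \<in> \<rho> ` ratliff_rush A I M n" using v(2) in_RR_mem[OF mv] by blast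
      qed
    qed
  qed
  show ?thesis
    unfolding ratliff_rush_behaves_well_def lifts_mod_def
    by (simp only: eq[unfolded \<rho>_def N_def xM_def])
qed

end

section \<open>Multiplication by a superficial element on \<open>L\<close>\<close>

text \<open>The hypotheses on \<open>x\<close>, \<open>I\<close> and the maximal ideal in the form in which the argument uses them:
  some power of \<open>\<mm>\<close> maps \<open>M\<close> into \<open>IM\<close>, and \<open>n0\<close> is a bound from which on $(I^{n+1}M :_M x)$ is
  contained in $I^nM$.\<close>

locale superficial_module = adic_module A M I
  for A :: "('a, 'x) ring_scheme" and M :: "('a, 'm) module" (structure) and I :: "'a set" +
  fixes \<mm> :: "'a set" and x :: 'a and n0 :: nat
  assumes \<mm>_ideal: "ideal \<mm> A" and I_sub: "I \<subseteq> \<mm>" and x_I: "x \<in> I"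
    and \<mm>_power: "\<exists>t. \<forall>a\<in>ideal_power A \<mm> t. \<forall>m\<in>carrier M. a \<odot> m \<in> IM 1"
    and superficial_x: "\<And>n m. n \<ge> n0 \<Longrightarrow> m \<in> carrier M \<Longrightarrow> x \<odot> m \<in> IM (n + 1) \<Longrightarrow> m \<in> IM n"
begin

abbreviation \<MM> :: "(nat \<Rightarrow> 'a) set" where "\<MM> \<equiv> rees_maximal_ideal A \<mm> I"

lemma x_carr: "x \<in> carrier A"
  using x_I ideal.Icarr[OF I_ideal] by blast

lemma \<mm>_carr: "a \<in> ideal_power A \<mm> k \<Longrightarrow> a \<in> carrier A"
  using ideal.Icarr[OF R.ideal_power_ideal[OF \<mm>_ideal]] .

lemma \<MM>_ideal: "ideal \<MM> Rees"
proof -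
  interpret Re: cring Rees by (rule rees_cring)
  interpret mm: ideal \<mm> A by (rule \<mm>_ideal)
  have mult0: "(p \<otimes>\<^bsub>Rees\<^esub> q) 0 = p 0 \<otimes>\<^bsub>A\<^esub> q 0" if "p \<in> carrier Rees" "q \<in> carrier Rees" for p q
    using rees_coeff_carr[OF that(1)] rees_coeff_carr[OF that(2)] by (simp add: rees_mult[OF that])
  show ?thesis
  proof (rule idealI)
    show "ring Rees" by (rule Re.ring_axioms)
    show "subgroup \<MM> (add_monoid Rees)"
    proof (rule Re.add.subgroupI)
      show "\<MM> \<subseteq> carrier Rees" by (auto simp: rees_maximal_ideal_def)
      show "\<MM> \<noteq> {}" using Re.zero_closed by (auto simp: rees_maximal_ideal_def rees_zero)
      show "\<ominus>\<^bsub>Rees\<^esub> p \<in> \<MM>" if "p \<in> \<MM>" for p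
      proof -
        have p: "p \<in> carrier Rees" "p 0 \<in> \<mm>" using that by (auto simp: rees_maximal_ideal_def)
        have "(\<ominus>\<^bsub>Rees\<^esub> p) 0 \<oplus>\<^bsub>A\<^esub> p 0 = \<zero>\<^bsub>A\<^esub>"
          using rees_add[of "\<ominus>\<^bsub>Rees\<^esub> p" p 0] p by (simp add: Re.l_neg rees_zero)
        then have "(\<ominus>\<^bsub>Rees\<^esub> p) 0 = \<ominus>\<^bsub>A\<^esub> p 0"
          using R.minus_equality rees_coeff_carr[of "\<ominus>\<^bsub>Rees\<^esub> p"] rees_coeff_carr[of p] p by auto
        then show ?thesis using p by (simp add: rees_maximal_ideal_def)
      qed
      show "p \<oplus>\<^bsub>Rees\<^esub> q \<in> \<MM>" if "p \<in> \<MM>" "q \<in> \<MM>" for p q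
        using that by (auto simp: rees_maximal_ideal_def rees_add)
    qed
    show "q \<otimes>\<^bsub>Rees\<^esub> p \<in> \<MM>" "p \<otimes>\<^bsub>Rees\<^esub> q \<in> \<MM>" if "p \<in> \<MM>" "q \<in> carrier Rees" for p q
      using that mm.I_l_closed mm.I_r_closed rees_coeff_carr[of q]
      by (auto simp: rees_maximal_ideal_def mult0)
  qed
qed

lemma \<MM>_carr: "p \<in> ideal_power Rees \<MM> k \<Longrightarrow> p \<in> carrier Rees"
  using ideal.Icarr[OF cring.ideal_power_ideal[OF rees_cring \<MM>_ideal]] .

lemma \<MM>_antimono: "i \<le> j \<Longrightarrow> p \<in> ideal_power Rees \<MM> j \<Longrightarrow> p \<in> ideal_power Rees \<MM> i"
  using cring.ideal_power_antimono[OF rees_cring \<MM>_ideal] by blast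

text \<open>In a product of \<open>k\<close> elements of $\mathfrak M$, every contribution to the component of degree
  \<open>i\<close> uses at most \<open>i\<close> factors of positive degree, and the components of degree \<open>0\<close> of the other
  factors lie in \<open>\<mm>\<close>.\<close>

lemma \<MM>_power_coeff: "p \<in> ideal_power Rees \<MM> k \<Longrightarrow> p i \<in> ideal_power A \<mm> (k - i)"
proof (induction k arbitrary: p i)
  case 0
  then show ?case using rees_coeff_carr by simp
next
  case (Suc k)
  interpret mk: ideal "ideal_power A \<mm> (Suc k - i)" A for i by (rule R.ideal_power_ideal[OF \<mm>_ideal])
  note carr = \<MM>_carr[of _ "Suc k", unfolded ideal_power.simps(2)]
  have "\<forall>i. p i \<in> ideal_power A \<mm> (Suc k - i)" using Suc.prems unfolding ideal_power.simps(2)[of Rees]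
  proof (induction p rule: ideal_prod.induct)
    case (prod p q)
    have p: "p \<in> carrier Rees" "p 0 \<in> \<mm>" using prod(1) by (auto simp: rees_maximal_ideal_def)
    have q: "q \<in> carrier Rees" using \<MM>_carr[OF prod(2)] .
    show ?case
    proof
      fix i
      have "(\<Oplus>\<^bsub>A\<^esub>l\<in>{..i}. p l \<otimes>\<^bsub>A\<^esub> q (i - l)) \<in> ideal_power A \<mm> (Suc k - i)"
      proof (rule R.finsum_in_subgroup)
        show "additive_subgroup (ideal_power A \<mm> (Suc k - i)) A" by (rule mk.additive_subgroup_axioms)
        fix l assume l: "l \<in> {..i}"
        show "p l \<otimes>\<^bsub>A\<^esub> q (i - l) \<in> ideal_power A \<mm> (Suc k - i)"
        proof (cases "l = 0")
          case True
          have "p 0 \<otimes>\<^bsub>A\<^esub> q i \<in> ideal_power A \<mm> (Suc (k - i))"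
            unfolding ideal_power.simps(2) by (rule ideal_prod.prod[OF p(2) Suc.IH[OF prod(2)]])
          moreover have "Suc k - i \<le> Suc (k - i)" by simp
          ultimately show ?thesis using R.ideal_power_antimono[OF \<mm>_ideal] True by auto
        next
          case False
          have "Suc k - i \<le> k - (i - l)" using False l by auto
          then have "q (i - l) \<in> ideal_power A \<mm> (Suc k - i)"
            using R.ideal_power_antimono[OF \<mm>_ideal] Suc.IH[OF prod(2), of "i - l"] by blast
          then show ?thesis using mk.I_l_closed rees_coeff_carr[OF p(1)] by blast
        qed
      qed simp
      then show "(p \<otimes>\<^bsub>Rees\<^esub> q) i \<in> ideal_power A \<mm> (Suc k - i)" by (simp only: rees_mult[OF p(1) q])
    qed
  next
    case (sum p q)
    then show ?case using mk.a_closed by (simp add: rees_add[OF carr[OF sum(1)] carr[OF sum(2)]])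
  qed
  then show ?case by blast
qed

lemma rees_monom_mult:
  assumes a: "a \<in> ideal_power A I i" and b: "b \<in> ideal_power A I j"
  shows "rees_monom a i \<otimes>\<^bsub>Rees\<^esub> rees_monom b j = rees_monom (a \<otimes>\<^bsub>A\<^esub> b) (i + j)"
proof
  fix n
  note ca = power_carr[OF a] and cb = power_carr[OF b]
  have "(rees_monom a i \<otimes>\<^bsub>Rees\<^esub> rees_monom b j) n = (\<Oplus>\<^bsub>A\<^esub>l\<in>{..n}. rees_monom a i l \<otimes>\<^bsub>A\<^esub> rees_monom b j (n - l))"
    by (rule rees_mult[OF rees_monom_closed[OF a] rees_monom_closed[OF b]])
  also have "\<dots> = (\<Oplus>\<^bsub>A\<^esub>l\<in>{..n}. if i = l then a \<otimes>\<^bsub>A\<^esub> rees_monom b j (n - l) else \<zero>\<^bsub>A\<^esub>)"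
    using ca cb by (intro R.finsum_cong') (auto simp: rees_monom_def)
  also have "\<dots> = (if i \<le> n then a \<otimes>\<^bsub>A\<^esub> rees_monom b j (n - i) else \<zero>\<^bsub>A\<^esub>)"
  proof (cases "i \<le> n")
    case True
    then show ?thesis
      using R.finsum_singleton[of i "{..n}" "\<lambda>l. a \<otimes>\<^bsub>A\<^esub> rees_monom b j (n - l)"] ca cb by (simp add: rees_monom_def Pi_def)
  next
    case False
    then have "(\<Oplus>\<^bsub>A\<^esub>l\<in>{..n}. if i = l then a \<otimes>\<^bsub>A\<^esub> rees_monom b j (n - l) else \<zero>\<^bsub>A\<^esub>) = (\<Oplus>\<^bsub>A\<^esub>l\<in>{..n}. \<zero>\<^bsub>A\<^esub>)"
      by (intro R.finsum_cong') auto
    then show ?thesis using False by simp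
  qed
  also have "\<dots> = rees_monom (a \<otimes>\<^bsub>A\<^esub> b) (i + j) n" using ca cb by (auto simp: rees_monom_def)
  finally show "(rees_monom a i \<otimes>\<^bsub>Rees\<^esub> rees_monom b j) n = rees_monom (a \<otimes>\<^bsub>A\<^esub> b) (i + j) n" .
qed

lemma rees_monom_\<MM>_power: "a \<in> ideal_power A I k \<Longrightarrow> rees_monom a k \<in> ideal_power Rees \<MM> k"
proof (induction k arbitrary: a)
  case 0
  then show ?case using rees_monom_closed[of a 0] by simp
next
  case (Suc k)
  show ?case using Suc.prems unfolding ideal_power.simps(2)
  proof (induction a rule: ideal_prod.induct)
    case (prod a b)
    have a: "a \<in> ideal_power A I 1" using prod(1) R.ideal_power_one[OF I_ideal] by simp
    have "rees_monom a 1 \<in> \<MM>"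
      using rees_monom_closed[OF a] \<mm>_carr[of _ 1] additive_subgroup.zero_closed[OF ideal.axioms(1)[OF \<mm>_ideal]]
      by (simp add: rees_maximal_ideal_def rees_monom_def)
    then have "rees_monom a 1 \<otimes>\<^bsub>Rees\<^esub> rees_monom b k \<in> ideal_prod Rees \<MM> (ideal_power Rees \<MM> k)"
      by (rule ideal_prod.prod[OF _ Suc.IH[OF prod(2)]])
    then show ?case using rees_monom_mult[OF a prod(2)] by simp
  next
    case (sum a b)
    have a: "a \<in> ideal_power A I (Suc k)" and b: "b \<in> ideal_power A I (Suc k)"
      using sum(1,2) by (simp_all add: ideal_power.simps(2))
    have "rees_monom (a \<oplus>\<^bsub>A\<^esub> b) (Suc k) = rees_monom a (Suc k) \<oplus>\<^bsub>Rees\<^esub> rees_monom b (Suc k)"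
    proof
      fix i
      show "rees_monom (a \<oplus>\<^bsub>A\<^esub> b) (Suc k) i = (rees_monom a (Suc k) \<oplus>\<^bsub>Rees\<^esub> rees_monom b (Suc k)) i"
        unfolding rees_add[OF rees_monom_closed[OF a] rees_monom_closed[OF b]] by (simp add: rees_monom_def)
    qed
    then show ?case using ideal_prod.sum[OF sum(3,4)] by simp
  qed
qed

text \<open>If $\mathfrak m^t M \subseteq IM$, then $\mathfrak m^t I^s M \subseteq I^{s+1} M$, which is the
  induction step.\<close>

lemma \<mm>_power_IM: "\<exists>k. \<forall>a\<in>ideal_power A \<mm> k. \<forall>m\<in>carrier M. a \<odot> m \<in> IM s"
proof (induction s)
  case 0
  show ?case by (intro exI[of _ 0]) (simp add: IM_0[simplified])
next
  case (Suc s)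
  then obtain k where k: "\<And>a m. a \<in> ideal_power A \<mm> k \<Longrightarrow> m \<in> carrier M \<Longrightarrow> a \<odot> m \<in> IM s" by blast
  obtain t where t: "\<And>a m. a \<in> ideal_power A \<mm> t \<Longrightarrow> m \<in> carrier M \<Longrightarrow> a \<odot> m \<in> IM 1"
    using \<mm>_power by blast
  have step: "b \<odot> y \<in> IM (Suc s)" if b: "b \<in> ideal_power A \<mm> t" and y: "y \<in> IM s" for b y
  proof -
    have "IM s \<subseteq> {y \<in> carrier M. b \<odot> y \<in> IM (Suc s)}"
    proof (rule ideal_mult_module_least)
      show "submodule {y \<in> carrier M. b \<odot> y \<in> IM (Suc s)} A M"
        by (rule preimage_submodule[OF module_axioms smult_hom[OF \<mm>_carr[OF b]] IM_submodule])
      fix c m assume c: "c \<in> ideal_power A I s" and m: "m \<in> carrier M"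
      have "b \<odot> (c \<odot> m) = c \<odot> (b \<odot> m)"
        by (rule smult_commute[OF \<mm>_carr[OF b] power_carr[OF c] m])
      then show "c \<odot> m \<in> {y \<in> carrier M. b \<odot> y \<in> IM (Suc s)}"
        using IM_power_smult[OF c t[OF b m]] power_carr[OF c] m by simp
    qed
    then show ?thesis using y by blast
  qed
  have "a \<odot> m \<in> IM (Suc s)" if "a \<in> ideal_power A \<mm> (t + k)" "m \<in> carrier M" for a m
    by (rule power_smult_split[OF \<mm>_ideal that IM_submodule]) (rule step[OF _ k[OF _ that(2)]])
  then show ?case by blast
qed

text \<open>In a bounded range of degrees, the components of elements of a high power of $\mathfrak M$ lie in
  a high power of \<open>\<mm>\<close>, and thus map \<open>M\<close> into a prescribed $I^D M$. The remaining degrees are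
  handled by the inclusion of the component of degree \<open>i\<close> in $I^i$.\<close>

lemma low_degree_IM:
  "\<exists>K. \<forall>p\<in>ideal_power Rees \<MM> K. \<forall>i\<le>D. \<forall>m\<in>carrier M. p i \<odot> m \<in> IM D"
proof -
  obtain k where k: "\<And>a m. a \<in> ideal_power A \<mm> k \<Longrightarrow> m \<in> carrier M \<Longrightarrow> a \<odot> m \<in> IM D"
    using \<mm>_power_IM by blast
  have "p i \<odot> m \<in> IM D" if p: "p \<in> ideal_power Rees \<MM> (k + D)" and "i \<le> D" "m \<in> carrier M" for p i m
  proof -
    have "k \<le> k + D - i" using that by simp
    then have "p i \<in> ideal_power A \<mm> k"
      using \<MM>_power_coeff[OF p, of i] R.ideal_power_antimono[OF \<mm>_ideal] by blast
    then show ?thesis by (rule k[OF _ that(3)])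
  qed
  then show ?thesis by blast
qed

text \<open>The element $xt$ of the Rees algebra; $\varphi$ denotes multiplication by it on \<open>L\<close>.\<close>

definition X :: "nat \<Rightarrow> 'a" where "X = rees_monom x 1"

lemma x_power: "x \<in> ideal_power A I 1"
  using x_I R.ideal_power_one[OF I_ideal] by simp

lemma X_carr: "X \<in> carrier Rees"
  unfolding X_def by (rule rees_monom_closed[OF x_power])

lemma X_smult:
  "g \<in> carrier seq_module \<Longrightarrow> (X \<odot>\<^bsub>seq_module\<^esub> g) n = (if n = 0 then \<zero> else x \<odot> g (n - 1))"
  using rees_monom_smult[of g x 1 n] x_carr by (auto simp: X_def)

text \<open>From degree \<open>n0 - 1\<close> on, the inclusion $(I^{n+2}M :_M x) \subseteq I^{n+1}M$ says that $\varphi$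
  is injective on the component of degree \<open>n\<close>.\<close>

lemma X_smult_zero:
  assumes g: "g \<in> carrier seq_module" and z: "X \<odot>\<^bsub>L\<^esub> L_class g = \<zero>\<^bsub>L\<^esub>" and n: "n + 1 \<ge> n0"
  shows "g n \<in> IM (n + 1)"
proof -
  have "L_class (X \<odot>\<^bsub>seq_module\<^esub> g) = \<zero>\<^bsub>L\<^esub>" using z L_class_smult[OF X_carr g] by simp
  then have "(X \<odot>\<^bsub>seq_module\<^esub> g) (n + 1) \<in> IM (n + 1 + 1)"
    using L_class_zero_iff[OF seq_smult_closed[OF X_carr g]] by blast
  then have "x \<odot> g n \<in> IM (n + 1 + 1)" by (simp add: X_smult[OF g])
  then show ?thesis by (rule superficial_x[OF n seq_carr[OF g]])
qed

lemma X_injective_above: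
  assumes "z \<in> L_above n0" "X \<odot>\<^bsub>L\<^esub> z = \<zero>\<^bsub>L\<^esub>"
  shows "z = \<zero>\<^bsub>L\<^esub>"
proof -
  obtain g where g: "g \<in> carrier seq_module" "\<And>j. j < n0 \<Longrightarrow> g j = \<zero>" "z = L_class g"
    using assms(1) unfolding L_above_def by blast
  have "g n \<in> IM (n + 1)" for n
    using X_smult_zero[OF g(1), of n] assms(2) g(2)[of n] g(3) IM_zero by (cases "n < n0") auto
  then show ?thesis using L_class_zero_iff[OF g(1)] g(3) by blast
qed

text \<open>The elements of $\widetilde{I^sM}$ represent torsion elements of \<open>L\<close> in degree \<open>s - 1\<close>: if
  $I^e m \subseteq I^{e+s}M$, then the components of degree at least \<open>e\<close> of an element of the Rees
  algebra act as required, and those of smaller degree do so in a high power of $\mathfrak M$.\<close>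

lemma in_RR_torsion:
  assumes m: "m \<in> carrier M" and rr: "in_RR s m"
  shows "\<exists>K. \<forall>p\<in>ideal_power Rees \<MM> K. \<forall>i. p i \<odot> m \<in> IM (i + s)"
proof -
  obtain e where e: "\<And>a. a \<in> ideal_power A I e \<Longrightarrow> a \<odot> m \<in> IM (s + e)"
    using rr unfolding in_RR_def by blast
  obtain K where K: "\<And>p i. p \<in> ideal_power Rees \<MM> K \<Longrightarrow> i \<le> e + s \<Longrightarrow> p i \<odot> m \<in> IM (e + s)"
    using low_degree_IM[of "e + s"] m by blast
  have "p i \<odot> m \<in> IM (i + s)" if p: "p \<in> ideal_power Rees \<MM> K" for p i
  proof (cases "i < e")
    case True
    then show ?thesis using IM_mono_mem[OF K[OF p, of i], of "i + s"] by simp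
  next
    case False
    have "p i \<in> ideal_power A I ((i - e) + e)" using rees_coeff[OF \<MM>_carr[OF p]] False by simp
    then show ?thesis
    proof (rule power_smult_split[OF I_ideal _ m IM_submodule])
      fix b c assume "b \<in> ideal_power A I (i - e)" "c \<in> ideal_power A I e"
      then have "b \<odot> (c \<odot> m) \<in> IM ((i - e) + (s + e))" by (intro IM_power_smult e)
      moreover have "(i - e) + (s + e) = i + s" using False by simp
      ultimately show "b \<odot> (c \<odot> m) \<in> IM (i + s)" by (simp only:)
    qed
  qed
  then show ?thesis by blast
qed

text \<open>A single power of $\mathfrak M$ annihilates the kernel of $\varphi$, because the kernel lives in
  finitely many degrees.\<close>

lemma X_kernel_torsion:
  "\<exists>s. \<forall>b\<in>carrier L. X \<odot>\<^bsub>L\<^esub> b = \<zero>\<^bsub>L\<^esub> \<longrightarrow> (\<forall>p\<in>ideal_power Rees \<MM> s. p \<odot>\<^bsub>L\<^esub> b = \<zero>\<^bsub>L\<^esub>)"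
proof -
  interpret L: module Rees L by (rule L_module_is_module)
  obtain s where s: "\<And>p i m. p \<in> ideal_power Rees \<MM> s \<Longrightarrow> i \<le> n0 \<Longrightarrow> m \<in> carrier M \<Longrightarrow> p i \<odot> m \<in> IM n0"
    using low_degree_IM[of n0] by blast
  have "p \<odot>\<^bsub>L\<^esub> b = \<zero>\<^bsub>L\<^esub>" if b: "b \<in> carrier L" and Xb: "X \<odot>\<^bsub>L\<^esub> b = \<zero>\<^bsub>L\<^esub>" and p: "p \<in> ideal_power Rees \<MM> s" for b p
  proof -
    obtain g where g: "g \<in> carrier seq_module" "b = L_class g" using L_rep[OF b] by blast
    note pc = \<MM>_carr[OF p]
    have pg: "p \<odot>\<^bsub>seq_module\<^esub> g \<in> carrier seq_module" by (rule seq_smult_closed[OF pc g(1)])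
    have "X \<odot>\<^bsub>L\<^esub> (p \<odot>\<^bsub>L\<^esub> b) = \<zero>\<^bsub>L\<^esub>"
      using L.smult_commute[OF X_carr pc b] Xb pc by simp
    then have X0: "X \<odot>\<^bsub>L\<^esub> L_class (p \<odot>\<^bsub>seq_module\<^esub> g) = \<zero>\<^bsub>L\<^esub>" using L_class_smult[OF pc g(1)] g(2) by simp
    have "(p \<odot>\<^bsub>seq_module\<^esub> g) n \<in> IM (n + 1)" for n
    proof (cases "n + 1 \<ge> n0")
      case True
      then show ?thesis by (rule X_smult_zero[OF pg X0])
    next
      case False
      have "(p \<odot>\<^bsub>seq_module\<^esub> g) n \<in> IM n0"
        unfolding seq_smult using False
        by (intro finsum_in_submodule[OF IM_submodule] s[OF p] seq_carr[OF g(1)]) auto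
      then show ?thesis using IM_mono_mem[of _ n0 "n + 1"] False by simp
    qed
    then have "L_class (p \<odot>\<^bsub>seq_module\<^esub> g) = \<zero>\<^bsub>L\<^esub>" using L_class_zero_iff[OF pg] by blast
    then show ?thesis using L_class_smult[OF pc g(1)] g(2) by simp
  qed
  then show ?thesis by blast
qed

section \<open>Vanishing of the first local cohomology and lifting\<close>

text \<open>If the class of \<open>m\<close> lies in $\widetilde{I^nN}$, then the element \<open>u\<close> of \<open>L\<close> given by \<open>m\<close> in
  degree \<open>n - 1\<close> satisfies $pu \in \varphi(L)$ for all \<open>p\<close> in a power of $\mathfrak M$, and the
  preimage can be chosen in the degrees where $\varphi$ is injective: the components of \<open>p\<close> of low
  degree annihilate \<open>u\<close>, so that only components of large degree contribute.\<close>

lemma exists_X_quotient: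
  assumes n: "n \<ge> 1" and m: "m \<in> carrier M" and rr: "in_RR_mod x n m"
  shows "\<exists>K. \<forall>p\<in>ideal_power Rees \<MM> K. \<exists>z\<in>L_above n0. X \<odot>\<^bsub>L\<^esub> z = p \<odot>\<^bsub>L\<^esub> L_class (single m (n - 1))"
proof -
  obtain e where e: "\<And>a. a \<in> ideal_power A I e \<Longrightarrow> \<exists>v\<in>carrier M. a \<odot> m \<ominus> x \<odot> v \<in> IM (n + e)"
    using rr unfolding in_RR_mod_def by blast
  \<comment> \<open>Components of \<open>p\<close> of degree below \<open>d\<close> will annihilate \<open>u\<close>. The component of degree \<open>i \<ge> d\<close>
    contributes to the preimage in degree \<open>n + i - 2\<close>, which is at least \<open>n0\<close>.\<close>
  define d where "d = e + n0 + 2"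
  obtain K where K: "\<And>p i. p \<in> ideal_power Rees \<MM> K \<Longrightarrow> i \<le> n + d \<Longrightarrow> p i \<odot> m \<in> IM (n + d)"
    using low_degree_IM[of "n + d"] m by blast
  have high: "\<exists>w\<in>carrier M. a \<odot> m \<ominus> x \<odot> w \<in> IM (n + i)"
    if i: "i \<ge> e" and a: "a \<in> ideal_power A I i" for a i
  proof -
    define S where "S = {y \<in> carrier M. \<exists>w\<in>carrier M. y \<ominus> x \<odot> w \<in> IM (n + i)}"
    have S: "submodule S A M"
    proof (rule submodule_if_smult_closed)
      show "\<zero> \<in> S"
        unfolding S_def using IM_zero x_carr by (auto intro!: bexI[of _ "\<zero>"] simp: diff_zero)
      fix y y' assume "y \<in> S" "y' \<in> S"
      then obtain w w' where w: "y \<in> carrier M" "w \<in> carrier M" "y \<ominus> x \<odot> w \<in> IM (n + i)"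
        "y' \<in> carrier M" "w' \<in> carrier M" "y' \<ominus> x \<odot> w' \<in> IM (n + i)" by (auto simp: S_def)
      have "(y \<oplus> y') \<ominus> x \<odot> (w \<oplus> w') = (y \<ominus> x \<odot> w) \<oplus> (y' \<ominus> x \<odot> w')"
        using w x_carr by (simp add: smult_r_distr a_minus_def M.minus_add M.a_ac)
      then show "y \<oplus> y' \<in> S" unfolding S_def using w IM_add[OF w(3,6)] by (auto intro!: bexI[of _ "w \<oplus> w'"])
    next
      fix c y assume c: "c \<in> carrier A" and "y \<in> S"
      then obtain w where w: "y \<in> carrier M" "w \<in> carrier M" "y \<ominus> x \<odot> w \<in> IM (n + i)" by (auto simp: S_def)
      have "c \<odot> y \<ominus> x \<odot> (c \<odot> w) = c \<odot> (y \<ominus> x \<odot> w)"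
        using c w x_carr by (simp add: smult_diff smult_commute[of x c])
      then show "c \<odot> y \<in> S" unfolding S_def using w c IM_smult[OF c w(3)] by (auto intro!: bexI[of _ "c \<odot> w"])
    qed (auto simp: S_def)
    have "a \<in> ideal_power A I ((i - e) + e)" using a i by simp
    then have "a \<odot> m \<in> S"
    proof (rule power_smult_split[OF I_ideal _ m S])
      fix b c assume b: "b \<in> ideal_power A I (i - e)" and c: "c \<in> ideal_power A I e"
      obtain v where v: "v \<in> carrier M" "c \<odot> m \<ominus> x \<odot> v \<in> IM (n + e)" using e[OF c] by blast
      have "b \<odot> (c \<odot> m) \<ominus> x \<odot> (b \<odot> v) = b \<odot> (c \<odot> m \<ominus> x \<odot> v)"
        using power_carr[OF b] power_carr[OF c] m v(1) x_carr by (simp add: smult_diff smult_commute[of x b])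
      also have "\<dots> \<in> IM ((i - e) + (n + e))" by (rule IM_power_smult[OF b v(2)])
      also have "(i - e) + (n + e) = n + i" using i by simp
      finally show "b \<odot> (c \<odot> m) \<in> S"
        unfolding S_def using power_carr[OF b] power_carr[OF c] m v(1)
        by (auto intro!: bexI[of _ "b \<odot> v"])
    qed
    then show ?thesis by (simp add: S_def)
  qed
  have "\<exists>z\<in>L_above n0. X \<odot>\<^bsub>L\<^esub> z = p \<odot>\<^bsub>L\<^esub> L_class (single m (n - 1))" if p: "p \<in> ideal_power Rees \<MM> K" for p
  proof -
    note pc = \<MM>_carr[OF p]
    have "\<exists>w. w \<in> carrier M \<and> (i \<ge> d \<longrightarrow> p i \<odot> m \<ominus> x \<odot> w \<in> IM (n + i)) \<and>
        (p i = \<zero>\<^bsub>A\<^esub> \<or> i < d \<longrightarrow> w = \<zero>)" for i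
    proof (cases "p i = \<zero>\<^bsub>A\<^esub> \<or> i < d")
      case True
      have "p i \<odot> m \<ominus> x \<odot> \<zero> \<in> IM (n + i)" if "i \<ge> d"
      proof -
        have "p i = \<zero>\<^bsub>A\<^esub>" using True that by simp
        then show ?thesis using m x_carr IM_zero by (simp add: diff_zero)
      qed
      then show ?thesis by (intro exI[of _ "\<zero>"]) simp
    next
      case False
      then show ?thesis using high[OF _ rees_coeff[OF pc], of i] by (auto simp: d_def)
    qed
    then obtain w where w: "\<And>i. w i \<in> carrier M"
      "\<And>i. i \<ge> d \<Longrightarrow> p i \<odot> m \<ominus> x \<odot> w i \<in> IM (n + i)"
      "\<And>i. p i = \<zero>\<^bsub>A\<^esub> \<or> i < d \<Longrightarrow> w i = \<zero>" by metis
    \<comment> \<open>The subtraction is truncated: for \<open>j + 2 < n\<close> the value is \<open>w 0\<close>, which is \<open>\<zero>\<close> as \<open>0 < d\<close>.\<close>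
    define g where "g j = w (j + 2 - n)" for j
    obtain b where b: "\<And>i. i > b \<Longrightarrow> p i = \<zero>\<^bsub>A\<^esub>" using rees_bound[OF pc] by blast
    have g: "g \<in> carrier seq_module"
      by (rule seqI[of _ "b + n"]) (auto simp: g_def w(1) intro!: w(3) b)
    have g0: "g j = \<zero>" if "j < n0" for j
      unfolding g_def using that n by (intro w(3)) (auto simp: d_def)
    note s = single_seq[OF m, of "n - 1"]
    have "(X \<odot>\<^bsub>seq_module\<^esub> g) l \<ominus> (p \<odot>\<^bsub>seq_module\<^esub> single m (n - 1)) l \<in> IM (l + 1)" for l
    proof (cases "n - 1 \<le> l")
      case False
      then have "l - 1 + 2 - n = 0 \<or> l = 0" "l + 1 - n = 0" "0 < d" by (auto simp: d_def)
      moreover have "l \<noteq> 0 \<Longrightarrow> g (l - 1) = \<zero>"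
        unfolding g_def using False by (intro w(3)) (auto simp: d_def)
      ultimately show ?thesis
        using False IM_zero x_carr by (auto simp: X_smult[OF g] smult_single[OF pc m] diff_zero)
    next
      case True
      define i where "i = l - (n - 1)"
      have l: "l + 1 = n + i" using True n by (simp add: i_def)
      have X: "(X \<odot>\<^bsub>seq_module\<^esub> g) l = (if i < d then \<zero> else x \<odot> w i)"
      proof (cases "l = 0")
        case True
        then have "i < d" using l n by (simp add: d_def)
        then show ?thesis using True by (simp add: X_smult[OF g])
      next
        case False
        then have "l - 1 + 2 - n = i" using l by simp
        then have "g (l - 1) = w i" by (simp add: g_def)
        then show ?thesis using False w(3)[of i] x_carr by (simp add: X_smult[OF g])
      qed
      have P: "(p \<odot>\<^bsub>seq_module\<^esub> single m (n - 1)) l = p i \<odot> m"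
        using True by (simp add: smult_single[OF pc m] i_def)
      have pim: "p i \<odot> m \<in> carrier M" using rees_coeff_carr[OF pc] m by simp
      show ?thesis
      proof (cases "i < d")
        case True
        have "p i \<odot> m \<in> IM (l + 1)"
          using IM_mono_mem[OF K[OF p, of i], of "n + i"] True l by simp
        then show ?thesis unfolding X P using True IM_diff[OF IM_zero] by simp
      next
        case False
        then have "p i \<odot> m \<ominus> x \<odot> w i \<in> IM (l + 1)" using w(2)[of i] l by simp
        then show ?thesis unfolding X P
          using False diff_swap[OF IM_submodule pim _ ] w(1) x_carr by simp
      qed
    qed
    then have "L_class (X \<odot>\<^bsub>seq_module\<^esub> g) = L_class (p \<odot>\<^bsub>seq_module\<^esub> single m (n - 1))"
      using L_class_eq_iff[OF seq_smult_closed[OF X_carr g] seq_smult_closed[OF pc s]] by blast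
    then have "X \<odot>\<^bsub>L\<^esub> L_class g = p \<odot>\<^bsub>L\<^esub> L_class (single m (n - 1))"
      using L_class_smult[OF X_carr g] L_class_smult[OF pc s] by simp
    moreover have "L_class g \<in> L_above n0" unfolding L_above_def using g g0 by blast
    ultimately show ?thesis by blast
  qed
  then show ?thesis by blast
qed

text \<open>The preimages from \<open>exists_X_quotient\<close> are unique by \<open>X_injective_above\<close>, so they define a
  homomorphism \<open>f\<close> with $\varphi(f(p)) = pu$. Once \<open>f\<close> is multiplication by \<open>z\<close>, the difference
  $u - \varphi(z)$ is annihilated by the monomials $a t^k$ with $a \in I^k$ for large \<open>k\<close>, and its
  component of degree \<open>n - 1\<close> shows that \<open>m\<close> is congruent to an element of $\widetilde{I^nM}$
  modulo $xM$.\<close>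

lemma lifts_mod_if_scalar:
  assumes sc: "homs_eventually_scalar Rees \<MM> L"
  shows "lifts_mod x"
  unfolding lifts_mod_def
proof (intro allI impI ballI)
  fix n m assume n: "1 \<le> n" and m: "m \<in> carrier M" and rr: "in_RR_mod x n m"
  interpret L: module Rees L by (rule L_module_is_module)
  interpret S: module Rees seq_module by (rule seq_module_is_module)
  define u where "u = single m (n - 1)"
  have u: "u \<in> carrier seq_module" unfolding u_def by (rule single_seq[OF m])
  have U: "L_class u \<in> carrier L" by (rule L_class_closed[OF u])
  obtain K where K: "\<And>p. p \<in> ideal_power Rees \<MM> K \<Longrightarrow> \<exists>z\<in>L_above n0. X \<odot>\<^bsub>L\<^esub> z = p \<odot>\<^bsub>L\<^esub> L_class u"
    using exists_X_quotient[OF n m rr] unfolding u_def by blast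
  note above = L.submoduleE[OF L_above_submodule[of n0]]
  define f where "f p = (SOME z. z \<in> L_above n0 \<and> X \<odot>\<^bsub>L\<^esub> z = p \<odot>\<^bsub>L\<^esub> L_class u)" for p
  have f: "f p \<in> L_above n0" "X \<odot>\<^bsub>L\<^esub> f p = p \<odot>\<^bsub>L\<^esub> L_class u" if "p \<in> ideal_power Rees \<MM> K" for p
    using someI_ex[of "\<lambda>z. z \<in> L_above n0 \<and> X \<odot>\<^bsub>L\<^esub> z = p \<odot>\<^bsub>L\<^esub> L_class u"] K[OF that]
    unfolding f_def by blast+
  have uniq: "z = f p" if p: "p \<in> ideal_power Rees \<MM> K" and z: "z \<in> L_above n0"
    and Xz: "X \<odot>\<^bsub>L\<^esub> z = p \<odot>\<^bsub>L\<^esub> L_class u" for p z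
  proof -
    have c: "z \<in> carrier L" "f p \<in> carrier L" using z f(1)[OF p] above(1) by auto
    have "X \<odot>\<^bsub>L\<^esub> (z \<ominus>\<^bsub>L\<^esub> f p) = \<zero>\<^bsub>L\<^esub>"
      using f(2)[OF p] Xz c X_carr \<MM>_carr[OF p] U by (simp add: L.smult_diff L.diff_eq_zero_iff)
    then have "z \<ominus>\<^bsub>L\<^esub> f p = \<zero>\<^bsub>L\<^esub>"
      by (rule X_injective_above[OF L.submodule_diff[OF L_above_submodule z f(1)[OF p]]])
    then show ?thesis using L.diff_eq_zero_iff[OF c] by simp
  qed
  interpret MK: ideal "ideal_power Rees \<MM> K" Rees
    by (rule cring.ideal_power_ideal[OF rees_cring \<MM>_ideal])
  have "f \<in> mod_hom Rees (ideal_module Rees (ideal_power Rees \<MM> K)) L"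
    unfolding ideal_module_hom_iff
  proof (intro conjI ballI)
    fix p assume p: "p \<in> ideal_power Rees \<MM> K"
    show fc: "f p \<in> carrier L" using f(1)[OF p] above(1) by blast
    fix q assume q: "q \<in> ideal_power Rees \<MM> K"
    have fc': "f q \<in> carrier L" using f(1)[OF q] above(1) by blast
    have "X \<odot>\<^bsub>L\<^esub> (f p \<oplus>\<^bsub>L\<^esub> f q) = (p \<oplus>\<^bsub>Rees\<^esub> q) \<odot>\<^bsub>L\<^esub> L_class u"
      using f(2)[OF p] f(2)[OF q] fc fc' X_carr U \<MM>_carr[OF p] \<MM>_carr[OF q]
      by (simp add: L.smult_r_distr L.smult_l_distr)
    then show "f (p \<oplus>\<^bsub>Rees\<^esub> q) = f p \<oplus>\<^bsub>L\<^esub> f q"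
      using uniq[OF MK.a_closed[OF p q] above(5)[OF f(1)[OF p] f(1)[OF q]]] by simp
  next
    fix a p assume a: "a \<in> carrier Rees" and p: "p \<in> ideal_power Rees \<MM> K"
    have fc: "f p \<in> carrier L" using f(1)[OF p] above(1) by blast
    have "X \<odot>\<^bsub>L\<^esub> (a \<odot>\<^bsub>L\<^esub> f p) = (a \<otimes>\<^bsub>Rees\<^esub> p) \<odot>\<^bsub>L\<^esub> L_class u"
      using L.smult_commute[OF X_carr a fc] f(2)[OF p] L.smult_assoc1[OF a \<MM>_carr[OF p] U] by simp
    then show "f (a \<otimes>\<^bsub>Rees\<^esub> p) = a \<odot>\<^bsub>L\<^esub> f p"
      using uniq[OF MK.I_l_closed[OF p a] above(4)[OF a f(1)[OF p]]] by simp
  qed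
  then obtain k z where k: "k \<ge> K" and z: "z \<in> carrier L"
    and fz: "\<And>p. p \<in> ideal_power Rees \<MM> k \<Longrightarrow> f p = p \<odot>\<^bsub>L\<^esub> z"
    using sc unfolding homs_eventually_scalar_def by meson
  obtain g where g: "g \<in> carrier seq_module" "z = L_class g" using L_rep[OF z] by blast
  \<comment> \<open>The definition of $\widetilde{I^nM}$ asks for a positive exponent.\<close>
  define k' where "k' = max k 1"
  \<comment> \<open>The component of degree \<open>n - 1\<close> of $\varphi(z)$ is \<open>x \<odot> v\<close>; it is \<open>\<zero>\<close> in degree \<open>0\<close>.\<close>
  define v where "v = (if n = 1 then \<zero> else g (n - 2))"
  have v: "v \<in> carrier M" using seq_carr[OF g(1)] by (simp add: v_def)
  have Xg: "X \<odot>\<^bsub>seq_module\<^esub> g \<in> carrier seq_module" by (rule seq_smult_closed[OF X_carr g(1)])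
  have Xgn: "(X \<odot>\<^bsub>seq_module\<^esub> g) (n - 1) = x \<odot> v"
    using n x_carr by (auto simp: X_smult[OF g(1)] v_def numeral_2_eq_2)
  have "a \<odot> (m \<ominus> x \<odot> v) \<in> IM (n + k')" if a: "a \<in> ideal_power A I k'" for a
  proof -
    let ?p = "rees_monom a k'"
    have p: "?p \<in> ideal_power Rees \<MM> k'" by (rule rees_monom_\<MM>_power[OF a])
    have pk: "?p \<in> ideal_power Rees \<MM> k" by (rule \<MM>_antimono[OF _ p]) (simp add: k'_def)
    have pK: "?p \<in> ideal_power Rees \<MM> K" by (rule \<MM>_antimono[OF k pk])
    note pc = \<MM>_carr[OF p]
    have "L_class (?p \<odot>\<^bsub>seq_module\<^esub> u) = ?p \<odot>\<^bsub>L\<^esub> L_class u" by (rule L_class_smult[OF pc u])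
    also have "\<dots> = X \<odot>\<^bsub>L\<^esub> (?p \<odot>\<^bsub>L\<^esub> z)" using f(2)[OF pK] fz[OF pk] by simp
    also have "\<dots> = ?p \<odot>\<^bsub>L\<^esub> (X \<odot>\<^bsub>L\<^esub> z)" by (rule L.smult_commute[OF X_carr pc z])
    also have "\<dots> = L_class (?p \<odot>\<^bsub>seq_module\<^esub> (X \<odot>\<^bsub>seq_module\<^esub> g))"
      using L_class_smult[OF pc Xg] L_class_smult[OF X_carr g(1)] g(2) by simp
    finally have "(?p \<odot>\<^bsub>seq_module\<^esub> u) (k' + (n - 1)) \<ominus> (?p \<odot>\<^bsub>seq_module\<^esub> (X \<odot>\<^bsub>seq_module\<^esub> g)) (k' + (n - 1)) \<in> IM (k' + (n - 1) + 1)"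
      using L_class_eq_iff[OF seq_smult_closed[OF pc u] seq_smult_closed[OF pc Xg]] by blast
    moreover have "u (n - 1) = m" by (simp add: u_def single_def)
    moreover have "k' + (n - 1) + 1 = n + k'" using n by simp
    ultimately have "a \<odot> m \<ominus> a \<odot> (x \<odot> v) \<in> IM (n + k')"
      by (simp only: rees_monom_smult[OF u power_carr[OF a]] rees_monom_smult[OF Xg power_carr[OF a]]
          le_add1 if_True add_diff_cancel_left' Xgn)
    then show ?thesis using smult_diff[OF power_carr[OF a] m] v x_carr by simp
  qed
  then have "in_RR n (m \<ominus> x \<odot> v)" unfolding in_RR_def by (intro exI[of _ k']) (auto simp: k'_def)
  then show "\<exists>v\<in>carrier M. in_RR n (m \<ominus> x \<odot> v)" using v by blast
qed

text \<open>The surjectivity of $H^0(L) \to H^0(L^I(N))$, deduced from the lifting property one degree at a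
  time: the components of \<open>U\<close> represent elements of $\widetilde{I^{j+1}N}$, and lifting them
  changes \<open>U\<close> by an element of $\varphi(L)$ into a torsion element.\<close>

lemma torsion_lift:
  assumes lift: "lifts_mod x" and U: "U \<in> carrier L" and k: "k \<ge> 1"
    and div: "\<And>p. p \<in> ideal_power Rees \<MM> k \<Longrightarrow> \<exists>y\<in>carrier L. p \<odot>\<^bsub>L\<^esub> U = X \<odot>\<^bsub>L\<^esub> y"
  shows "\<exists>z\<in>carrier L. \<exists>K. \<forall>p\<in>ideal_power Rees \<MM> K. p \<odot>\<^bsub>L\<^esub> (U \<ominus>\<^bsub>L\<^esub> X \<odot>\<^bsub>L\<^esub> z) = \<zero>\<^bsub>L\<^esub>"
proof -
  interpret L: module Rees L by (rule L_module_is_module)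
  interpret S: module Rees seq_module by (rule seq_module_is_module)
  obtain u where u: "u \<in> carrier seq_module" "U = L_class u" using L_rep[OF U] by blast
  obtain b where b: "\<And>j. j > b \<Longrightarrow> u j = \<zero>" using seq_bound[OF u(1)] by blast
  have RRm: "in_RR_mod x (j + 1) (u j)" for j
  proof -
    have "\<exists>v\<in>carrier M. a \<odot> u j \<ominus> x \<odot> v \<in> IM (j + 1 + k)" if a: "a \<in> ideal_power A I k" for a
    proof -
      note p = rees_monom_\<MM>_power[OF a]
      note pc = \<MM>_carr[OF p]
      obtain y where y: "y \<in> carrier L" "rees_monom a k \<odot>\<^bsub>L\<^esub> U = X \<odot>\<^bsub>L\<^esub> y" using div[OF p] by blast
      obtain g where g: "g \<in> carrier seq_module" "y = L_class g" using L_rep[OF y(1)] by blast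
      have "L_class (rees_monom a k \<odot>\<^bsub>seq_module\<^esub> u) = L_class (X \<odot>\<^bsub>seq_module\<^esub> g)"
        using L_class_smult[OF pc u(1)] L_class_smult[OF X_carr g(1)] y(2) u(2) g(2) by simp
      then have "(rees_monom a k \<odot>\<^bsub>seq_module\<^esub> u) (k + j) \<ominus> (X \<odot>\<^bsub>seq_module\<^esub> g) (k + j) \<in> IM (k + j + 1)"
        using L_class_eq_iff[OF seq_smult_closed[OF pc u(1)] seq_smult_closed[OF X_carr g(1)]] by blast
      moreover have "k + j \<noteq> 0" "k + j + 1 = j + 1 + k" using k by auto
      ultimately have "a \<odot> u j \<ominus> x \<odot> g (k + j - 1) \<in> IM (j + 1 + k)"
        by (simp only: rees_monom_smult[OF u(1) power_carr[OF a]] X_smult[OF g(1)] le_add1 if_True if_False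
            add_diff_cancel_left')
      then show ?thesis using seq_carr[OF g(1)] by blast
    qed
    then show ?thesis unfolding in_RR_mod_def using k by blast
  qed
  have zero_RR: "in_RR n \<zero>" for n
    unfolding in_RR_def using power_carr IM_zero by (intro exI[of _ 1]) auto
  have "\<exists>v. v \<in> carrier M \<and> in_RR (j + 1) (u j \<ominus> x \<odot> v) \<and> (j > b \<longrightarrow> v = \<zero>)" for j
  proof (cases "j > b")
    case True
    then show ?thesis using b[OF True] zero_RR x_carr by (intro exI[of _ "\<zero>"]) (simp add: diff_zero)
  next
    case False
    have "\<exists>v\<in>carrier M. in_RR (j + 1) (u j \<ominus> x \<odot> v)"
      using lift RRm[of j] seq_carr[OF u(1), of j] unfolding lifts_mod_def by (meson le_add2)
    then show ?thesis using False by blast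
  qed
  then obtain v where v: "\<And>j. v j \<in> carrier M" "\<And>j. in_RR (j + 1) (u j \<ominus> x \<odot> v j)"
    "\<And>j. j > b \<Longrightarrow> v j = \<zero>" by metis
  \<comment> \<open>The sequence \<open>w\<close> represents the torsion element. In degree \<open>0\<close> it differs from \<open>u - \<phi>(g)\<close> by
    \<open>x \<odot> v 0\<close>, which vanishes modulo \<open>IM\<close> since \<open>x \<in> I\<close>.\<close>
  define w where "w j = u j \<ominus> x \<odot> v j" for j
  define g where "g j = v (j + 1)" for j
  have wc: "w j \<in> carrier M" for j using v(1) x_carr seq_carr[OF u(1)] by (simp add: w_def)
  have w: "w \<in> carrier seq_module"
    by (rule seqI[of _ b]) (use wc b v(3) x_carr in \<open>auto simp: w_def diff_zero\<close>)
  have g: "g \<in> carrier seq_module"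
    by (rule seqI[of _ b]) (use v in \<open>auto simp: g_def\<close>)
  note Xg = seq_smult_closed[OF X_carr g]
  have ux: "u n \<ominus> x \<odot> v n \<ominus> w n = \<zero>" for n
    using wc[of n] unfolding w_def by (simp add: a_minus_def M.r_neg)
  have eq: "L_class (u \<ominus>\<^bsub>seq_module\<^esub> X \<odot>\<^bsub>seq_module\<^esub> g) = L_class w"
  proof -
    have neg: "(\<ominus>\<^bsub>seq_module\<^esub> h) n = \<ominus> h n" if h: "h \<in> carrier seq_module" for h n
    proof -
      have "(\<ominus>\<^bsub>seq_module\<^esub> h \<oplus>\<^bsub>seq_module\<^esub> h) n = \<zero>"
        using S.M.l_neg[OF h] by (simp add: seq_module_def)
      then show ?thesis
        using M.minus_equality seq_carr[OF h] seq_carr[OF S.M.a_inv_closed[OF h]] by (simp add: seq_add)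
    qed
    have "(u \<ominus>\<^bsub>seq_module\<^esub> X \<odot>\<^bsub>seq_module\<^esub> g) n \<ominus> w n \<in> IM (n + 1)" for n
    proof -
      have d: "(u \<ominus>\<^bsub>seq_module\<^esub> X \<odot>\<^bsub>seq_module\<^esub> g) n = u n \<ominus> (X \<odot>\<^bsub>seq_module\<^esub> g) n"
        using neg[OF Xg] by (simp add: a_minus_def seq_add)
      show ?thesis
      proof (cases "n = 0")
        case True
        have "x \<odot> v 0 \<in> IM 1"
          using ideal_mult_module_prod[OF x_power v(1)] .
        moreover have "u 0 \<ominus> \<zero> \<ominus> w 0 = x \<odot> v 0"
          unfolding w_def using v(1) x_carr seq_carr[OF u(1)] by (simp add: diff_zero diff_diff)
        ultimately show ?thesis unfolding d X_smult[OF g] using True by simp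
      next
        case False
        then have "(X \<odot>\<^bsub>seq_module\<^esub> g) n = x \<odot> v n" by (simp add: X_smult[OF g] g_def)
        then show ?thesis using ux[of n] IM_zero by (simp add: d)
      qed
    qed
    then show ?thesis using L_class_eq_iff[OF _ w] S.M.minus_closed[OF u(1) Xg] by blast
  qed
  have "\<exists>K. \<forall>p\<in>ideal_power Rees \<MM> K. \<forall>i. p i \<odot> w j \<in> IM (i + (j + 1))" for j
    using in_RR_torsion[OF wc v(2)[of j, folded w_def]] .
  then obtain K where K: "\<And>j p i. p \<in> ideal_power Rees \<MM> (K j) \<Longrightarrow> p i \<odot> w j \<in> IM (i + (j + 1))"
    by metis
  define KK where "KK = Max (K ` {..b})"
  have "p \<odot>\<^bsub>L\<^esub> L_class w = \<zero>\<^bsub>L\<^esub>" if p: "p \<in> ideal_power Rees \<MM> KK" for p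
  proof -
    note pc = \<MM>_carr[OF p]
    have pw: "p i \<odot> w j \<in> IM (i + (j + 1))" for i j
    proof (cases "j \<le> b")
      case True
      then have "K j \<le> KK" unfolding KK_def by (intro Max_ge) auto
      then show ?thesis using K[OF \<MM>_antimono[OF _ p]] by blast
    next
      case False
      then have "w j = \<zero>" using b[of j] v(3)[of j] x_carr by (simp add: w_def diff_zero)
      then show ?thesis using IM_zero rees_coeff_carr[OF pc] by simp
    qed
    have "(p \<odot>\<^bsub>seq_module\<^esub> w) n \<in> IM (n + 1)" for n
      unfolding seq_smult
    proof (rule finsum_in_submodule[OF IM_submodule])
      fix i assume "i \<in> {..n}"
      then have "i + (n - i + 1) = n + 1" by simp
      then show "p i \<odot> w (n - i) \<in> IM (n + 1)" using pw[of i "n - i"] by (simp only:)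
    qed simp
    then show ?thesis using L_class_zero_iff[OF seq_smult_closed[OF pc w]] L_class_smult[OF pc w] by simp
  qed
  moreover have "L_class w = U \<ominus>\<^bsub>L\<^esub> X \<odot>\<^bsub>L\<^esub> L_class g"
    using eq L_class_diff[OF u(1) Xg] L_class_smult[OF X_carr g] u(2) by simp
  ultimately show ?thesis using L_class_closed[OF g] by auto
qed

text \<open>The injectivity of $\varphi$ on $H^1(L)$. By \<open>torsion_lift\<close> one may subtract a multiplication
  from \<open>g\<close> and assume that it takes values in the kernel of $\varphi$ on a power of $\mathfrak M$.
  That kernel is annihilated by $\mathfrak M^s$, so \<open>g\<close> vanishes on the product of that power with
  $\mathfrak M^s$.\<close>

lemma scalar_descends:
  assumes lift: "lifts_mod x"
    and g: "g \<in> mod_hom Rees (ideal_module Rees (ideal_power Rees \<MM> k)) L"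
    and U: "U \<in> carrier L" and Xg: "\<And>p. p \<in> ideal_power Rees \<MM> k \<Longrightarrow> X \<odot>\<^bsub>L\<^esub> g p = p \<odot>\<^bsub>L\<^esub> U"
  shows "\<exists>k'\<ge>k. \<exists>z\<in>carrier L. \<forall>p\<in>ideal_power Rees \<MM> k'. g p = p \<odot>\<^bsub>L\<^esub> z"
proof -
  interpret Re: cring Rees by (rule rees_cring)
  interpret L: module Rees L by (rule L_module_is_module)
  have gc: "g p \<in> carrier L" and ga: "q \<in> ideal_power Rees \<MM> k \<Longrightarrow> g (p \<oplus>\<^bsub>Rees\<^esub> q) = g p \<oplus>\<^bsub>L\<^esub> g q"
    and gs: "a \<in> carrier Rees \<Longrightarrow> g (a \<otimes>\<^bsub>Rees\<^esub> p) = a \<odot>\<^bsub>L\<^esub> g p"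
    if "p \<in> ideal_power Rees \<MM> k" for p q a
    using g that unfolding ideal_module_hom_iff by blast+
  have "\<exists>y\<in>carrier L. p \<odot>\<^bsub>L\<^esub> U = X \<odot>\<^bsub>L\<^esub> y" if "p \<in> ideal_power Rees \<MM> (max k 1)" for p
  proof -
    have "p \<in> ideal_power Rees \<MM> k" by (rule \<MM>_antimono[OF _ that]) simp
    then show ?thesis using Xg gc by metis
  qed
  then obtain z K where z: "z \<in> carrier L"
    and K: "\<And>p. p \<in> ideal_power Rees \<MM> K \<Longrightarrow> p \<odot>\<^bsub>L\<^esub> (U \<ominus>\<^bsub>L\<^esub> X \<odot>\<^bsub>L\<^esub> z) = \<zero>\<^bsub>L\<^esub>"
    using torsion_lift[OF lift U, of "max k 1"] by auto
  obtain s where s: "\<And>b p. b \<in> carrier L \<Longrightarrow> X \<odot>\<^bsub>L\<^esub> b = \<zero>\<^bsub>L\<^esub> \<Longrightarrow> p \<in> ideal_power Rees \<MM> s \<Longrightarrow> p \<odot>\<^bsub>L\<^esub> b = \<zero>\<^bsub>L\<^esub>"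
    using X_kernel_torsion by blast
  let ?k = "max K k"
  have "g p = p \<odot>\<^bsub>L\<^esub> z" if p: "p \<in> ideal_power Rees \<MM> (s + ?k)" for p
  proof (rule Re.ideal_power_split[OF \<MM>_ideal p])
    fix q r assume q: "q \<in> ideal_power Rees \<MM> s" and r: "r \<in> ideal_power Rees \<MM> ?k"
    have rK: "r \<in> ideal_power Rees \<MM> K" and rk: "r \<in> ideal_power Rees \<MM> k"
      by (rule \<MM>_antimono[OF _ r]; simp)+
    note rc = \<MM>_carr[OF r] and qc = \<MM>_carr[OF q]
    have Xr: "X \<odot>\<^bsub>L\<^esub> (g r \<ominus>\<^bsub>L\<^esub> r \<odot>\<^bsub>L\<^esub> z) = r \<odot>\<^bsub>L\<^esub> (U \<ominus>\<^bsub>L\<^esub> X \<odot>\<^bsub>L\<^esub> z)"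
      using Xg[OF rk] gc[OF rk] rc z X_carr U by (simp add: L.smult_diff L.smult_commute[OF X_carr rc z])
    have "q \<odot>\<^bsub>L\<^esub> (g r \<ominus>\<^bsub>L\<^esub> r \<odot>\<^bsub>L\<^esub> z) = \<zero>\<^bsub>L\<^esub>"
    proof (rule s[OF _ _ q])
      show "g r \<ominus>\<^bsub>L\<^esub> r \<odot>\<^bsub>L\<^esub> z \<in> carrier L" using gc[OF rk] rc z by simp
      show "X \<odot>\<^bsub>L\<^esub> (g r \<ominus>\<^bsub>L\<^esub> r \<odot>\<^bsub>L\<^esub> z) = \<zero>\<^bsub>L\<^esub>" using Xr K[OF rK] by simp
    qed
    then have "q \<odot>\<^bsub>L\<^esub> g r = q \<odot>\<^bsub>L\<^esub> (r \<odot>\<^bsub>L\<^esub> z)"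
      using gc[OF rk] rc qc z by (simp add: L.smult_diff L.diff_eq_zero_iff)
    then show "g (q \<otimes>\<^bsub>Rees\<^esub> r) = (q \<otimes>\<^bsub>Rees\<^esub> r) \<odot>\<^bsub>L\<^esub> z"
      using gs[OF rk qc] L.smult_assoc1[OF qc rc z] by simp
  next
    fix q r assume q: "q \<in> ideal_power Rees \<MM> (s + ?k)" and r: "r \<in> ideal_power Rees \<MM> (s + ?k)"
      and eq: "g q = q \<odot>\<^bsub>L\<^esub> z" "g r = r \<odot>\<^bsub>L\<^esub> z"
    have "q \<in> ideal_power Rees \<MM> k" "r \<in> ideal_power Rees \<MM> k"
      by (rule \<MM>_antimono[OF _ q], simp, rule \<MM>_antimono[OF _ r], simp)
    then show "g (q \<oplus>\<^bsub>Rees\<^esub> r) = (q \<oplus>\<^bsub>Rees\<^esub> r) \<odot>\<^bsub>L\<^esub> z"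
      using ga[of q r] eq L.smult_l_distr[OF \<MM>_carr[OF q] \<MM>_carr[OF r] z] by simp
  qed
  then show ?thesis using z by (intro exI[of _ "s + ?k"]) auto
qed

text \<open>Since $(xt)^n f(p) = f((xt)^n p) = p f((xt)^n)$, the composite of \<open>f\<close> with the \<open>n\<close>-th power
  of $\varphi$ is a multiplication; \<open>scalar_descends\<close> then removes the \<open>n\<close> factors.\<close>

lemma scalar_if_lifts_mod:
  assumes lift: "lifts_mod x"
  shows "homs_eventually_scalar Rees \<MM> L"
  unfolding homs_eventually_scalar_def
proof (intro allI ballI)
  fix n f assume f: "f \<in> mod_hom Rees (ideal_module Rees (ideal_power Rees \<MM> n)) L"
  interpret Re: cring Rees by (rule rees_cring)
  interpret L: module Rees L by (rule L_module_is_module)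
  note fD = f[unfolded ideal_module_hom_iff]
  have fc: "f p \<in> carrier L" and fs: "a \<in> carrier Rees \<Longrightarrow> f (a \<otimes>\<^bsub>Rees\<^esub> p) = a \<odot>\<^bsub>L\<^esub> f p"
    if "p \<in> ideal_power Rees \<MM> n" for p a
    using fD that by blast+
  define Y where "Y s = X [^]\<^bsub>Rees\<^esub> (s::nat)" for s
  have Y: "Y s \<in> carrier Rees" for s unfolding Y_def using X_carr by simp
  have YS: "Y (Suc s) = X \<otimes>\<^bsub>Rees\<^esub> Y s" for s
    using X_carr Y[of s] by (simp add: Y_def Re.m_comm)
  have XM: "X \<in> \<MM>"
    using rees_monom_\<MM>_power[OF x_power] Re.ideal_power_one[OF \<MM>_ideal] by (simp add: X_def)
  have YM: "Y s \<in> ideal_power Rees \<MM> s" for s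
  proof (induction s)
    case (Suc s)
    then show ?case unfolding YS ideal_power.simps(2) by (intro ideal_prod.prod XM)
  qed (use Y[of 0] in simp)
  have "\<exists>k\<ge>n. \<exists>z\<in>carrier L. \<forall>p\<in>ideal_power Rees \<MM> k. Y (n - s) \<odot>\<^bsub>L\<^esub> f p = p \<odot>\<^bsub>L\<^esub> z" for s
  proof (induction s)
    case 0
    have "Y n \<odot>\<^bsub>L\<^esub> f p = p \<odot>\<^bsub>L\<^esub> f (Y n)" if p: "p \<in> ideal_power Rees \<MM> n" for p
      using fs[OF p Y[of n]] fs[OF YM \<MM>_carr[OF p]] Re.m_comm[OF Y[of n] \<MM>_carr[OF p]] by simp
    then show ?case using fc[OF YM] by (intro exI[of _ n]) auto
  next
    case (Suc s)
    show ?case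
    proof (cases "s < n")
      case False
      then show ?thesis using Suc by simp
    next
      case True
      then have ns: "n - s = Suc (n - Suc s)" by simp
      obtain k U where k: "k \<ge> n" and U: "U \<in> carrier L"
        and kU: "\<And>p. p \<in> ideal_power Rees \<MM> k \<Longrightarrow> Y (n - s) \<odot>\<^bsub>L\<^esub> f p = p \<odot>\<^bsub>L\<^esub> U"
        using Suc by meson
      let ?g = "\<lambda>p. Y (n - Suc s) \<odot>\<^bsub>L\<^esub> f p"
      note mem = \<MM>_antimono[OF k]
      have "?g \<in> mod_hom Rees (ideal_module Rees (ideal_power Rees \<MM> k)) L"
        unfolding ideal_module_hom_iff
      proof (intro conjI ballI)
        fix p assume p: "p \<in> ideal_power Rees \<MM> k"
        show "?g p \<in> carrier L" using fc[OF mem[OF p]] Y by simp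
        fix q assume q: "q \<in> ideal_power Rees \<MM> k"
        show "?g (p \<oplus>\<^bsub>Rees\<^esub> q) = ?g p \<oplus>\<^bsub>L\<^esub> ?g q"
          using fD mem[OF p] mem[OF q] fc Y by (simp add: L.smult_r_distr)
      next
        fix a p assume a: "a \<in> carrier Rees" and p: "p \<in> ideal_power Rees \<MM> k"
        show "?g (a \<otimes>\<^bsub>Rees\<^esub> p) = a \<odot>\<^bsub>L\<^esub> ?g p"
          using fs[OF mem[OF p] a] L.smult_commute[OF Y a fc[OF mem[OF p]]] by simp
      qed
      moreover have "X \<odot>\<^bsub>L\<^esub> ?g p = p \<odot>\<^bsub>L\<^esub> U" if p: "p \<in> ideal_power Rees \<MM> k" for p
        using kU[OF p] L.smult_assoc1[OF X_carr Y fc[OF mem[OF p]]] by (simp add: ns YS)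
      ultimately obtain k' z where "k' \<ge> k" "z \<in> carrier L"
        "\<And>p. p \<in> ideal_power Rees \<MM> k' \<Longrightarrow> ?g p = p \<odot>\<^bsub>L\<^esub> z"
        using scalar_descends[OF lift _ U] by meson
      then show ?thesis using k by (meson le_trans)
    qed
  qed
  from this[of n] show "\<exists>k\<ge>n. \<exists>z\<in>carrier L. \<forall>p\<in>ideal_power Rees \<MM> k. f p = p \<odot>\<^bsub>L\<^esub> z"
  proof (elim exE conjE bexE)
    fix k z assume k: "k \<ge> n" and z: "z \<in> carrier L"
      and eq: "\<forall>p\<in>ideal_power Rees \<MM> k. Y (n - n) \<odot>\<^bsub>L\<^esub> f p = p \<odot>\<^bsub>L\<^esub> z"
    have "f p = p \<odot>\<^bsub>L\<^esub> z" if p: "p \<in> ideal_power Rees \<MM> k" for p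
    proof -
      have "Y (n - n) \<odot>\<^bsub>L\<^esub> f p = f p" using fc[OF \<MM>_antimono[OF k p]] by (simp add: Y_def)
      then show ?thesis using eq p by simp
    qed
    then show ?thesis using k z by blast
  qed
qed

end

theorem theorem3p3:
  fixes A :: "('a, 'x) ring_scheme"
    and M :: "('a, 'm) module"
    and \<mm> I :: "'a set"
    and x :: 'a
    and r :: nat
  assumes "noetherian_ring A"
    and "local_ring A \<mm>"
    and "infinite (carrier (A Quot \<mm>))"
    and "fg_module A M"
    and "cohen_macaulay_module A \<mm> M"
    and "module_dim A M = enat r"
    and "r \<ge> 2"
    and "ideal_of_definition A \<mm> I M"
    and "superficial A I M x"
  shows "ratliff_rush_behaves_well A I M x \<longleftrightarrow>
    carrier (local_cohomology (rees_algebra A I) (rees_maximal_ideal A \<mm> I) 1 (L_module A I M)) =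
    {\<zero>\<^bsub>local_cohomology (rees_algebra A I) (rees_maximal_ideal A \<mm> I) 1 (L_module A I M)\<^esub>}"
proof -
  interpret M: module A M using assms(4) by (simp add: fg_module_def)
  have I: "ideal I A" "I \<subseteq> \<mm>" and len: "finite_length A (M QuotM ideal_mult_module A I M)"
    using assms(8) by (auto simp: ideal_of_definition_def)
  have mi: "ideal \<mm> A" using assms(2) by (simp add: local_ring_def maximalideal_def)
  interpret adic_module A M I
    by (intro adic_module.intro M.module_axioms adic_module_axioms.intro I(1))
  have IM1: "IM 1 = ideal_mult_module A I M" using M.R.ideal_power_one[OF I(1)] by simp
  obtain n0 where xI: "x \<in> I" and n0: "\<And>n. n \<ge> n0 \<Longrightarrow> colon_module M (IM (n + 1)) {x} = IM n"
    using assms(9) unfolding superficial_def by blast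
  have "\<exists>t. \<forall>a\<in>ideal_power A \<mm> t. \<forall>m\<in>carrier M. a \<odot>\<^bsub>M\<^esub> m \<in> IM 1"
  proof -
    let ?N = "M QuotM IM 1"
    note q = M.quot_map[OF IM_submodule[of 1]]
    note qD = mod_homD[OF q(1)]
    obtain t where t: "\<And>a y. a \<in> ideal_power A \<mm> t \<Longrightarrow> y \<in> carrier ?N \<Longrightarrow> a \<odot>\<^bsub>?N\<^esub> y = \<zero>\<^bsub>?N\<^esub>"
      using finite_length_annihilated[OF assms(1,2) len] unfolding IM1 by blast
    have "a \<odot>\<^bsub>M\<^esub> m \<in> IM 1" if a: "a \<in> ideal_power A \<mm> t" and m: "m \<in> carrier M" for a m
    proof -
      have ac: "a \<in> carrier A" using ideal.Icarr[OF M.R.ideal_power_ideal[OF mi] a] .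
      have "IM 1 +>\<^bsub>M\<^esub> (a \<odot>\<^bsub>M\<^esub> m) = IM 1 +>\<^bsub>M\<^esub> \<zero>\<^bsub>M\<^esub>"
        using qD(3)[OF ac m] t[OF a qD(1)[OF m]] q(3) by simp
      then have "a \<odot>\<^bsub>M\<^esub> m \<ominus>\<^bsub>M\<^esub> \<zero>\<^bsub>M\<^esub> \<in> IM 1"
        using M.coset_eq_iff[OF IM_submodule[of 1], of "a \<odot>\<^bsub>M\<^esub> m" "\<zero>\<^bsub>M\<^esub>"] ac m by simp
      then show ?thesis using ac m by (simp add: M.diff_zero)
    qed
    then show ?thesis by blast
  qed
  moreover have "m \<in> IM n" if "n \<ge> n0" "m \<in> carrier M" "x \<odot>\<^bsub>M\<^esub> m \<in> IM (n + 1)" for n m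
    using n0[OF that(1)] that(2,3) by (auto simp: colon_module_def)
  ultimately interpret superficial_module A M I \<mm> x n0
    by (intro superficial_module.intro adic_module_axioms superficial_module_axioms.intro mi I(2) xI)
  have "ratliff_rush_behaves_well A I M x \<longleftrightarrow> homs_eventually_scalar Rees \<MM> L"
    using behaves_well_iff_lifts_mod[OF x_carr] lifts_mod_if_scalar scalar_if_lifts_mod by blast
  then show ?thesis
    using first_local_cohomology_zero_iff[OF L_module_is_module \<MM>_ideal] by simp
qed

end
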